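(* Let $R$ be a noetherian commutative ring and let $P=(A,C)$ be a measuring $\alpha$-pairing over $R$. 1. If $P$ is coreflexive, then $C=A^{\circ}$. 2. Assume $R$ to be artinian. Then $P$ is coreflexive if and only if all $R$-cofinite (two-sided) ideals of $A$ are closed with respect to the linear weak topology $A[\mathfrak{T}_{ls}(C)]$ (which equals the right $C$-adic topology $\mathcal{T}_{-C}(A)$). 3. If $A$ is cofinitely $R$-cogenerated, then the following statements are equivalent: (i) $P$ is coreflexive; (ii) $C=A^{\circ}$; (iii) every locally finite left $A$-module is $C$-rational, i.e. $\mathrm{Loc}({}_A\mathcal{M})=\sigma[{}_AC]$.
   Context: $R$ is a commutative ring with $1\neq 0$; $\otimes,\mathrm{Hom}$ are over $R$, $L^{\ast}=\mathrm{Hom}_R(L,R)$. Algebras are associative unital, modules unitary, coalgebras coassociative and counital. For an $R$-coalgebra $(C,\Delta,\varepsilon)$, $C^{\ast}$ is an $R$-algebra under convolution $(f\star g)(c)=\sum f(c_1)g(c_2)$ with unit $\varepsilon$. A measuring $\alpha$-pairing $P=(A,C)$ consists of an $R$-algebra $A$, an $R$-coalgebra $C$ and an $R$-bilinear form $\langle\,,\rangle:A\times C\to R$ such that $\kappa_P:A\to C^{\ast}$, $a\mapsto\langle a,-\rangle$ is an algebra morphism and for every $R$-module $X$ the map $X\otimes C\to\mathrm{Hom}_R(A,X)$, $\sum x_i\otimes c_i\mapsto[a\mapsto\sum x_i\langle a,c_i\rangle]$ is injective. In particular $\chi_P:C\to A^{\ast}$ is injective, and $C$ is identified with its image, which lies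 in $A^{\circ}$. $C$ is an $A$-bimodule via $a\rightharpoonup c=\sum c_1\langle a,c_2\rangle$, $c\leftharpoonup a=\sum\langle a,c_1\rangle c_2$. An ideal or submodule is $R$-cofinite if the quotient is a finitely generated $R$-module. $A^{\circ}=\{f\in A^{\ast}\mid f(I)=0\text{ for some } R\text{-cofinite two-sided ideal } I\}$. $A$ is cofinitely $R$-cogenerated if $A/I$ embeds in a product of copies of $R$ for every $R$-cofinite ideal $I$. $A[\mathfrak{T}_{ls}(C)]$ has neighbourhood basis of $0$ given by $K^{\perp}=\{a\in A\mid\langle a,K\rangle=0\}$, $K\subseteq C$ a finitely generated $R$-submodule. $\mathcal{T}_{-C}(A)$ has neighbourhood basis of $0$ given by $\{a\in A\mid W\leftharpoonup a=0\}$, $W\subseteq C$ finite. The cofinite topology $\mathrm{Cf}(A)$ has neighbourhood basis of $0$ given by the $R$-cofinite two-sided ideals of $A$ (equivalently, since $R$ is noetherian, by the $R$-cofinite right ideals). $P$ is coreflexive if $A[\mathfrak{T}_{ls}(C)]=\mathrm{Cf}(A)$. A left $A$-module $X$ is locally finite if $Ax$ is a finitely generated $R$-module for every $x\in X$; $\mathrm{Loc}({}_A\mathcal{M})$ is the full subcategory of these. $X$ is $C$-rational if for every $x\in X$ there is $\sum x_i\otimes c_i\in X\otimes C$ with $ax=\sum x_i\langle a,c_i\rangle$ for all $a\in A$. $\sigma[{}_AC]$ is the full subcategory of left $A$-modules isomorphic to a submodule of a $C$-generated module (a quotient of a direct sum of copies of ${}_AC$); for a measuring $\alpha$-pairing it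 coincides with the category of $C$-rational left $A$-modules. *)

theory Defs
  imports "HOL-Algebra.Module" "HOL-Algebra.Ring_Divisibility" "HOL-Analysis.Abstract_Topology"
begin

section \<open>Modules\<close>

text \<open>Where an operation builds only a module, the ring fields \<open>mult\<close> and \<open>one\<close> of the record carry no meaning and are left
  \<open>undefined\<close>. Several definitions are also used with the noncommutative ring \<open>A\<close> in the place
  of the scalar ring \<open>R\<close>; nothing in them depends on commutativity.\<close>

definition regular_module :: "('r, 'k) ring_scheme \<Rightarrow> ('r, 'r) module" where
  "regular_module R = \<lparr>carrier = carrier R, monoid.mult = monoid.mult R, one = one R,
     zero = zero R, add = add R, smult = monoid.mult R\<rparr>"

definition linear_maps ::
  "('r, 'k) ring_scheme \<Rightarrow> ('r, 'b, 'm) module_scheme \<Rightarrow> ('r, 'd, 'n) module_scheme \<Rightarrow> ('b \<Rightarrow> 'd) set"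
where
  "linear_maps R M N = {f \<in> carrier M \<rightarrow> carrier N.
     (\<forall>x\<in>carrier M. \<forall>y\<in>carrier M. f (x \<oplus>\<^bsub>M\<^esub> y) = f x \<oplus>\<^bsub>N\<^esub> f y) \<and>
     (\<forall>r\<in>carrier R. \<forall>x\<in>carrier M. f (r \<odot>\<^bsub>M\<^esub> x) = r \<odot>\<^bsub>N\<^esub> f x)}"

text \<open>Elements of \<open>Hom_module R M N\<close> are extensional, so that equality of elements is equality
  of functions on the carrier of \<open>M\<close>.\<close>

definition Hom_module ::
  "('r, 'k) ring_scheme \<Rightarrow> ('r, 'b, 'm) module_scheme \<Rightarrow> ('r, 'd, 'n) module_scheme \<Rightarrow>
   ('r, 'b \<Rightarrow> 'd) module"
where
  "Hom_module R M N = \<lparr>carrier = linear_maps R M N \<inter> extensional (carrier M),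
     monoid.mult = undefined, one = undefined,
     zero = (\<lambda>x\<in>carrier M. \<zero>\<^bsub>N\<^esub>),
     add = (\<lambda>f g. \<lambda>x\<in>carrier M. f x \<oplus>\<^bsub>N\<^esub> g x),
     smult = (\<lambda>r f. \<lambda>x\<in>carrier M. r \<odot>\<^bsub>N\<^esub> f x)\<rparr>"

definition dual_module ::
  "('r, 'k) ring_scheme \<Rightarrow> ('r, 'b, 'm) module_scheme \<Rightarrow> ('r, 'b \<Rightarrow> 'r) module" where
  "dual_module R M = Hom_module R M (regular_module R)"

definition power_module :: "'i set \<Rightarrow> ('r, 'b, 'm) module_scheme \<Rightarrow> ('r, 'i \<Rightarrow> 'b) module" where
  "power_module I M = \<lparr>carrier = I \<rightarrow>\<^sub>E carrier M,
     monoid.mult = undefined, one = undefined,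
     zero = (\<lambda>i\<in>I. \<zero>\<^bsub>M\<^esub>),
     add = (\<lambda>f g. \<lambda>i\<in>I. f i \<oplus>\<^bsub>M\<^esub> g i),
     smult = (\<lambda>r f. \<lambda>i\<in>I. r \<odot>\<^bsub>M\<^esub> f i)\<rparr>"

definition copower_module :: "'i set \<Rightarrow> ('r, 'b, 'm) module_scheme \<Rightarrow> ('r, 'i \<Rightarrow> 'b) module" where
  "copower_module I M = (power_module I M)
     \<lparr>carrier := {f \<in> I \<rightarrow>\<^sub>E carrier M. finite {i \<in> I. f i \<noteq> \<zero>\<^bsub>M\<^esub>}}\<rparr>"

definition quotient_module :: "('r, 'b, 'm) module_scheme \<Rightarrow> 'b set \<Rightarrow> ('r, 'b set) module" where
  "quotient_module M N = \<lparr>carrier = a_rcosets\<^bsub>M\<^esub> N,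
     monoid.mult = undefined, one = undefined,
     zero = N,
     add = (\<lambda>S T. S <+>\<^bsub>M\<^esub> T),
     smult = (\<lambda>r S. \<Union>x\<in>S. N +>\<^bsub>M\<^esub> (r \<odot>\<^bsub>M\<^esub> x))\<rparr>"

definition submodule_span ::
  "('r, 'k) ring_scheme \<Rightarrow> ('r, 'b, 'm) module_scheme \<Rightarrow> 'b set \<Rightarrow> 'b set" where
  "submodule_span R M S = \<Inter>{N. submodule N R M \<and> S \<subseteq> N}"

definition fg_submodule ::
  "('r, 'k) ring_scheme \<Rightarrow> ('r, 'b, 'm) module_scheme \<Rightarrow> 'b set \<Rightarrow> bool" where
  "fg_submodule R M K \<longleftrightarrow> (\<exists>S. finite S \<and> S \<subseteq> carrier M \<and> K = submodule_span R M S)"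

definition fg_module :: "('r, 'k) ring_scheme \<Rightarrow> ('r, 'b, 'm) module_scheme \<Rightarrow> bool" where
  "fg_module R M \<longleftrightarrow> fg_submodule R M (carrier M)"

text \<open>The index set may be taken inside the carrier type of \<open>M\<close>: if \<open>M\<close> embeds in any power of
  \<open>R\<close>, then choosing for every nonzero element one coordinate at which it does not vanish gives
  an embedding in a power indexed by at most as many elements as \<open>M\<close> has.\<close>

definition embeds_in_power_of_ring ::
  "('r, 'k) ring_scheme \<Rightarrow> ('r, 'b, 'm) module_scheme \<Rightarrow> bool" where
  "embeds_in_power_of_ring R M \<longleftrightarrow>
     (\<exists>(I :: 'b set). \<exists>h \<in> linear_maps R M (power_module I (regular_module R)).
        inj_on h (carrier M))"

locale artinian_ring = ring +
  assumes descending_chain: "\<And>I :: nat \<Rightarrow> 'a set.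
    \<lbrakk>\<And>n. ideal (I n) R; \<And>n. I (Suc n) \<subseteq> I n\<rbrakk> \<Longrightarrow> \<exists>n. \<forall>m\<ge>n. I m = I n"


section \<open>Tensor products\<close>

text \<open>The tensor product is the free \<open>R\<close>-module on the set of pairs modulo the bilinearity
  relations.\<close>

definition free_on_pairs ::
  "('r, 'k) ring_scheme \<Rightarrow> ('r, 'b, 'm) module_scheme \<Rightarrow> ('r, 'd, 'n) module_scheme \<Rightarrow>
   ('r, 'b \<times> 'd \<Rightarrow> 'r) module"
where
  "free_on_pairs R M N = copower_module (carrier M \<times> carrier N) (regular_module R)"

definition pair_gen ::
  "('r, 'k) ring_scheme \<Rightarrow> ('r, 'b, 'm) module_scheme \<Rightarrow> ('r, 'd, 'n) module_scheme \<Rightarrow>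
   'b \<Rightarrow> 'd \<Rightarrow> ('b \<times> 'd \<Rightarrow> 'r)"
where
  "pair_gen R M N x y =
     (\<lambda>q\<in>carrier M \<times> carrier N. if q = (x, y) then \<one>\<^bsub>R\<^esub> else \<zero>\<^bsub>R\<^esub>)"

definition tensor_relations ::
  "('r, 'k) ring_scheme \<Rightarrow> ('r, 'b, 'm) module_scheme \<Rightarrow> ('r, 'd, 'n) module_scheme \<Rightarrow>
   ('b \<times> 'd \<Rightarrow> 'r) set"
where
  "tensor_relations R M N =
     (let F = free_on_pairs R M N; g = pair_gen R M N in
      {g (x \<oplus>\<^bsub>M\<^esub> x') y \<ominus>\<^bsub>F\<^esub> (g x y \<oplus>\<^bsub>F\<^esub> g x' y) | x x' y.
         x \<in> carrier M \<and> x' \<in> carrier M \<and> y \<in> carrier N} \<union>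
      {g x (y \<oplus>\<^bsub>N\<^esub> y') \<ominus>\<^bsub>F\<^esub> (g x y \<oplus>\<^bsub>F\<^esub> g x y') | x y y'.
         x \<in> carrier M \<and> y \<in> carrier N \<and> y' \<in> carrier N} \<union>
      {g (r \<odot>\<^bsub>M\<^esub> x) y \<ominus>\<^bsub>F\<^esub> (r \<odot>\<^bsub>F\<^esub> g x y) | r x y.
         r \<in> carrier R \<and> x \<in> carrier M \<and> y \<in> carrier N} \<union>
      {g x (r \<odot>\<^bsub>N\<^esub> y) \<ominus>\<^bsub>F\<^esub> (r \<odot>\<^bsub>F\<^esub> g x y) | r x y.
         r \<in> carrier R \<and> x \<in> carrier M \<and> y \<in> carrier N})"

definition tensor_kernel ::
  "('r, 'k) ring_scheme \<Rightarrow> ('r, 'b, 'm) module_scheme \<Rightarrow> ('r, 'd, 'n) module_scheme \<Rightarrow>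
   ('b \<times> 'd \<Rightarrow> 'r) set"
where
  "tensor_kernel R M N = submodule_span R (free_on_pairs R M N) (tensor_relations R M N)"

definition tensor ::
  "('r, 'k) ring_scheme \<Rightarrow> ('r, 'b, 'm) module_scheme \<Rightarrow> ('r, 'd, 'n) module_scheme \<Rightarrow>
   ('r, ('b \<times> 'd \<Rightarrow> 'r) set) module"
where
  "tensor R M N = quotient_module (free_on_pairs R M N) (tensor_kernel R M N)"

definition pure_tensor ::
  "('r, 'k) ring_scheme \<Rightarrow> ('r, 'b, 'm) module_scheme \<Rightarrow> ('r, 'd, 'n) module_scheme \<Rightarrow>
   'b \<Rightarrow> 'd \<Rightarrow> ('b \<times> 'd \<Rightarrow> 'r) set"
where
  "pure_tensor R M N x y = tensor_kernel R M N +>\<^bsub>free_on_pairs R M N\<^esub> pair_gen R M N x y"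

text \<open>\<open>tensor_lift R M N Z b\<close> is the linear map from the tensor product to \<open>Z\<close> that sends
  \<open>\<Sum> x\<^sub>i \<otimes> y\<^sub>i\<close> to \<open>\<Sum> b x\<^sub>i y\<^sub>i\<close>. It is evaluated on representatives, so it is meaningful
  for bilinear \<open>b\<close> only; every use below is of that kind.\<close>

definition free_lift ::
  "('r, 'k) ring_scheme \<Rightarrow> ('r, 'b, 'm) module_scheme \<Rightarrow> ('r, 'd, 'n) module_scheme \<Rightarrow>
   ('r, 'z, 'l) module_scheme \<Rightarrow> ('b \<Rightarrow> 'd \<Rightarrow> 'z) \<Rightarrow> ('b \<times> 'd \<Rightarrow> 'r) \<Rightarrow> 'z"
where
  "free_lift R M N Z b f =
     (\<Oplus>\<^bsub>Z\<^esub>q\<in>{q \<in> carrier M \<times> carrier N. f q \<noteq> \<zero>\<^bsub>R\<^esub>}. f q \<odot>\<^bsub>Z\<^esub> b (fst q) (snd q))"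

definition tensor_lift ::
  "('r, 'k) ring_scheme \<Rightarrow> ('r, 'b, 'm) module_scheme \<Rightarrow> ('r, 'd, 'n) module_scheme \<Rightarrow>
   ('r, 'z, 'l) module_scheme \<Rightarrow> ('b \<Rightarrow> 'd \<Rightarrow> 'z) \<Rightarrow> ('b \<times> 'd \<Rightarrow> 'r) set \<Rightarrow> 'z"
where
  "tensor_lift R M N Z b T = the_elem (free_lift R M N Z b ` T)"

definition tensor_map ::
  "('r, 'k) ring_scheme \<Rightarrow> ('r, 'b, 'm) module_scheme \<Rightarrow> ('r, 'd, 'n) module_scheme \<Rightarrow>
   ('r, 'b', 'm') module_scheme \<Rightarrow> ('r, 'd', 'n') module_scheme \<Rightarrow>
   ('b \<Rightarrow> 'b') \<Rightarrow> ('d \<Rightarrow> 'd') \<Rightarrow> ('b \<times> 'd \<Rightarrow> 'r) set \<Rightarrow> ('b' \<times> 'd' \<Rightarrow> 'r) set"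
where
  "tensor_map R M N M' N' f g =
     tensor_lift R M N (tensor R M' N') (\<lambda>x y. pure_tensor R M' N' (f x) (g y))"

definition tensor_assoc ::
  "('r, 'k) ring_scheme \<Rightarrow> ('r, 'b, 'm) module_scheme \<Rightarrow> ('r, 'd, 'n) module_scheme \<Rightarrow>
   ('r, 'e, 'l) module_scheme \<Rightarrow>
   (('b \<times> 'd \<Rightarrow> 'r) set \<times> 'e \<Rightarrow> 'r) set \<Rightarrow> ('b \<times> ('d \<times> 'e \<Rightarrow> 'r) set \<Rightarrow> 'r) set"
where
  "tensor_assoc R L M N =
     (let MN = tensor R M N; LMN = tensor R L MN in
      tensor_lift R (tensor R L M) N LMN
        (\<lambda>t z. tensor_lift R L M LMN (\<lambda>x y. pure_tensor R L MN x (pure_tensor R M N y z)) t))"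


section \<open>Algebras, coalgebras and left modules over an algebra\<close>

text \<open>The library locale \<open>algebra\<close> requires commutativity, hence the following one.\<close>

locale assoc_algebra = R?: module R A + A?: ring A for R (structure) and A (structure) +
  assumes smult_mult_left: "\<lbrakk>r \<in> carrier R; a \<in> carrier A; b \<in> carrier A\<rbrakk> \<Longrightarrow>
      (r \<odot>\<^bsub>A\<^esub> a) \<otimes>\<^bsub>A\<^esub> b = r \<odot>\<^bsub>A\<^esub> (a \<otimes>\<^bsub>A\<^esub> b)"
    and smult_mult_right: "\<lbrakk>r \<in> carrier R; a \<in> carrier A; b \<in> carrier A\<rbrakk> \<Longrightarrow>
      a \<otimes>\<^bsub>A\<^esub> (r \<odot>\<^bsub>A\<^esub> b) = r \<odot>\<^bsub>A\<^esub> (a \<otimes>\<^bsub>A\<^esub> b)"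

record ('r, 'c) coalg = "('r, 'c) module" +
  comult :: "'c \<Rightarrow> ('c \<times> 'c \<Rightarrow> 'r) set"
  counit :: "'c \<Rightarrow> 'r"

locale coalgebra = R?: module R C
  for R :: "('r, 'k) ring_scheme" (structure) and C :: "('r, 'c, 'm) coalg_scheme" (structure) +
  assumes comult_linear: "comult C \<in> linear_maps R C (tensor R C C)"
    and counit_linear: "counit C \<in> linear_maps R C (regular_module R)"
    and coassoc: "c \<in> carrier C \<Longrightarrow>
      tensor_assoc R C C C (tensor_map R C C (tensor R C C) C (comult C) (\<lambda>x. x) (comult C c)) =
      tensor_map R C C C (tensor R C C) (\<lambda>x. x) (comult C) (comult C c)"
    and counit_left: "c \<in> carrier C \<Longrightarrow>
      tensor_lift R C C C (\<lambda>x y. counit C x \<odot>\<^bsub>C\<^esub> y) (comult C c) = c"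
    and counit_right: "c \<in> carrier C \<Longrightarrow>
      tensor_lift R C C C (\<lambda>x y. counit C y \<odot>\<^bsub>C\<^esub> x) (comult C c) = c"

definition convolution_algebra ::
  "('r, 'k) ring_scheme \<Rightarrow> ('r, 'c, 'm) coalg_scheme \<Rightarrow> ('r, 'c \<Rightarrow> 'r) module" where
  "convolution_algebra R C = (dual_module R C)
     \<lparr>monoid.mult := (\<lambda>f g. \<lambda>c\<in>carrier C.
        tensor_lift R C C (regular_module R) (\<lambda>x y. f x \<otimes>\<^bsub>R\<^esub> g y) (comult C c)),
      one := (\<lambda>c\<in>carrier C. counit C c)\<rparr>"

text \<open>The clauses of the library locale \<open>module\<close>, without commutativity of the scalars.\<close>

locale left_module = A?: ring A + X?: abelian_group X
  for A :: "('a, 'k) ring_scheme" (structure) and X :: "('a, 'x, 'n) module_scheme" (structure) +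
  assumes act_closed: "\<lbrakk>a \<in> carrier A; x \<in> carrier X\<rbrakk> \<Longrightarrow> a \<odot>\<^bsub>X\<^esub> x \<in> carrier X"
    and act_l_distr: "\<lbrakk>a \<in> carrier A; b \<in> carrier A; x \<in> carrier X\<rbrakk> \<Longrightarrow>
      (a \<oplus>\<^bsub>A\<^esub> b) \<odot>\<^bsub>X\<^esub> x = a \<odot>\<^bsub>X\<^esub> x \<oplus>\<^bsub>X\<^esub> b \<odot>\<^bsub>X\<^esub> x"
    and act_r_distr: "\<lbrakk>a \<in> carrier A; x \<in> carrier X; y \<in> carrier X\<rbrakk> \<Longrightarrow>
      a \<odot>\<^bsub>X\<^esub> (x \<oplus>\<^bsub>X\<^esub> y) = a \<odot>\<^bsub>X\<^esub> x \<oplus>\<^bsub>X\<^esub> a \<odot>\<^bsub>X\<^esub> y"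
    and act_assoc: "\<lbrakk>a \<in> carrier A; b \<in> carrier A; x \<in> carrier X\<rbrakk> \<Longrightarrow>
      (a \<otimes>\<^bsub>A\<^esub> b) \<odot>\<^bsub>X\<^esub> x = a \<odot>\<^bsub>X\<^esub> (b \<odot>\<^bsub>X\<^esub> x)"
    and act_one: "x \<in> carrier X \<Longrightarrow> \<one>\<^bsub>A\<^esub> \<odot>\<^bsub>X\<^esub> x = x"

text \<open>The \<open>R\<close>-module underlying a left \<open>A\<close>-module: \<open>R\<close> acts through \<open>r \<mapsto> r \<cdot> 1\<^sub>A\<close>.\<close>

definition restrict_scalars ::
  "('r, 'a, 'm) module_scheme \<Rightarrow> ('a, 'x, 'n) module_scheme \<Rightarrow> ('r, 'x) module" where
  "restrict_scalars A X = \<lparr>carrier = carrier X, monoid.mult = undefined, one = undefined,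
     zero = zero X, add = add X, smult = (\<lambda>r x. (r \<odot>\<^bsub>A\<^esub> \<one>\<^bsub>A\<^esub>) \<odot>\<^bsub>X\<^esub> x)\<rparr>"

definition locally_finite ::
  "('r, 'k) ring_scheme \<Rightarrow> ('r, 'a, 'm) module_scheme \<Rightarrow> ('a, 'x, 'n) module_scheme \<Rightarrow> bool" where
  "locally_finite R A X \<longleftrightarrow>
     (\<forall>x\<in>carrier X. fg_submodule R (restrict_scalars A X) {a \<odot>\<^bsub>X\<^esub> x | a. a \<in> carrier A})"

text \<open>\<open>X\<close> is isomorphic to a submodule of a quotient \<open>M\<^bsup>(I)\<^esup>/K\<close> of a direct sum of copies of \<open>M\<close>.
  Letting \<open>I\<close> range over the subsets of \<open>'x \<times> nat\<close> is no restriction: each of the elements of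
  \<open>X\<close> is represented by an element of \<open>M\<^bsup>(I)\<^esup>\<close> with finite support, so for an arbitrary \<open>I\<close> the
  image of \<open>X\<close> lies in the image of \<open>M\<^bsup>(J)\<^esup>\<close>, where \<open>J\<close> is the union of these supports.\<close>

definition subgenerated_by ::
  "('a, 'k) ring_scheme \<Rightarrow> ('a, 'c, 'm) module_scheme \<Rightarrow> ('a, 'x, 'n) module_scheme \<Rightarrow> bool" where
  "subgenerated_by A M X \<longleftrightarrow>
     (\<exists>(I :: ('x \<times> nat) set) K. submodule K A (copower_module I M) \<and>
        (\<exists>h \<in> linear_maps A X (quotient_module (copower_module I M) K). inj_on h (carrier X)))"


section \<open>Measuring pairings\<close>

definition alpha_map ::
  "('r, 'k) ring_scheme \<Rightarrow> ('r, 'a, 'm) module_scheme \<Rightarrow> ('r, 'c, 'n) module_scheme \<Rightarrow>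
   ('a \<Rightarrow> 'c \<Rightarrow> 'r) \<Rightarrow> ('r, 'x, 'l) module_scheme \<Rightarrow> ('x \<times> 'c \<Rightarrow> 'r) set \<Rightarrow> ('a \<Rightarrow> 'x)"
where
  "alpha_map R A C p X =
     tensor_lift R X C (Hom_module R A X) (\<lambda>x c. \<lambda>a\<in>carrier A. p a c \<odot>\<^bsub>X\<^esub> x)"

definition kappa ::
  "('r, 'c, 'n) module_scheme \<Rightarrow> ('a \<Rightarrow> 'c \<Rightarrow> 'r) \<Rightarrow> 'a \<Rightarrow> ('c \<Rightarrow> 'r)" where
  "kappa C p a = (\<lambda>c\<in>carrier C. p a c)"

definition chi ::
  "('r, 'a, 'n) module_scheme \<Rightarrow> ('a \<Rightarrow> 'c \<Rightarrow> 'r) \<Rightarrow> 'c \<Rightarrow> ('a \<Rightarrow> 'r)" where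
  "chi A p c = (\<lambda>a\<in>carrier A. p a c)"

locale measuring_pairing = A?: assoc_algebra R A + C?: coalgebra R C
  for R :: "('r, 'k) ring_scheme" (structure) and A :: "('r, 'a, 'm) module_scheme" (structure)
    and C :: "('r, 'c, 'n) coalg_scheme" (structure) +
  fixes p :: "'a \<Rightarrow> 'c \<Rightarrow> 'r"
  assumes pairing_linear_right: "a \<in> carrier A \<Longrightarrow> p a \<in> linear_maps R C (regular_module R)"
    and pairing_linear_left: "c \<in> carrier C \<Longrightarrow> (\<lambda>a. p a c) \<in> linear_maps R A (regular_module R)"
    and kappa_ring_hom: "kappa C p \<in> ring_hom A (convolution_algebra R C)"
    and kappa_linear: "kappa C p \<in> linear_maps R A (convolution_algebra R C)"

text \<open>HOL cannot quantify over all \<open>R\<close>-modules at once. The type used here contains an isomorphic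
  copy \<open>R\<^sup>n/K\<close> of every finitely generated \<open>R\<close>-module, and these suffice: an element of the kernel
  of \<open>X \<otimes> C \<rightarrow> Hom(A,X)\<close> comes from \<open>Y \<otimes> C\<close> for some finitely generated submodule \<open>Y\<close> of \<open>X\<close>, and
  there it lies in the kernel of \<open>Y \<otimes> C \<rightarrow> Hom(A,Y)\<close>.\<close>

locale measuring_alpha_pairing = measuring_pairing R A C p
  for R :: "('r, 'k) ring_scheme" (structure) and A :: "('r, 'a, 'm) module_scheme" (structure)
    and C :: "('r, 'c, 'n) coalg_scheme" (structure) and p :: "'a \<Rightarrow> 'c \<Rightarrow> 'r" +
  assumes alpha_condition: "\<And>X :: ('r, (nat \<Rightarrow> 'r) set) module.
    module R X \<Longrightarrow> inj_on (alpha_map R A C p X) (carrier (tensor R X C))"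

definition left_action ::
  "('r, 'k) ring_scheme \<Rightarrow> ('r, 'c, 'n) coalg_scheme \<Rightarrow> ('a \<Rightarrow> 'c \<Rightarrow> 'r) \<Rightarrow> 'a \<Rightarrow> 'c \<Rightarrow> 'c" where
  "left_action R C p a c = tensor_lift R C C C (\<lambda>c1 c2. p a c2 \<odot>\<^bsub>C\<^esub> c1) (comult C c)"

definition right_action ::
  "('r, 'k) ring_scheme \<Rightarrow> ('r, 'c, 'n) coalg_scheme \<Rightarrow> ('a \<Rightarrow> 'c \<Rightarrow> 'r) \<Rightarrow> 'c \<Rightarrow> 'a \<Rightarrow> 'c" where
  "right_action R C p c a = tensor_lift R C C C (\<lambda>c1 c2. p a c1 \<odot>\<^bsub>C\<^esub> c2) (comult C c)"

definition coalgebra_left_module ::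
  "('r, 'k) ring_scheme \<Rightarrow> ('r, 'c, 'n) coalg_scheme \<Rightarrow> ('a \<Rightarrow> 'c \<Rightarrow> 'r) \<Rightarrow> ('a, 'c) module" where
  "coalgebra_left_module R C p = \<lparr>carrier = carrier C, monoid.mult = undefined, one = undefined,
     zero = zero C, add = add C, smult = left_action R C p\<rparr>"

definition rational ::
  "('r, 'k) ring_scheme \<Rightarrow> ('r, 'a, 'm) module_scheme \<Rightarrow> ('r, 'c, 'n) coalg_scheme \<Rightarrow>
   ('a \<Rightarrow> 'c \<Rightarrow> 'r) \<Rightarrow> ('a, 'x, 'l) module_scheme \<Rightarrow> bool"
where
  "rational R A C p X \<longleftrightarrow>
     (\<forall>x\<in>carrier X. \<exists>u\<in>carrier (tensor R (restrict_scalars A X) C).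
        \<forall>a\<in>carrier A. a \<odot>\<^bsub>X\<^esub> x = alpha_map R A C p (restrict_scalars A X) u a)"


section \<open>Cofinite ideals and linear topologies\<close>

definition cofinite_ideal ::
  "('r, 'k) ring_scheme \<Rightarrow> ('r, 'a, 'm) module_scheme \<Rightarrow> 'a set \<Rightarrow> bool" where
  "cofinite_ideal R A I \<longleftrightarrow> ideal I A \<and> fg_module R (quotient_module A I)"

definition finite_dual ::
  "('r, 'k) ring_scheme \<Rightarrow> ('r, 'a, 'm) module_scheme \<Rightarrow> ('a \<Rightarrow> 'r) set" where
  "finite_dual R A =
     {f \<in> carrier (dual_module R A). \<exists>I. cofinite_ideal R A I \<and> (\<forall>a\<in>I. f a = \<zero>\<^bsub>R\<^esub>)}"

definition cofinitely_cogenerated ::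
  "('r, 'k) ring_scheme \<Rightarrow> ('r, 'a, 'm) module_scheme \<Rightarrow> bool" where
  "cofinitely_cogenerated R A \<longleftrightarrow>
     (\<forall>I. cofinite_ideal R A I \<longrightarrow> embeds_in_power_of_ring R (quotient_module A I))"

text \<open>The topology on the carrier of \<open>A\<close> in which the translates \<open>a + N\<close>, for \<open>N\<close> in the filter
  base \<open>\<B>\<close>, form a neighbourhood basis of \<open>a\<close>.\<close>

definition linear_topology :: "('a, 'm) ring_scheme \<Rightarrow> 'a set set \<Rightarrow> 'a topology" where
  "linear_topology A \<B> =
     topology (\<lambda>U. U \<subseteq> carrier A \<and> (\<forall>a\<in>U. \<exists>N\<in>\<B>. a <+\<^bsub>A\<^esub> N \<subseteq> U))"

lemma openin_linear_topology:
  assumes "\<And>N N'. N \<in> \<B> \<Longrightarrow> N' \<in> \<B> \<Longrightarrow> \<exists>N''\<in>\<B>. N'' \<subseteq> N \<inter> N'"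
  shows "openin (linear_topology A \<B>) U \<longleftrightarrow>
    U \<subseteq> carrier A \<and> (\<forall>a\<in>U. \<exists>N\<in>\<B>. a <+\<^bsub>A\<^esub> N \<subseteq> U)"
proof -
  let ?P = "\<lambda>U. U \<subseteq> carrier A \<and> (\<forall>a\<in>U. \<exists>N\<in>\<B>. a <+\<^bsub>A\<^esub> N \<subseteq> U)"
  have mono: "a <+\<^bsub>A\<^esub> N'' \<subseteq> a <+\<^bsub>A\<^esub> N" if "N'' \<subseteq> N" for a N N''
    using that by (auto simp: a_l_coset_def l_coset_def)
  have "istopology ?P"
    unfolding istopology_def
  proof (intro conjI allI impI)
    fix S T assume S: "?P S" and T: "?P T"
    show "S \<inter> T \<subseteq> carrier A" using S by (meson inf.coboundedI1)
    show "\<forall>a\<in>S \<inter> T. \<exists>N\<in>\<B>. a <+\<^bsub>A\<^esub> N \<subseteq> S \<inter> T"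
    proof
      fix a assume a: "a \<in> S \<inter> T"
      obtain N N' where N: "N \<in> \<B>" "a <+\<^bsub>A\<^esub> N \<subseteq> S" and N': "N' \<in> \<B>" "a <+\<^bsub>A\<^esub> N' \<subseteq> T"
        using a S T by (meson IntE)
      obtain N'' where "N'' \<in> \<B>" "N'' \<subseteq> N \<inter> N'" using assms N(1) N'(1) by meson
      then show "\<exists>N\<in>\<B>. a <+\<^bsub>A\<^esub> N \<subseteq> S \<inter> T"
        using mono[of N'' N a] mono[of N'' N' a] N(2) N'(2) by (meson le_inf_iff order_trans)
    qed
  next
    fix \<K> assume K: "\<forall>K\<in>\<K>. ?P K"
    show "\<Union>\<K> \<subseteq> carrier A" using K by (meson Sup_least)
    show "\<forall>a\<in>\<Union>\<K>. \<exists>N\<in>\<B>. a <+\<^bsub>A\<^esub> N \<subseteq> \<Union>\<K>"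
      using K by (meson UnionE Union_upper order_trans)
  qed
  then show ?thesis unfolding linear_topology_def by simp
qed

definition linear_weak_topology ::
  "('r, 'k) ring_scheme \<Rightarrow> ('r, 'a, 'm) module_scheme \<Rightarrow> ('r, 'c, 'n) coalg_scheme \<Rightarrow>
   ('a \<Rightarrow> 'c \<Rightarrow> 'r) \<Rightarrow> 'a topology"
where
  "linear_weak_topology R A C p =
     linear_topology A {{a \<in> carrier A. \<forall>c\<in>K. p a c = \<zero>\<^bsub>R\<^esub>} | K. fg_submodule R C K}"

definition right_adic_topology ::
  "('r, 'k) ring_scheme \<Rightarrow> ('r, 'a, 'm) module_scheme \<Rightarrow> ('r, 'c, 'n) coalg_scheme \<Rightarrow>
   ('a \<Rightarrow> 'c \<Rightarrow> 'r) \<Rightarrow> 'a topology"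
where
  "right_adic_topology R A C p =
     linear_topology A {{a \<in> carrier A. \<forall>w\<in>W. right_action R C p w a = \<zero>\<^bsub>C\<^esub>} | W.
       finite W \<and> W \<subseteq> carrier C}"

definition cofinite_topology ::
  "('r, 'k) ring_scheme \<Rightarrow> ('r, 'a, 'm) module_scheme \<Rightarrow> 'a topology" where
  "cofinite_topology R A = linear_topology A {I. cofinite_ideal R A I}"

definition coreflexive ::
  "('r, 'k) ring_scheme \<Rightarrow> ('r, 'a, 'm) module_scheme \<Rightarrow> ('r, 'c, 'n) coalg_scheme \<Rightarrow>
   ('a \<Rightarrow> 'c \<Rightarrow> 'r) \<Rightarrow> bool"
where
  "coreflexive R A C p \<longleftrightarrow> linear_weak_topology R A C p = cofinite_topology R A"

text \<open>Quantification over left \<open>A\<close>-modules is relative to a carrier type \<open>'x\<close>. The type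
  \<open>'a set\<close> contains all cyclic modules \<open>A/I\<close>.\<close>

definition locally_finite_imp_rational ::
  "'x itself \<Rightarrow> ('r, 'k) ring_scheme \<Rightarrow> ('r, 'a, 'm) module_scheme \<Rightarrow>
   ('r, 'c, 'n) coalg_scheme \<Rightarrow> ('a \<Rightarrow> 'c \<Rightarrow> 'r) \<Rightarrow> bool"
where
  "locally_finite_imp_rational (_ :: 'x itself) R A C p \<longleftrightarrow>
     (\<forall>X :: ('a, 'x) module. left_module A X \<longrightarrow> locally_finite R A X \<longrightarrow> rational R A C p X)"

definition Loc_eq_sigma ::
  "'x itself \<Rightarrow> ('r, 'k) ring_scheme \<Rightarrow> ('r, 'a, 'm) module_scheme \<Rightarrow>
   ('r, 'c, 'n) coalg_scheme \<Rightarrow> ('a \<Rightarrow> 'c \<Rightarrow> 'r) \<Rightarrow> bool"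
where
  "Loc_eq_sigma (_ :: 'x itself) R A C p \<longleftrightarrow>
     {X :: ('a, 'x) module. left_module A X \<and> locally_finite R A X} =
     {X. left_module A X \<and> subgenerated_by A (coalgebra_left_module R C p) X}"

end

theory Submission
  imports Defs
begin

text \<open>For \<open>T \<subseteq> C\<close> let \<open>perp T\<close> be the set of all \<open>a \<in> A\<close> with \<open>\<langle>a, T\<rangle> = 0\<close>. The submodules \<open>perp T\<close> with
  \<open>T\<close> finite are a neighbourhood basis of \<open>0\<close> in the linear weak topology. Each of them contains a
  cofinite ideal (\<open>perp_contains_cofinite_ideal\<close>); hence the pairing is coreflexive if and only if
  conversely every cofinite ideal contains \<open>perp T\<close> for some finite \<open>T\<close> (\<open>coreflexive_iff\<close>). The
  three parts are proved by means of this criterion.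

  The \<open>\<alpha>\<close>-condition is applied to cyclic modules \<open>R/J\<close>. For \<open>m \<in> C\<close> and the ideal \<open>J\<close> of all \<open>\<langle>a, m\<rangle>\<close>
  it gives \<open>m \<in> JC\<close> (\<open>alpha_locally_projective\<close>), that is, an endomorphism \<open>a \<mapsto> \<Sum> \<langle>a, c\<^sub>j\<rangle> a\<^sub>j\<close> of \<open>A\<close> whose
  transpose fixes \<open>m\<close> (\<open>rational_identity\<close>). From this follows the key fact \<open>rational_maps_iff\<close>: a linear
  map \<open>f\<close> on \<open>A\<close> has the form \<open>a \<mapsto> \<Sum> \<langle>a, c\<^sub>i\<rangle> y\<^sub>i\<close> if and only if it vanishes on \<open>perp T\<close> for some finite \<open>T\<close>.

  A functional \<open>f\<close> has this form if and only if it comes from \<open>C\<close>. So if the pairing is coreflexive, the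
  functionals in the finite dual, which kill a cofinite ideal, come from \<open>C\<close>. Conversely let \<open>C\<close> be the
  finite dual and let \<open>A\<close> be cofinitely cogenerated. For a cofinite ideal \<open>I\<close>, the elements of \<open>C\<close> that
  kill \<open>I\<close> form a submodule that is finitely generated, since \<open>A/I\<close> is and \<open>R\<close> is noetherian; its
  annihilator is \<open>I\<close> by cogeneration.

  If \<open>R\<close> is artinian and \<open>I\<close> is closed and cofinite, the submodules \<open>I + perp T\<close> intersect in \<open>I\<close>, and by
  the descending chain condition in \<open>A/I\<close> one of them equals \<open>I\<close>.

  The map \<open>f a = a x\<close>, with \<open>x\<close> in a left \<open>A\<close>-module, has this form if and only if \<open>x\<close> satisfies the condition in the
  definition of rational modules; by the key fact this means that \<open>perp T\<close> kills \<open>x\<close> for some finite \<open>T\<close>. The modules all of whose elements have this property are also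
  the modules in \<open>\<sigma>[C]\<close> (\<open>subgenerated_iff_discrete\<close>), and they are locally finite. In a locally finite
  module the annihilator of \<open>A x\<close> is a cofinite ideal (\<open>annihilator_cofinite\<close>), so coreflexivity makes
  every locally finite module rational; the modules \<open>A/I\<close> give the converse.\<close>

section \<open>Left modules, spans and quotients\<close>

lemma module_iff_left_module: "module R M \<longleftrightarrow> cring R \<and> left_module R M"
proof
  assume "module R M"
  then interpret module R M .
  show "cring R \<and> left_module R M"
    by (intro conjI left_module.intro left_module_axioms.intro)
      (simp_all add: R.is_cring R.ring_axioms M.abelian_group_axioms smult_l_distr smult_r_distr smult_assoc1)
next
  assume a: "cring R \<and> left_module R M"
  then interpret left_module R M by simp
  show "module R M"
    using a by (intro moduleI) (simp_all add: X.abelian_group_axioms act_closed act_l_distr act_r_distr act_assoc act_one)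
qed

lemma submodule_subset: "submodule H R M \<Longrightarrow> h \<in> H \<Longrightarrow> h \<in> carrier M"
  using subgroup.mem_carrier[OF submodule.axioms(1), of H R M h] by simp

lemma submodule_zero: "submodule H R M \<Longrightarrow> \<zero>\<^bsub>M\<^esub> \<in> H"
  using subgroup.one_closed[OF submodule.axioms(1), of H R M] by simp

lemma submodule_add: "submodule H R M \<Longrightarrow> g \<in> H \<Longrightarrow> h \<in> H \<Longrightarrow> g \<oplus>\<^bsub>M\<^esub> h \<in> H"
  using subgroup.m_closed[OF submodule.axioms(1), of H R M g h] by simp

lemma submodule_minus: "submodule H R M \<Longrightarrow> h \<in> H \<Longrightarrow> \<ominus>\<^bsub>M\<^esub> h \<in> H"
  using subgroup.m_inv_closed[OF submodule.axioms(1), of H R M h] by (simp add: a_inv_def)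

lemma submodule_diff: "submodule H R M \<Longrightarrow> g \<in> H \<Longrightarrow> h \<in> H \<Longrightarrow> g \<ominus>\<^bsub>M\<^esub> h \<in> H"
  by (simp add: a_minus_def submodule_add submodule_minus)

lemma additive_subgroup_submodule: "submodule H R M \<Longrightarrow> additive_subgroup H M"
  by (simp add: additive_subgroup.intro submodule.axioms(1))

lemma linear_mapsI:
  assumes "\<And>x. x \<in> carrier M \<Longrightarrow> f x \<in> carrier N"
    and "\<And>x y. x \<in> carrier M \<Longrightarrow> y \<in> carrier M \<Longrightarrow> f (x \<oplus>\<^bsub>M\<^esub> y) = f x \<oplus>\<^bsub>N\<^esub> f y"
    and "\<And>r x. r \<in> carrier R \<Longrightarrow> x \<in> carrier M \<Longrightarrow> f (r \<odot>\<^bsub>M\<^esub> x) = r \<odot>\<^bsub>N\<^esub> f x"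
  shows "f \<in> linear_maps R M N"
  using assms by (simp add: linear_maps_def)

lemma linear_closed: "f \<in> linear_maps R M N \<Longrightarrow> x \<in> carrier M \<Longrightarrow> f x \<in> carrier N"
  and linear_add: "f \<in> linear_maps R M N \<Longrightarrow> x \<in> carrier M \<Longrightarrow> y \<in> carrier M \<Longrightarrow>
    f (x \<oplus>\<^bsub>M\<^esub> y) = f x \<oplus>\<^bsub>N\<^esub> f y"
  and linear_smult: "f \<in> linear_maps R M N \<Longrightarrow> r \<in> carrier R \<Longrightarrow> x \<in> carrier M \<Longrightarrow>
    f (r \<odot>\<^bsub>M\<^esub> x) = r \<odot>\<^bsub>N\<^esub> f x"
  by (auto simp: linear_maps_def)

context left_module
begin

lemma act_l_null [simp]:
  assumes "x \<in> carrier X"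
  shows "\<zero> \<odot>\<^bsub>X\<^esub> x = \<zero>\<^bsub>X\<^esub>"
  using act_l_distr[of \<zero> \<zero> x] assms act_closed[of \<zero> x] X.add.r_cancel_one' by fastforce

lemma act_r_null [simp]:
  assumes "a \<in> carrier A"
  shows "a \<odot>\<^bsub>X\<^esub> \<zero>\<^bsub>X\<^esub> = \<zero>\<^bsub>X\<^esub>"
  using act_r_distr[of a "\<zero>\<^bsub>X\<^esub>" "\<zero>\<^bsub>X\<^esub>"] assms act_closed[of a "\<zero>\<^bsub>X\<^esub>"] X.add.r_cancel_one' by fastforce

lemma act_l_minus:
  assumes "a \<in> carrier A" "x \<in> carrier X"
  shows "(\<ominus> a) \<odot>\<^bsub>X\<^esub> x = \<ominus>\<^bsub>X\<^esub> (a \<odot>\<^bsub>X\<^esub> x)"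
  using act_l_distr[of "\<ominus> a" a x] assms act_closed
  by (metis A.a_inv_closed A.l_neg X.minus_equality act_l_null)

lemma act_r_minus:
  assumes "a \<in> carrier A" "x \<in> carrier X"
  shows "a \<odot>\<^bsub>X\<^esub> (\<ominus>\<^bsub>X\<^esub> x) = \<ominus>\<^bsub>X\<^esub> (a \<odot>\<^bsub>X\<^esub> x)"
  using act_r_distr[of a "\<ominus>\<^bsub>X\<^esub> x" x] assms act_closed
  by (metis X.a_inv_closed X.l_neg X.minus_equality act_r_null)

lemma minus_eq_act: "x \<in> carrier X \<Longrightarrow> \<ominus>\<^bsub>X\<^esub> x = (\<ominus> \<one>) \<odot>\<^bsub>X\<^esub> x"
  by (simp add: act_l_minus act_one)

lemma act_r_diff:
  assumes "a \<in> carrier A" "x \<in> carrier X" "y \<in> carrier X"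
  shows "a \<odot>\<^bsub>X\<^esub> (x \<ominus>\<^bsub>X\<^esub> y) = a \<odot>\<^bsub>X\<^esub> x \<ominus>\<^bsub>X\<^esub> a \<odot>\<^bsub>X\<^esub> y"
  using assms by (simp add: a_minus_def act_r_distr act_r_minus)

lemma act_l_diff:
  assumes "a \<in> carrier A" "b \<in> carrier A" "x \<in> carrier X"
  shows "(a \<ominus> b) \<odot>\<^bsub>X\<^esub> x = a \<odot>\<^bsub>X\<^esub> x \<ominus>\<^bsub>X\<^esub> b \<odot>\<^bsub>X\<^esub> x"
  using assms by (simp add: a_minus_def act_l_distr act_l_minus)

lemma diff_zero_iff: "x \<in> carrier X \<Longrightarrow> y \<in> carrier X \<Longrightarrow> x \<ominus>\<^bsub>X\<^esub> y = \<zero>\<^bsub>X\<^esub> \<longleftrightarrow> x = y"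
  by (metis X.add.inv_equality X.add.inv_closed X.minus_eq X.minus_minus X.r_neg)

lemma submoduleI:
  assumes "H \<subseteq> carrier X" "\<zero>\<^bsub>X\<^esub> \<in> H"
    and "\<And>x y. x \<in> H \<Longrightarrow> y \<in> H \<Longrightarrow> x \<oplus>\<^bsub>X\<^esub> y \<in> H"
    and "\<And>a x. a \<in> carrier A \<Longrightarrow> x \<in> H \<Longrightarrow> a \<odot>\<^bsub>X\<^esub> x \<in> H"
  shows "submodule H A X"
proof (intro submodule.intro submodule_axioms.intro subgroup.intro)
  fix x assume "x \<in> H"
  then show "inv\<^bsub>add_monoid X\<^esub> x \<in> H"
    using assms(4)[of "\<ominus> \<one>" x] minus_eq_act[of x] assms(1) by (auto simp: a_inv_def)
qed (use assms in auto)

lemma carrier_submodule: "submodule (carrier X) A X"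
  by (rule submoduleI) (auto simp: act_closed)

lemma zero_submodule: "submodule {\<zero>\<^bsub>X\<^esub>} A X"
  by (rule submoduleI) auto

lemma finsum_in_submodule:
  assumes "submodule H A X" "finite Q" "\<And>q. q \<in> Q \<Longrightarrow> f q \<in> H"
  shows "(\<Oplus>\<^bsub>X\<^esub>q\<in>Q. f q) \<in> H"
  using assms(2,3)
proof (induction Q)
  case empty
  then show ?case by (simp add: submodule_zero[OF assms(1)])
next
  case (insert q Q)
  then show ?case
    using submodule_subset[OF assms(1)] submodule_add[OF assms(1)]
    by (subst X.finsum_insert) (auto simp: Pi_def)
qed

lemma span_submodule: "S \<subseteq> carrier X \<Longrightarrow> submodule (submodule_span A X S) A X"
  unfolding submodule_span_def
  using carrier_submodule
  by (intro submoduleI)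
    (auto intro: submodule_subset submodule_zero submodule_add submodule.smult_closed)

end

lemma span_superset: "S \<subseteq> submodule_span R M S"
  by (auto simp: submodule_span_def)

lemma span_least: "submodule N R M \<Longrightarrow> S \<subseteq> N \<Longrightarrow> submodule_span R M S \<subseteq> N"
  by (auto simp: submodule_span_def)

lemma span_mono: "S \<subseteq> T \<Longrightarrow> submodule_span R M S \<subseteq> submodule_span R M T"
  by (auto simp: submodule_span_def)

lemma span_of_submodule: "submodule N R M \<Longrightarrow> submodule_span R M N = N"
  using span_least[of N R M N] span_superset[of N R M] by blast

context left_module
begin

lemma span_subset_carrier: "S \<subseteq> carrier X \<Longrightarrow> submodule_span A X S \<subseteq> carrier X"
  using span_least[OF carrier_submodule] .

lemma span_subset_span:
  "T \<subseteq> carrier X \<Longrightarrow> S \<subseteq> submodule_span A X T \<Longrightarrow> submodule_span A X S \<subseteq> submodule_span A X T"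
  by (rule span_least[OF span_submodule])

lemma submodule_Int: "submodule N A X \<Longrightarrow> submodule N' A X \<Longrightarrow> submodule (N \<inter> N') A X"
  by (intro submoduleI)
    (auto intro: submodule_subset submodule_zero submodule_add submodule.smult_closed)

lemma span_insert:
  assumes N: "submodule N A X" and y: "y \<in> carrier X"
  shows "submodule_span A X (insert y N) = {r \<odot>\<^bsub>X\<^esub> y \<oplus>\<^bsub>X\<^esub> n | r n. r \<in> carrier A \<and> n \<in> N}"
    (is "?L = ?R")
proof
  have c: "n \<in> carrier X" if "n \<in> N" for n using submodule_subset[OF N that] .
  have S: "submodule ?R A X"
  proof (rule submoduleI)
    show "?R \<subseteq> carrier X" using y c by (auto simp: act_closed)
    show "\<zero>\<^bsub>X\<^esub> \<in> ?R"
      using y submodule_zero[OF N] by (auto intro!: exI[of _ \<zero>] exI[of _ "\<zero>\<^bsub>X\<^esub>"])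
  next
    fix u v assume "u \<in> ?R" "v \<in> ?R"
    then obtain r n s m where uv: "u = r \<odot>\<^bsub>X\<^esub> y \<oplus>\<^bsub>X\<^esub> n" "v = s \<odot>\<^bsub>X\<^esub> y \<oplus>\<^bsub>X\<^esub> m"
      and rs: "r \<in> carrier A" "s \<in> carrier A" "n \<in> N" "m \<in> N" by blast
    then have "u \<oplus>\<^bsub>X\<^esub> v = (r \<oplus> s) \<odot>\<^bsub>X\<^esub> y \<oplus>\<^bsub>X\<^esub> (n \<oplus>\<^bsub>X\<^esub> m)"
      using y c by (simp add: act_l_distr act_closed X.a_ac)
    then show "u \<oplus>\<^bsub>X\<^esub> v \<in> ?R" using rs submodule_add[OF N] by blast
  next
    fix a u assume a: "a \<in> carrier A" and "u \<in> ?R"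
    then obtain r n where u: "u = r \<odot>\<^bsub>X\<^esub> y \<oplus>\<^bsub>X\<^esub> n" and rs: "r \<in> carrier A" "n \<in> N" by blast
    then have "a \<odot>\<^bsub>X\<^esub> u = (a \<otimes> r) \<odot>\<^bsub>X\<^esub> y \<oplus>\<^bsub>X\<^esub> (a \<odot>\<^bsub>X\<^esub> n)"
      using y c a by (simp add: act_r_distr act_closed act_assoc)
    then show "a \<odot>\<^bsub>X\<^esub> u \<in> ?R" using rs a submodule.smult_closed[OF N] A.m_closed by blast
  qed
  have "insert y N \<subseteq> ?R"
  proof (intro insert_subsetI subsetI)
    show "y \<in> ?R" using y submodule_zero[OF N] by (auto intro!: exI[of _ \<one>] exI[of _ "\<zero>\<^bsub>X\<^esub>"] simp: act_one)
    show "n \<in> ?R" if "n \<in> N" for n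
      using y c that by (auto intro!: exI[of _ \<zero>] exI[of _ n])
  qed
  then show "?L \<subseteq> ?R" using span_least[OF S] by blast
  have sp: "submodule ?L A X" using span_submodule[of "insert y N"] y c by auto
  have "insert y N \<subseteq> ?L" by (rule span_superset)
  then show "?R \<subseteq> ?L" using submodule_add[OF sp] submodule.smult_closed[OF sp] by auto
qed

lemma span_insert_span:
  assumes "S \<subseteq> carrier X" "y \<in> carrier X"
  shows "submodule_span A X (insert y S) = submodule_span A X (insert y (submodule_span A X S))"
proof
  show "submodule_span A X (insert y S) \<subseteq> submodule_span A X (insert y (submodule_span A X S))"
    by (rule span_mono) (use span_superset[of S A X] in auto)
  show "submodule_span A X (insert y (submodule_span A X S)) \<subseteq> submodule_span A X (insert y S)"
    using span_mono[of S "insert y S" A X] span_superset[of "insert y S" A X] assms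
    by (intro span_subset_span) auto
qed

end

locale linear_map = X?: left_module A X + Y?: left_module A Y
  for A :: "('a, 'k) ring_scheme" (structure) and X :: "('a, 'x, 'm) module_scheme"
    and Y :: "('a, 'y, 'n) module_scheme" +
  fixes f
  assumes linear: "f \<in> linear_maps A X Y"
begin

lemma closed: "x \<in> carrier X \<Longrightarrow> f x \<in> carrier Y"
  and add: "x \<in> carrier X \<Longrightarrow> y \<in> carrier X \<Longrightarrow> f (x \<oplus>\<^bsub>X\<^esub> y) = f x \<oplus>\<^bsub>Y\<^esub> f y"
  and smult: "r \<in> carrier A \<Longrightarrow> x \<in> carrier X \<Longrightarrow> f (r \<odot>\<^bsub>X\<^esub> x) = r \<odot>\<^bsub>Y\<^esub> f x"
  using linear by (auto simp: linear_maps_def)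

lemma zero: "f \<zero>\<^bsub>X\<^esub> = \<zero>\<^bsub>Y\<^esub>"
  using smult[of \<zero> "\<zero>\<^bsub>X\<^esub>"] closed[of "\<zero>\<^bsub>X\<^esub>"] by simp

lemma minus: "x \<in> carrier X \<Longrightarrow> f (\<ominus>\<^bsub>X\<^esub> x) = \<ominus>\<^bsub>Y\<^esub> f x"
  by (simp add: X.minus_eq_act Y.minus_eq_act smult closed)

lemma diff: "x \<in> carrier X \<Longrightarrow> y \<in> carrier X \<Longrightarrow> f (x \<ominus>\<^bsub>X\<^esub> y) = f x \<ominus>\<^bsub>Y\<^esub> f y"
  by (simp add: a_minus_def add minus)

lemma finsum:
  assumes "finite Q" "\<And>q. q \<in> Q \<Longrightarrow> g q \<in> carrier X"
  shows "f (\<Oplus>\<^bsub>X\<^esub>q\<in>Q. g q) = (\<Oplus>\<^bsub>Y\<^esub>q\<in>Q. f (g q))"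
  using assms
proof (induction Q)
  case empty
  then show ?case by (simp add: zero)
next
  case (insert q Q)
  then show ?case
    using closed by (simp add: Pi_def add)
qed

lemma kernel_submodule: "submodule {x \<in> carrier X. f x = \<zero>\<^bsub>Y\<^esub>} A X"
  by (rule X.submoduleI) (auto simp: zero add smult X.act_closed)

lemma vimage_submodule: "submodule N A Y \<Longrightarrow> submodule {x \<in> carrier X. f x \<in> N} A X"
  by (rule X.submoduleI)
    (auto simp: zero add smult X.act_closed submodule_zero submodule_add submodule.smult_closed)

lemma image_submodule: 
  assumes "submodule D A X" 
  shows "submodule (f ` D) A Y"
proof (rule Y.submoduleI)
  show "f ` D \<subseteq> carrier Y" using assms by (auto intro: closed submodule_subset)
  show "\<zero>\<^bsub>Y\<^esub> \<in> f ` D" using submodule_zero[OF assms] zero by force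
next
  fix x y assume "x \<in> f ` D" "y \<in> f ` D"
  then obtain u v where "x = f u" "y = f v" "u \<in> D" "v \<in> D" by auto
  then show "x \<oplus>\<^bsub>Y\<^esub> y \<in> f ` D"
    using submodule_add[OF assms, of u v] add[of u v] submodule_subset[OF assms] by force
next
  fix a x assume "a \<in> carrier A" "x \<in> f ` D"
  moreover then obtain u where "x = f u" "u \<in> D" by auto
  ultimately show "a \<odot>\<^bsub>Y\<^esub> x \<in> f ` D"
    using submodule.smult_closed[OF assms, of a u] smult[of a u] submodule_subset[OF assms] by force
qed

lemma image_span:
  assumes "S \<subseteq> carrier X"
  shows "f ` submodule_span A X S = submodule_span A Y (f ` S)"
proof
  have fS: "f ` S \<subseteq> carrier Y" using assms closed by auto
  show "submodule_span A Y (f ` S) \<subseteq> f ` submodule_span A X S"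
    using span_superset[of S A X] by (intro span_least image_submodule X.span_submodule assms) auto
  have "submodule_span A X S \<subseteq> {x \<in> carrier X. f x \<in> submodule_span A Y (f ` S)}"
    using span_superset[of "f ` S" A Y] assms
    by (intro span_least vimage_submodule Y.span_submodule fS) auto
  then show "f ` submodule_span A X S \<subseteq> submodule_span A Y (f ` S)" by auto
qed

end

lemma linear_map_comp:
  "f \<in> linear_maps R L M \<Longrightarrow> g \<in> linear_maps R M N \<Longrightarrow> (\<lambda>x. g (f x)) \<in> linear_maps R L N"
  by (auto simp: linear_maps_def Pi_def)

context left_module
begin

lemma abelian_subgroup_submodule: "submodule N A X \<Longrightarrow> abelian_subgroup N X"
  by (simp add: abelian_subgroupI3 additive_subgroup_submodule X.abelian_group_axioms)

lemma coset_eq_iff: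
  assumes N: "submodule N A X" and xy: "x \<in> carrier X" "y \<in> carrier X"
  shows "N +>\<^bsub>X\<^esub> x = N +>\<^bsub>X\<^esub> y \<longleftrightarrow> x \<ominus>\<^bsub>X\<^esub> y \<in> N"
proof -
  interpret abelian_subgroup N X by (rule abelian_subgroup_submodule[OF N])
  show ?thesis
    using a_rcos_module[OF xy(2,1)] a_repr_independence'[OF _ xy(2)] a_rcos_self[OF xy(1)]
    by (auto simp: a_minus_def)
qed

lemma coset_eq_self_iff:
  assumes N: "submodule N A X" and x: "x \<in> carrier X"
  shows "N +>\<^bsub>X\<^esub> x = N \<longleftrightarrow> x \<in> N"
  using coset_eq_iff[OF N x, of "\<zero>\<^bsub>X\<^esub>"] x submodule_subset[OF N] 
  by (simp add: X.minus_eq subset_iff) (metis X.a_inv_closed X.l_neg X.r_zero X.zero_closed)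

lemma quotient_carrier:
  "carrier (quotient_module X N) = (\<lambda>x. N +>\<^bsub>X\<^esub> x) ` carrier X"
  by (auto simp: quotient_module_def A_RCOSETS_def')

lemma quotient_zero: "\<zero>\<^bsub>quotient_module X N\<^esub> = N"
  by (simp add: quotient_module_def)

lemma quotient_add:
  assumes N: "submodule N A X" and "x \<in> carrier X" "y \<in> carrier X"
  shows "(N +>\<^bsub>X\<^esub> x) \<oplus>\<^bsub>quotient_module X N\<^esub> (N +>\<^bsub>X\<^esub> y) = N +>\<^bsub>X\<^esub> (x \<oplus>\<^bsub>X\<^esub> y)"
  using abelian_subgroup.a_rcos_sum[OF abelian_subgroup_submodule[OF N]] assms
  by (simp add: quotient_module_def)

lemma quotient_smult:
  assumes N: "submodule N A X" and ax: "a \<in> carrier A" "x \<in> carrier X"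
  shows "a \<odot>\<^bsub>quotient_module X N\<^esub> (N +>\<^bsub>X\<^esub> x) = N +>\<^bsub>X\<^esub> (a \<odot>\<^bsub>X\<^esub> x)"
proof -
  interpret abelian_subgroup N X by (rule abelian_subgroup_submodule[OF N])
  have "N +>\<^bsub>X\<^esub> (a \<odot>\<^bsub>X\<^esub> y) = N +>\<^bsub>X\<^esub> (a \<odot>\<^bsub>X\<^esub> x)" if y: "y \<in> N +>\<^bsub>X\<^esub> x" for y
  proof -
    have yc: "y \<in> carrier X" using a_elemrcos_carrier[OF ax(2) y] .
    have "y \<ominus>\<^bsub>X\<^esub> x \<in> N" using a_rcos_module_imp[OF ax(2) y] by (simp add: a_minus_def)
    then have "a \<odot>\<^bsub>X\<^esub> (y \<ominus>\<^bsub>X\<^esub> x) \<in> N" using ax submodule.smult_closed[OF N] by simp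
    then show ?thesis
      using coset_eq_iff[OF N] ax yc by (simp add: act_closed act_r_diff)
  qed
  then have "(\<Union>y\<in>N +>\<^bsub>X\<^esub> x. N +>\<^bsub>X\<^esub> (a \<odot>\<^bsub>X\<^esub> y)) = (\<Union>y\<in>N +>\<^bsub>X\<^esub> x. N +>\<^bsub>X\<^esub> (a \<odot>\<^bsub>X\<^esub> x))"
    by (rule SUP_cong[OF refl])
  then show ?thesis using a_rcos_self[OF ax(2)] by (auto simp add: quotient_module_def)
qed

lemma quotient_left_module:
  assumes N: "submodule N A X"
  shows "left_module A (quotient_module X N)"
proof (intro left_module.intro left_module_axioms.intro abelian_groupI)
  let ?Q = "quotient_module X N"
  note q = quotient_carrier quotient_zero quotient_add[OF N] quotient_smult[OF N]
  show "ring A" by (rule A.ring_axioms)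
  show "\<zero>\<^bsub>?Q\<^esub> \<in> carrier ?Q"
    using coset_eq_self_iff[OF N, of "\<zero>\<^bsub>X\<^esub>"] submodule_zero[OF N] X.zero_closed
    by (auto simp: q intro!: image_eqI[of _ _ "\<zero>\<^bsub>X\<^esub>"])
  have Nz: "N = N +>\<^bsub>X\<^esub> \<zero>\<^bsub>X\<^esub>"
    using coset_eq_self_iff[OF N, of "\<zero>\<^bsub>X\<^esub>"] submodule_zero[OF N] by simp
  show "\<zero>\<^bsub>?Q\<^esub> \<oplus>\<^bsub>?Q\<^esub> u = u" if u: "u \<in> carrier ?Q" for u
  proof -
    obtain x where x: "x \<in> carrier X" "u = N +>\<^bsub>X\<^esub> x" using u by (auto simp: q)
    then show ?thesis using quotient_add[OF N X.zero_closed x(1)] by (simp add: quotient_zero flip: Nz)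
  qed
  show "\<exists>v\<in>carrier ?Q. v \<oplus>\<^bsub>?Q\<^esub> u = \<zero>\<^bsub>?Q\<^esub>" if u: "u \<in> carrier ?Q" for u
  proof -
    obtain x where x: "x \<in> carrier X" "u = N +>\<^bsub>X\<^esub> x" using u by (auto simp: q)
    then have "(N +>\<^bsub>X\<^esub> (\<ominus>\<^bsub>X\<^esub> x)) \<oplus>\<^bsub>?Q\<^esub> u = \<zero>\<^bsub>?Q\<^esub>"
      using Nz by (simp add: q X.l_neg)
    then show ?thesis using x by (auto simp: q)
  qed
qed (auto simp: quotient_carrier quotient_add[OF N] quotient_smult[OF N] act_closed act_l_distr
    act_r_distr act_assoc act_one X.a_ac)

lemma quotient_proj_linear:
  "submodule N A X \<Longrightarrow> (\<lambda>x. N +>\<^bsub>X\<^esub> x) \<in> linear_maps A X (quotient_module X N)"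
  by (rule linear_mapsI) (auto simp: quotient_carrier quotient_add quotient_smult)

lemma quotient_proj_linear_map:
  "submodule N A X \<Longrightarrow> linear_map A X (quotient_module X N) (\<lambda>x. N +>\<^bsub>X\<^esub> x)"
  by (intro linear_map.intro linear_map_axioms.intro left_module_axioms quotient_left_module quotient_proj_linear)

text \<open>This translates cofiniteness into a statement about submodules of \<open>X\<close> itself, so that
  finiteness arguments need not speak of cosets: representatives of generators of \<open>X/N\<close> generate \<open>X\<close> modulo \<open>N\<close>, and the
  projection kills \<open>N\<close>.\<close>

lemma fg_quotient_iff:
  assumes N: "submodule N A X"
  shows "fg_module A (quotient_module X N) \<longleftrightarrow>
    (\<exists>S. finite S \<and> S \<subseteq> carrier X \<and> submodule_span A X (N \<union> S) = carrier X)"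
proof
  interpret \<pi>: linear_map A X "quotient_module X N" "\<lambda>x. N +>\<^bsub>X\<^esub> x"
    by (rule quotient_proj_linear_map[OF N])
  let ?Q = "quotient_module X N" and ?\<pi> = "\<lambda>x. N +>\<^bsub>X\<^esub> x"
  have NX: "N \<subseteq> carrier X" using submodule_subset[OF N] by auto
  { assume "fg_module A ?Q"
    then obtain T where T: "finite T" "T \<subseteq> carrier ?Q" "carrier ?Q = submodule_span A ?Q T"
      by (auto simp: fg_module_def fg_submodule_def)
    then obtain S where S: "S \<subseteq> carrier X" "finite S" "T = ?\<pi> ` S"
      by (metis finite_subset_image quotient_carrier)
    have "x \<in> submodule_span A X (N \<union> S)" if x: "x \<in> carrier X" for x
    proof -
      have sp: "submodule (submodule_span A X (N \<union> S)) A X" using NX S by (intro span_submodule) auto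
      have "?\<pi> x \<in> ?\<pi> ` submodule_span A X S"
        using T S x \<pi>.image_span[OF S(1)] quotient_carrier by force
      then obtain s where s: "s \<in> submodule_span A X S" "?\<pi> x = ?\<pi> s" by auto
      have sc: "s \<in> carrier X" using s span_subset_carrier[OF S(1)] by auto
      have "x \<ominus>\<^bsub>X\<^esub> s \<in> N" using s(2) coset_eq_iff[OF N x sc] by simp
      then have "x \<ominus>\<^bsub>X\<^esub> s \<in> submodule_span A X (N \<union> S)" using span_superset[of "N \<union> S" A X] by auto
      moreover have "s \<in> submodule_span A X (N \<union> S)" using s(1) span_mono[of S "N \<union> S" A X] by auto
      ultimately have "(x \<ominus>\<^bsub>X\<^esub> s) \<oplus>\<^bsub>X\<^esub> s \<in> submodule_span A X (N \<union> S)" by (rule submodule_add[OF sp])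
      then show ?thesis using x sc by (simp add: a_minus_def X.a_assoc X.l_neg)
    qed
    then show "\<exists>S. finite S \<and> S \<subseteq> carrier X \<and> submodule_span A X (N \<union> S) = carrier X"
      using S NX span_subset_carrier[of "N \<union> S"] by blast }
  { assume "\<exists>S. finite S \<and> S \<subseteq> carrier X \<and> submodule_span A X (N \<union> S) = carrier X"
    then obtain S where S: "finite S" "S \<subseteq> carrier X" "submodule_span A X (N \<union> S) = carrier X"
      by blast
    have fS: "?\<pi> ` S \<subseteq> carrier ?Q" using S \<pi>.closed by auto
    have sp: "submodule (submodule_span A ?Q (?\<pi> ` S)) A ?Q"
      using \<pi>.Y.span_submodule[OF fS] .
    have "?\<pi> ` (N \<union> S) \<subseteq> submodule_span A ?Q (?\<pi> ` S)"
    proof (intro subsetI, elim imageE UnE)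
      fix u n assume "u = ?\<pi> n" "n \<in> N"
      then have "u = \<zero>\<^bsub>?Q\<^esub>" using coset_eq_self_iff[OF N, of n] NX by (auto simp: quotient_zero)
      then show "u \<in> submodule_span A ?Q (?\<pi> ` S)" using submodule_zero[OF sp] by simp
    qed (use span_superset[of "?\<pi> ` S" A ?Q] in auto)
    then have "submodule_span A ?Q (?\<pi> ` (N \<union> S)) \<subseteq> submodule_span A ?Q (?\<pi> ` S)"
      by (rule span_least[OF sp])
    moreover have "submodule_span A ?Q (?\<pi> ` (N \<union> S)) = carrier ?Q"
      using \<pi>.image_span[of "N \<union> S"] S NX by (simp add: quotient_carrier)
    ultimately have "carrier ?Q = submodule_span A ?Q (?\<pi> ` S)"
      using \<pi>.Y.span_subset_carrier[OF fS] by auto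
    then show "fg_module A ?Q"
      using S fS unfolding fg_module_def fg_submodule_def by blast }
qed

end

section \<open>Finiteness over noetherian and artinian rings\<close>

lemma regular_simps [simp]:
  "carrier (regular_module R) = carrier R"
  "\<zero>\<^bsub>regular_module R\<^esub> = \<zero>\<^bsub>R\<^esub>"
  "x \<oplus>\<^bsub>regular_module R\<^esub> y = x \<oplus>\<^bsub>R\<^esub> y"
  "x \<odot>\<^bsub>regular_module R\<^esub> y = x \<otimes>\<^bsub>R\<^esub> y"
  by (simp_all add: regular_module_def)

lemma power_simps [simp]:
  "carrier (power_module I M) = I \<rightarrow>\<^sub>E carrier M"
  "\<zero>\<^bsub>power_module I M\<^esub> = (\<lambda>i\<in>I. \<zero>\<^bsub>M\<^esub>)"
  "f \<oplus>\<^bsub>power_module I M\<^esub> g = (\<lambda>i\<in>I. f i \<oplus>\<^bsub>M\<^esub> g i)"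
  "r \<odot>\<^bsub>power_module I M\<^esub> f = (\<lambda>i\<in>I. r \<odot>\<^bsub>M\<^esub> f i)"
  by (simp_all add: power_module_def)

lemma copower_simps [simp]:
  "carrier (copower_module I M) = {f \<in> I \<rightarrow>\<^sub>E carrier M. finite {i \<in> I. f i \<noteq> \<zero>\<^bsub>M\<^esub>}}"
  "\<zero>\<^bsub>copower_module I M\<^esub> = (\<lambda>i\<in>I. \<zero>\<^bsub>M\<^esub>)"
  "f \<oplus>\<^bsub>copower_module I M\<^esub> g = (\<lambda>i\<in>I. f i \<oplus>\<^bsub>M\<^esub> g i)"
  "r \<odot>\<^bsub>copower_module I M\<^esub> f = (\<lambda>i\<in>I. r \<odot>\<^bsub>M\<^esub> f i)"
  by (simp_all add: copower_module_def power_module_def)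

lemma Hom_simps [simp]:
  "carrier (Hom_module R M N) = linear_maps R M N \<inter> extensional (carrier M)"
  "\<zero>\<^bsub>Hom_module R M N\<^esub> = (\<lambda>x\<in>carrier M. \<zero>\<^bsub>N\<^esub>)"
  "f \<oplus>\<^bsub>Hom_module R M N\<^esub> g = (\<lambda>x\<in>carrier M. f x \<oplus>\<^bsub>N\<^esub> g x)"
  "r \<odot>\<^bsub>Hom_module R M N\<^esub> f = (\<lambda>x\<in>carrier M. r \<odot>\<^bsub>N\<^esub> f x)"
  by (simp_all add: Hom_module_def)

lemma (in ring) regular_left_module: "left_module R (regular_module R)"
proof (intro left_module.intro left_module_axioms.intro ring_axioms abelian_groupI)
  show "\<exists>y\<in>carrier (regular_module R). y \<oplus>\<^bsub>regular_module R\<^esub> x = \<zero>\<^bsub>regular_module R\<^esub>"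
    if "x \<in> carrier (regular_module R)" for x
    using that l_neg by (auto intro!: bexI[of _ "\<ominus> x"])
qed (auto simp: l_distr r_distr m_assoc a_ac)

context left_module
begin

lemma submodule_left_module:
  assumes "submodule H A X"
  shows "left_module A (X\<lparr>carrier := H\<rparr>)"
proof (intro left_module.intro left_module_axioms.intro A.ring_axioms abelian_groupI)
  note c = submodule_subset[OF assms]
  show "\<exists>y\<in>carrier (X\<lparr>carrier := H\<rparr>). y \<oplus>\<^bsub>X\<lparr>carrier := H\<rparr>\<^esub> x = \<zero>\<^bsub>X\<lparr>carrier := H\<rparr>\<^esub>"
    if "x \<in> carrier (X\<lparr>carrier := H\<rparr>)" for x
    using that c X.l_neg submodule_minus[OF assms] by (auto intro!: bexI[of _ "\<ominus>\<^bsub>X\<^esub> x"])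
qed (use submodule_subset[OF assms] submodule_zero[OF assms] submodule_add[OF assms]
      submodule.smult_closed[OF assms] in
    \<open>auto simp: act_l_distr act_r_distr act_assoc act_one X.a_ac\<close>)

lemma power_left_module: "left_module A (power_module I X)"
proof (intro left_module.intro left_module_axioms.intro A.ring_axioms abelian_groupI)
  show "\<exists>g\<in>carrier (power_module I X). g \<oplus>\<^bsub>power_module I X\<^esub> f = \<zero>\<^bsub>power_module I X\<^esub>"
    if "f \<in> carrier (power_module I X)" for f
    using that by (auto intro!: bexI[of _ "\<lambda>i\<in>I. \<ominus>\<^bsub>X\<^esub> f i"] simp: X.l_neg PiE_iff fun_eq_iff)
qed (auto simp: act_closed act_l_distr act_r_distr act_assoc act_one X.a_ac PiE_iff fun_eq_iff
    extensional_def restrict_def)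

lemma copower_left_module: "left_module A (copower_module I X)"
proof -
  interpret P: left_module A "power_module I X" by (rule power_left_module)
  let ?S = "{f \<in> I \<rightarrow>\<^sub>E carrier X. finite {i \<in> I. f i \<noteq> \<zero>\<^bsub>X\<^esub>}}"
  have "submodule ?S A (power_module I X)"
  proof (rule P.submoduleI)
    fix f g assume fg: "f \<in> ?S" "g \<in> ?S"
    have "{i \<in> I. f i \<oplus>\<^bsub>X\<^esub> g i \<noteq> \<zero>\<^bsub>X\<^esub>} \<subseteq> {i \<in> I. f i \<noteq> \<zero>\<^bsub>X\<^esub>} \<union> {i \<in> I. g i \<noteq> \<zero>\<^bsub>X\<^esub>}"
      using fg by (auto simp: PiE_iff)
    then show "f \<oplus>\<^bsub>power_module I X\<^esub> g \<in> ?S"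
      using fg by (auto simp: PiE_iff intro: finite_subset cong: conj_cong)
  next
    fix a f assume af: "a \<in> carrier A" "f \<in> ?S"
    have "{i \<in> I. a \<odot>\<^bsub>X\<^esub> f i \<noteq> \<zero>\<^bsub>X\<^esub>} \<subseteq> {i \<in> I. f i \<noteq> \<zero>\<^bsub>X\<^esub>}"
      using af by auto
    then show "a \<odot>\<^bsub>power_module I X\<^esub> f \<in> ?S"
      using af by (auto simp: PiE_iff act_closed intro: finite_subset cong: conj_cong)
  qed auto
  from P.submodule_left_module[OF this] show ?thesis by (simp add: copower_module_def)
qed

end

lemma Hom_left_module:
  assumes "cring R" "left_module R M" "left_module R N"
  shows "left_module R (Hom_module R M N)"
proof -
  interpret R: cring R by fact
  interpret M: left_module R M by fact
  interpret N: left_module R N by fact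
  interpret P: left_module R "power_module (carrier M) N" by (rule N.power_left_module)
  have "submodule (linear_maps R M N \<inter> extensional (carrier M)) R (power_module (carrier M) N)"
  proof (rule P.submoduleI)
    fix f g assume "f \<in> linear_maps R M N \<inter> extensional (carrier M)"
      "g \<in> linear_maps R M N \<inter> extensional (carrier M)"
    then show "f \<oplus>\<^bsub>power_module (carrier M) N\<^esub> g \<in> linear_maps R M N \<inter> extensional (carrier M)"
      by (auto simp: linear_maps_def Pi_def N.X.a_ac N.act_r_distr M.act_closed)
  next
    fix r f assume r: "r \<in> carrier R" and f: "f \<in> linear_maps R M N \<inter> extensional (carrier M)"
    have "r \<odot>\<^bsub>N\<^esub> (s \<odot>\<^bsub>N\<^esub> y) = s \<odot>\<^bsub>N\<^esub> (r \<odot>\<^bsub>N\<^esub> y)" if "s \<in> carrier R" "y \<in> carrier N" for s y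
      using r that R.m_comm[of r s] N.act_assoc[of r s y] N.act_assoc[of s r y] by simp
    then show "r \<odot>\<^bsub>power_module (carrier M) N\<^esub> f \<in> linear_maps R M N \<inter> extensional (carrier M)"
      using r f by (auto simp: linear_maps_def Pi_def N.act_r_distr M.act_closed N.act_closed)
  qed (auto simp: linear_maps_def M.act_closed extensional_def)
  moreover have "Hom_module R M N = power_module (carrier M) N
      \<lparr>carrier := linear_maps R M N \<inter> extensional (carrier M)\<rparr>"
    by (simp add: Hom_module_def power_module_def)
  ultimately show ?thesis using P.submodule_left_module by metis
qed

context left_module
begin

lemma submodule_sum:
  assumes D: "submodule D A X" and S: "submodule S A X"
  shows "submodule {d \<oplus>\<^bsub>X\<^esub> s | d s. d \<in> D \<and> s \<in> S} A X"
proof (rule submoduleI)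
  note c = submodule_subset[OF D] submodule_subset[OF S]
  show "{d \<oplus>\<^bsub>X\<^esub> s | d s. d \<in> D \<and> s \<in> S} \<subseteq> carrier X" using c by auto
  show "\<zero>\<^bsub>X\<^esub> \<in> {d \<oplus>\<^bsub>X\<^esub> s | d s. d \<in> D \<and> s \<in> S}"
    using submodule_zero[OF D] submodule_zero[OF S] by force
  show "x \<oplus>\<^bsub>X\<^esub> y \<in> {d \<oplus>\<^bsub>X\<^esub> s | d s. d \<in> D \<and> s \<in> S}"
    if xy: "x \<in> {d \<oplus>\<^bsub>X\<^esub> s | d s. d \<in> D \<and> s \<in> S}" "y \<in> {d \<oplus>\<^bsub>X\<^esub> s | d s. d \<in> D \<and> s \<in> S}" for x y
  proof -
    obtain d s d' s' where e: "x = d \<oplus>\<^bsub>X\<^esub> s" "y = d' \<oplus>\<^bsub>X\<^esub> s'" "d \<in> D" "s \<in> S" "d' \<in> D" "s' \<in> S"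
      using xy by auto
    then have "x \<oplus>\<^bsub>X\<^esub> y = (d \<oplus>\<^bsub>X\<^esub> d') \<oplus>\<^bsub>X\<^esub> (s \<oplus>\<^bsub>X\<^esub> s')"
      using c by (simp add: X.a_ac)
    then show ?thesis using e submodule_add[OF D] submodule_add[OF S] by blast
  qed
  show "a \<odot>\<^bsub>X\<^esub> x \<in> {d \<oplus>\<^bsub>X\<^esub> s | d s. d \<in> D \<and> s \<in> S}"
    if a: "a \<in> carrier A" and x: "x \<in> {d \<oplus>\<^bsub>X\<^esub> s | d s. d \<in> D \<and> s \<in> S}" for a x
  proof -
    obtain d s where e: "x = d \<oplus>\<^bsub>X\<^esub> s" "d \<in> D" "s \<in> S" using x by auto
    then have "a \<odot>\<^bsub>X\<^esub> x = a \<odot>\<^bsub>X\<^esub> d \<oplus>\<^bsub>X\<^esub> a \<odot>\<^bsub>X\<^esub> s" using c a by (simp add: act_r_distr)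
    then show ?thesis using e a submodule.smult_closed[OF D] submodule.smult_closed[OF S] by blast
  qed
qed

lemma span_Un_span:
  assumes "S \<subseteq> carrier X" "T \<subseteq> carrier X" "D \<subseteq> submodule_span A X T"
  shows "submodule_span A X (D \<union> S) \<subseteq> submodule_span A X (T \<union> S)"
  using assms span_mono[of T "T \<union> S" A X] span_superset[of "T \<union> S" A X]
  by (intro span_least span_submodule) auto

lemma submodule_cancel:
  assumes "submodule D A X" "x \<in> carrier X" "y \<in> D" "x \<ominus>\<^bsub>X\<^esub> y \<in> D"
  shows "x \<in> D"
proof -
  have "(x \<ominus>\<^bsub>X\<^esub> y) \<oplus>\<^bsub>X\<^esub> y = x"
    using assms(2) submodule_subset[OF assms(1,3)] by (simp add: X.minus_eq X.a_assoc X.l_neg)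
  then show ?thesis using submodule_add[OF assms(1,4,3)] by simp
qed

end

lemma (in cring) submodule_regular_imp_ideal: "submodule J R (regular_module R) \<Longrightarrow> ideal J R"
proof (rule idealI[OF ring_axioms])
  assume J: "submodule J R (regular_module R)"
  show "subgroup J (add_monoid R)"
    using submodule.axioms(1)[OF J] by (simp add: regular_module_def subgroup_def m_inv_def)
  fix a x assume a: "a \<in> J" "x \<in> carrier R"
  then show "x \<otimes> a \<in> J" using submodule.smult_closed[OF J, of x a] by simp
  then show "a \<otimes> x \<in> J" using a submodule_subset[OF J] m_comm[of a x] by simp
qed

locale cring_module = R?: cring R + M?: left_module R M
  for R :: "('r, 'k) ring_scheme" (structure) and M :: "('r, 'b, 'm) module_scheme" (structure)
begin

text \<open>The coefficients that occur at \<open>y\<close> in the elements of \<open>D \<inter> (R y + B)\<close>. As for leading coefficients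
  of polynomials, a submodule \<open>D\<close> of \<open>R y + B\<close> is controlled by this ideal together with \<open>D \<inter> B\<close>.\<close>

definition leading :: "'b \<Rightarrow> 'b set \<Rightarrow> 'b set \<Rightarrow> 'r set" where
  "leading y B D = {r \<in> carrier R. r \<odot>\<^bsub>M\<^esub> y \<in> {d \<oplus>\<^bsub>M\<^esub> b | d b. d \<in> D \<and> b \<in> B}}"

lemma leading_ideal:
  assumes "y \<in> carrier M" "submodule B R M" "submodule D R M"
  shows "ideal (leading y B D) R"
proof -
  interpret l: linear_map R "regular_module R" M "\<lambda>r. r \<odot>\<^bsub>M\<^esub> y"
    using assms(1)
    by (intro linear_map.intro linear_map_axioms.intro R.regular_left_module M.left_module_axioms linear_mapsI)
      (auto simp: act_closed act_l_distr act_assoc)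
  show ?thesis
    using submodule_regular_imp_ideal[OF l.vimage_submodule[OF M.submodule_sum[OF assms(3,2)]]]
    by (simp add: leading_def)
qed

lemma leading_mono: "D \<subseteq> D' \<Longrightarrow> leading y B D \<subseteq> leading y B D'"
  by (auto simp: leading_def)

lemma leadingI:
  assumes "submodule B R M" "y \<in> carrier M" "r \<in> carrier R" "b \<in> B" "r \<odot>\<^bsub>M\<^esub> y \<oplus>\<^bsub>M\<^esub> b \<in> D"
  shows "r \<in> leading y B D"
proof -
  have "r \<odot>\<^bsub>M\<^esub> y = (r \<odot>\<^bsub>M\<^esub> y \<oplus>\<^bsub>M\<^esub> b) \<oplus>\<^bsub>M\<^esub> \<ominus>\<^bsub>M\<^esub> b"
    using assms submodule_subset[OF assms(1,4)] by (simp add: act_closed M.X.a_assoc M.X.r_neg)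
  then show ?thesis using assms submodule_minus[OF assms(1,4)] unfolding leading_def by blast
qed

lemma leadingE:
  assumes "submodule B R M" "submodule D R M" "y \<in> carrier M" "r \<in> leading y B D" "b \<in> B"
  obtains d where "d \<in> D" "(r \<odot>\<^bsub>M\<^esub> y \<oplus>\<^bsub>M\<^esub> b) \<ominus>\<^bsub>M\<^esub> d \<in> B"
proof -
  obtain d b' where d: "r \<in> carrier R" "d \<in> D" "b' \<in> B" "r \<odot>\<^bsub>M\<^esub> y = d \<oplus>\<^bsub>M\<^esub> b'"
    using assms(4) by (auto simp: leading_def)
  note c = submodule_subset[OF assms(1)] submodule_subset[OF assms(2)]
  have "(r \<odot>\<^bsub>M\<^esub> y \<oplus>\<^bsub>M\<^esub> b) \<ominus>\<^bsub>M\<^esub> d = (d \<oplus>\<^bsub>M\<^esub> (b' \<oplus>\<^bsub>M\<^esub> b)) \<oplus>\<^bsub>M\<^esub> \<ominus>\<^bsub>M\<^esub> d"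
    unfolding d(4) using c d assms(5) by (simp add: M.X.minus_eq M.X.a_assoc)
  also have "\<dots> = b' \<oplus>\<^bsub>M\<^esub> b"
    using c d assms(5) by (metis M.X.a_comm M.X.a_inv_closed M.X.add.m_closed M.X.r_neg1)
  finally show ?thesis using that[OF d(2)] d(3) assms(5) submodule_add[OF assms(1)] by simp
qed

text \<open>Submodules of finitely generated modules are finitely generated, relative to a submodule \<open>N\<close>.
  By induction on the generators \<open>S\<close> of the larger module modulo \<open>N\<close>: when \<open>y\<close> is adjoined, lift
  finitely many generators of the ideal of leading coefficients at \<open>y\<close> to \<open>D\<close>; they reduce every
  element of \<open>D\<close> to one of \<open>D \<inter> B\<close>, where \<open>B\<close> is the span of \<open>N\<close> and the earlier generators.\<close>

lemma noetherian_relative_fg: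
  assumes "noetherian_ring R" and N: "submodule N R M"
    and "finite S" "S \<subseteq> carrier M" and "submodule D R M" "D \<subseteq> submodule_span R M (N \<union> S)"
  shows "\<exists>Z. finite Z \<and> Z \<subseteq> D \<and> D \<subseteq> submodule_span R M ((D \<inter> N) \<union> Z)"
  using assms(3-)
proof (induction S arbitrary: D)
  case empty
  then have "D \<subseteq> D \<inter> N" using span_of_submodule[OF N] by simp
  then show ?case using span_superset[of "D \<inter> N" R M] by (intro exI[of _ "{}"]) auto
next
  case (insert y S)
  have NM: "N \<subseteq> carrier M" using submodule_subset[OF N] by auto
  have DM: "D \<subseteq> carrier M" using submodule_subset[OF insert.prems(2)] by auto
  note D = insert.prems(2)
  define B where "B = submodule_span R M (N \<union> S)"
  have y: "y \<in> carrier M" using insert by simp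
  have B: "submodule B R M" unfolding B_def using NM insert.prems by (intro M.span_submodule) auto
  have Dsp: "D \<subseteq> {r \<odot>\<^bsub>M\<^esub> y \<oplus>\<^bsub>M\<^esub> b | r b. r \<in> carrier R \<and> b \<in> B}"
    using insert.prems(3) M.span_insert_span[of "N \<union> S" y] NM insert.prems(1) M.span_insert[OF B y]
    by (simp add: B_def)
  obtain G where G: "finite G" "G \<subseteq> carrier R" "leading y B D = Idl G"
    using noetherian_ring.finetely_gen[OF assms(1) leading_ideal[OF y B D]] by blast
  have GJ: "G \<subseteq> leading y B D" unfolding G(3) by (rule R.genideal_self[OF G(2)])
  have "\<forall>g\<in>G. \<exists>d\<in>D. g \<in> leading y B {d}"
    using GJ by (auto simp: leading_def)
  then obtain d where d: "\<And>g. g \<in> G \<Longrightarrow> d g \<in> D \<and> g \<in> leading y B {d g}" by metis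
  have D': "submodule (D \<inter> B) R M" by (rule M.submodule_Int[OF D B])
  obtain Z2 where Z2: "finite Z2" "Z2 \<subseteq> D \<inter> B" "D \<inter> B \<subseteq> submodule_span R M (D \<inter> B \<inter> N \<union> Z2)"
    using insert.IH[OF _ D'] insert.prems(1) by (auto simp: B_def)
  define Z where "Z = d ` G \<union> Z2"
  define W where "W = submodule_span R M (D \<inter> N \<union> Z)"
  have Z: "finite Z" "Z \<subseteq> D" using G d Z2 by (auto simp: Z_def)
  have W: "submodule W R M" unfolding W_def using Z DM by (intro M.span_submodule) auto
  have WD: "W \<subseteq> D" unfolding W_def using Z by (intro span_least[OF D]) auto
  have DW: "D \<inter> B \<subseteq> W"
    using Z2(3) span_mono[of "D \<inter> B \<inter> N \<union> Z2" "D \<inter> N \<union> Z" R M] by (auto simp: W_def Z_def)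
  have "d g \<in> W" if "g \<in> G" for g
    using that span_superset[of "D \<inter> N \<union> Z" R M] by (auto simp: W_def Z_def)
  then have "G \<subseteq> leading y B W"
    using d leading_mono[of "{d g}" W y B for g] by blast
  then have JW: "leading y B D \<subseteq> leading y B W"
    unfolding G(3) by (rule R.genideal_minimal[OF leading_ideal[OF y B W]])
  \<comment> \<open>subtract from an element of \<open>D\<close> an element of \<open>W\<close> with the same coefficient at \<open>y\<close>\<close>
  have "D \<subseteq> W"
  proof
    fix x assume x: "x \<in> D"
    then obtain r b where rb: "x = r \<odot>\<^bsub>M\<^esub> y \<oplus>\<^bsub>M\<^esub> b" "r \<in> carrier R" "b \<in> B" using Dsp by blast
    then have "r \<in> leading y B W" using leadingI[OF B y rb(2,3)] x JW by blast
    then obtain w where w: "w \<in> W" "x \<ominus>\<^bsub>M\<^esub> w \<in> B" using leadingE[OF B W y _ rb(3)] rb(1) by blast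
    then have "x \<ominus>\<^bsub>M\<^esub> w \<in> W" using DW submodule_diff[OF D x] WD by blast
    then show "x \<in> W" using M.submodule_cancel[OF W _ w(1)] x DM by blast
  qed
  then show ?case using Z by (auto simp: W_def)
qed

text \<open>Finitely generated modules over an artinian ring satisfy the descending chain condition. It is
  the same induction: once the leading ideals at \<open>y\<close> and the intersections with \<open>B\<close> are stationary,
  an element of \<open>D n\<close> differs from one of \<open>D m\<close> by an element of \<open>D n \<inter> B \<subseteq> D m\<close>.\<close>

lemma artinian_chain_stabilizes:
  assumes "artinian_ring R" and N: "submodule N R M" and "finite S" "S \<subseteq> carrier M"
    and D: "\<And>n. submodule (D n) R M" and dec: "\<And>n. D (Suc n) \<subseteq> D n" and ND: "\<And>n. N \<subseteq> D n"
  shows "\<exists>n. \<forall>m\<ge>n. D n \<inter> submodule_span R M (N \<union> S) \<subseteq> D m"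
  using assms(3,4)
proof (induction S)
  case empty
  then show ?case using span_of_submodule[OF N] ND by auto
next
  case (insert y S)
  have NM: "N \<subseteq> carrier M" using submodule_subset[OF N] by auto
  have dec': "D m \<subseteq> D n" if "n \<le> m" for n m
    using lift_Suc_antimono_le[of D] dec that by blast
  define B where "B = submodule_span R M (N \<union> S)"
  have y: "y \<in> carrier M" using insert by simp
  have B: "submodule B R M" unfolding B_def using NM insert.prems by (intro M.span_submodule) auto
  have sp: "submodule_span R M (N \<union> insert y S) = {r \<odot>\<^bsub>M\<^esub> y \<oplus>\<^bsub>M\<^esub> b | r b. r \<in> carrier R \<and> b \<in> B}"
    using M.span_insert_span[of "N \<union> S" y] NM insert.prems M.span_insert[OF B y]
    by (simp add: B_def)
  obtain n2 where n2: "\<And>m. m \<ge> n2 \<Longrightarrow> D n2 \<inter> B \<subseteq> D m" using insert by (auto simp: B_def)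
  obtain n1 where n1: "\<And>m. m \<ge> n1 \<Longrightarrow> leading y B (D m) = leading y B (D n1)"
    using artinian_ring.descending_chain[OF assms(1), of "\<lambda>n. leading y B (D n)"]
      leading_ideal[OF y B D] leading_mono[OF dec] by blast
  let ?n = "max n1 n2"
  have "x \<in> D m" if m: "m \<ge> ?n" and x: "x \<in> D ?n" "x \<in> submodule_span R M (N \<union> insert y S)" for m x
  proof -
    obtain r b where rb: "x = r \<odot>\<^bsub>M\<^esub> y \<oplus>\<^bsub>M\<^esub> b" "r \<in> carrier R" "b \<in> B" using x sp by blast
    have "r \<in> leading y B (D ?n)" using leadingI[OF B y rb(2,3)] x rb(1) by blast
    then have "r \<in> leading y B (D m)" using n1[of m] n1[of ?n] m by simp
    then obtain w where w: "w \<in> D m" "x \<ominus>\<^bsub>M\<^esub> w \<in> B" using leadingE[OF B D y _ rb(3)] rb(1) by blast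
    have "w \<in> D ?n" using w(1) dec'[OF m] by blast
    then have "x \<ominus>\<^bsub>M\<^esub> w \<in> D ?n" using submodule_diff[OF D x(1)] by blast
    then have "x \<ominus>\<^bsub>M\<^esub> w \<in> D m" using n2[of m] m w(2) dec'[of n2 ?n] by auto
    then show ?thesis using M.submodule_cancel[OF D _ w(1)] submodule_subset[OF D x(1)] by blast
  qed
  then show ?case by blast
qed

end

lemma kernel_cofinite:
  assumes "cring R" "noetherian_ring R" "linear_map R M Y f"
    and D: "submodule D R M" and S: "finite S" "S \<subseteq> carrier Y" "f ` D \<subseteq> submodule_span R Y S"
  shows "\<exists>Z. finite Z \<and> Z \<subseteq> D \<and> D \<subseteq> submodule_span R M ({d \<in> D. f d = \<zero>\<^bsub>Y\<^esub>} \<union> Z)"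
proof -
  interpret linear_map R M Y f by fact
  interpret YC: cring_module R Y
    by (intro cring_module.intro assms(1) Y.left_module_axioms)
  have DM: "D \<subseteq> carrier M" using submodule_subset[OF D] by auto
  have "submodule_span R Y S \<subseteq> submodule_span R Y ({\<zero>\<^bsub>Y\<^esub>} \<union> S)" by (rule span_mono) auto
  then obtain Z' where Z': "finite Z'" "Z' \<subseteq> f ` D" "f ` D \<subseteq> submodule_span R Y ((f ` D \<inter> {\<zero>\<^bsub>Y\<^esub>}) \<union> Z')"
    using YC.noetherian_relative_fg[OF assms(2) Y.zero_submodule S(1,2) image_submodule[OF D]] S(3) by blast
  obtain Z where Z: "finite Z" "Z \<subseteq> D" "Z' = f ` Z" by (meson Z'(1,2) finite_subset_image)
  have Z'Y: "Z' \<subseteq> carrier Y" using Z DM closed by auto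
  have "submodule_span R Y ((f ` D \<inter> {\<zero>\<^bsub>Y\<^esub>}) \<union> Z') \<subseteq> submodule_span R Y Z'"
    using span_superset[of Z' R Y] submodule_zero[OF Y.span_submodule[OF Z'Y]]
    by (intro span_least Y.span_submodule[OF Z'Y]) auto
  then have fD: "f ` D \<subseteq> f ` submodule_span R M Z" using Z' image_span[of Z] Z DM by auto
  let ?W = "submodule_span R M ({d \<in> D. f d = \<zero>\<^bsub>Y\<^esub>} \<union> Z)"
  have W: "submodule ?W R M" using Z DM by (intro X.span_submodule) auto
  have "d \<in> ?W" if d: "d \<in> D" for d
  proof -
    obtain z where z: "z \<in> submodule_span R M Z" "f d = f z" using fD d by auto
    have zD: "z \<in> D" using z(1) span_least[OF D Z(2)] by auto
    have "d \<ominus>\<^bsub>M\<^esub> z \<in> {d \<in> D. f d = \<zero>\<^bsub>Y\<^esub>}"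
      using submodule_diff[OF D d zD] diff[of d z] z(2) d zD DM closed[of d] closed[of z]
        Y.diff_zero_iff[of "f z" "f z"] subsetD[OF DM d] subsetD[OF DM zD] by auto
    then have "d \<ominus>\<^bsub>M\<^esub> z \<in> ?W" using span_superset[of "{d \<in> D. f d = \<zero>\<^bsub>Y\<^esub>} \<union> Z" R M] by blast
    moreover have "z \<in> ?W" using z(1) span_mono[of Z "{d \<in> D. f d = \<zero>\<^bsub>Y\<^esub>} \<union> Z" R M] by blast
    ultimately show ?thesis using X.submodule_cancel[OF W] d DM by blast
  qed
  then show ?thesis using Z by blast
qed

text \<open>The common kernel of finitely many maps with finitely generated image has finitely generated
  index: cut down by one map at a time. It is applied to the maps \<open>\<langle>-, c\<rangle>\<close> on \<open>A\<close>, to \<open>\<langle>a, -\<rangle>\<close> on \<open>C\<close> and to \<open>a \<mapsto> a s\<close> for \<open>s\<close> in an \<open>A\<close>-module.\<close>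

lemma kernels_cofinite:
  assumes "cring R" "noetherian_ring R" "finite T" and f: "\<And>t. t \<in> T \<Longrightarrow> linear_map R M Y (f t)"
    and M: "left_module R M" and D: "submodule D R M"
    and S: "\<And>t. t \<in> T \<Longrightarrow> \<exists>S. finite S \<and> S \<subseteq> carrier Y \<and> f t ` D \<subseteq> submodule_span R Y S"
  shows "\<exists>Z. finite Z \<and> Z \<subseteq> D \<and> D \<subseteq> submodule_span R M ({d \<in> D. \<forall>t\<in>T. f t d = \<zero>\<^bsub>Y\<^esub>} \<union> Z)"
  using assms(3) f S
proof (induction T)
  case empty
  then show ?case using span_superset[of D R M] by (intro exI[of _ "{}"]) auto
next
  case (insert t T)
  interpret M: left_module R M by (rule M)
  interpret t: linear_map R M Y "f t" using insert.prems by simp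
  have DM: "D \<subseteq> carrier M" using submodule_subset[OF D] by auto
  let ?D1 = "{d \<in> D. \<forall>t\<in>T. f t d = \<zero>\<^bsub>Y\<^esub>}" and ?D2 = "{d \<in> D. \<forall>t\<in>insert t T. f t d = \<zero>\<^bsub>Y\<^esub>}"
  obtain Z where Z: "finite Z" "Z \<subseteq> D" "D \<subseteq> submodule_span R M (?D1 \<union> Z)"
    using insert by auto
  have D1: "submodule ?D1 R M"
  proof (rule M.submoduleI)
    show "?D1 \<subseteq> carrier M" using DM by auto
    show "\<zero>\<^bsub>M\<^esub> \<in> ?D1" using submodule_zero[OF D] linear_map.zero[OF insert.prems(1)] by auto
    show "x \<oplus>\<^bsub>M\<^esub> y \<in> ?D1" if "x \<in> ?D1" "y \<in> ?D1" for x y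
      using that submodule_add[OF D] linear_map.add[OF insert.prems(1)] submodule_subset[OF D] by auto
    show "a \<odot>\<^bsub>M\<^esub> x \<in> ?D1" if "a \<in> carrier R" "x \<in> ?D1" for a x
      using that submodule.smult_closed[OF D] linear_map.smult[OF insert.prems(1)] submodule_subset[OF D]
      by auto
  qed
  obtain S where S: "finite S" "S \<subseteq> carrier Y" "f t ` D \<subseteq> submodule_span R Y S"
    using insert.prems(2)[of t] by auto
  obtain Z' where Z': "finite Z'" "Z' \<subseteq> ?D1" "?D1 \<subseteq> submodule_span R M ({d \<in> ?D1. f t d = \<zero>\<^bsub>Y\<^esub>} \<union> Z')"
    using kernel_cofinite[OF assms(1,2) t.linear_map_axioms D1 S(1,2) subset_trans[OF image_mono S(3)]] by blast
  have e: "{d \<in> ?D1. f t d = \<zero>\<^bsub>Y\<^esub>} = ?D2" by auto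
  have "submodule_span R M (?D1 \<union> Z) \<subseteq> submodule_span R M ((?D2 \<union> Z') \<union> Z)"
    by (rule M.span_Un_span) (use Z(2) Z'(2,3) DM e in auto)
  then have "D \<subseteq> submodule_span R M ((?D2 \<union> Z') \<union> Z)" using Z(3) by simp
  then show ?case using Z Z' by (intro exI[of _ "Z' \<union> Z"]) (auto simp: Un_assoc)
qed

lemma (in ring) regular_span_one: "submodule_span R (regular_module R) {\<one>} = carrier R"
proof -
  interpret left_module R "regular_module R" by (rule regular_left_module)
  have "submodule (submodule_span R (regular_module R) {\<one>}) R (regular_module R)"
    by (rule span_submodule) simp
  then have "r \<in> submodule_span R (regular_module R) {\<one>}" if "r \<in> carrier R" for r
    using submodule.smult_closed[of _ R "regular_module R" r \<one>] span_superset[of "{\<one>}"] that by auto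
  then show ?thesis using span_subset_carrier[of "{\<one>}"] by auto
qed

section \<open>Tensor products\<close>

lemma (in left_module) act_finsum:
  assumes "finite Q" "a \<in> carrier A" "\<And>q. q \<in> Q \<Longrightarrow> f q \<in> carrier X"
  shows "a \<odot>\<^bsub>X\<^esub> (\<Oplus>\<^bsub>X\<^esub>q\<in>Q. f q) = (\<Oplus>\<^bsub>X\<^esub>q\<in>Q. a \<odot>\<^bsub>X\<^esub> f q)"
  using assms(1,3)
proof (induction Q)
  case empty
  then show ?case using assms(2) by simp
next
  case (insert q Q)
  then show ?case using assms(2) by (simp add: Pi_def act_r_distr act_closed)
qed

text \<open>The map out of \<open>M\<^bsup>(I)\<^esup>\<close> with components \<open>l i\<close>.\<close>

definition copower_lift ::
  "('r, 'b, 'm) module_scheme \<Rightarrow> ('r, 'z, 'l) module_scheme \<Rightarrow> 'i set \<Rightarrow> ('i \<Rightarrow> 'b \<Rightarrow> 'z) \<Rightarrow> ('i \<Rightarrow> 'b) \<Rightarrow> 'z" where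
  "copower_lift M Z I l f = (\<Oplus>\<^bsub>Z\<^esub>i\<in>{i \<in> I. f i \<noteq> \<zero>\<^bsub>M\<^esub>}. l i (f i))"

lemma copower_lift_superset:
  assumes "left_module R Z" and l: "\<And>i. i \<in> I \<Longrightarrow> linear_map R M Z (l i)"
    and f: "\<And>i. i \<in> I \<Longrightarrow> f i \<in> carrier M"
    and Q: "finite Q" "Q \<subseteq> I" "{i \<in> I. f i \<noteq> \<zero>\<^bsub>M\<^esub>} \<subseteq> Q"
  shows "copower_lift M Z I l f = (\<Oplus>\<^bsub>Z\<^esub>i\<in>Q. l i (f i))"
proof -
  interpret Z: left_module R Z by fact
  have zero: "l i (f i) = \<zero>\<^bsub>Z\<^esub>" if "i \<in> Q - {i \<in> I. f i \<noteq> \<zero>\<^bsub>M\<^esub>}" for i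
    using that Q(2) linear_map.zero[OF l] by auto
  have cl: "l i (f i) \<in> carrier Z" if "i \<in> Q" for i
    using that Q(2) linear_map.closed[OF l f] by auto
  show ?thesis
    unfolding copower_lift_def
    using Z.X.add.finprod_mono_neutral_cong_left[OF Q(1,3), of "\<lambda>i. l i (f i)" "\<lambda>i. l i (f i)"] zero cl
    by blast
qed

lemma copower_lift_linear_map:
  assumes "cring R" and M: "left_module R M" and Z: "left_module R Z"
    and l: "\<And>i. i \<in> I \<Longrightarrow> linear_map R M Z (l i)"
  shows "linear_map R (copower_module I M) Z (copower_lift M Z I l)"
proof (intro linear_map.intro linear_map_axioms.intro left_module.copower_left_module M Z linear_mapsI)
  interpret M: left_module R M by (rule M)
  interpret Z: left_module R Z by (rule Z)
  let ?S = "\<lambda>f. {i \<in> I. f i \<noteq> \<zero>\<^bsub>M\<^esub>}"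
  have fc: "f i \<in> carrier M" if "f \<in> carrier (copower_module I M)" "i \<in> I" for f i
    using that by auto
  have fin: "finite (?S f)" if "f \<in> carrier (copower_module I M)" for f
    using that by simp
  have lc: "l i (f i) \<in> carrier Z" if "f \<in> carrier (copower_module I M)" "i \<in> I" for f i
    using linear_map.closed[OF l[OF that(2)] fc[OF that]] .
  show "copower_lift M Z I l f \<in> carrier Z" if "f \<in> carrier (copower_module I M)" for f
    unfolding copower_lift_def using lc[OF that] by (intro Z.X.finsum_closed) auto
  show "copower_lift M Z I l (f \<oplus>\<^bsub>copower_module I M\<^esub> g) = copower_lift M Z I l f \<oplus>\<^bsub>Z\<^esub> copower_lift M Z I l g"
    if fg: "f \<in> carrier (copower_module I M)" "g \<in> carrier (copower_module I M)" for f g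
  proof -
    let ?Q = "?S f \<union> ?S g"
    have Q: "finite ?Q" "?Q \<subseteq> I" using fin[OF fg(1)] fin[OF fg(2)] by auto
    note sup = copower_lift_superset[OF Z l _ Q]
    have "copower_lift M Z I l (f \<oplus>\<^bsub>copower_module I M\<^esub> g) = (\<Oplus>\<^bsub>Z\<^esub>i\<in>?Q. l i (f i \<oplus>\<^bsub>M\<^esub> g i))"
      by (subst sup) (use fc[OF fg(1)] fc[OF fg(2)] in \<open>auto intro!: Z.X.finsum_cong' linear_map.closed[OF l]\<close>)
    also have "\<dots> = (\<Oplus>\<^bsub>Z\<^esub>i\<in>?Q. l i (f i) \<oplus>\<^bsub>Z\<^esub> l i (g i))"
      using fc[OF fg(1)] fc[OF fg(2)] lc[OF fg(1)] lc[OF fg(2)] linear_map.add[OF l]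
      by (intro Z.X.finsum_cong') auto
    also have "\<dots> = (\<Oplus>\<^bsub>Z\<^esub>i\<in>?Q. l i (f i)) \<oplus>\<^bsub>Z\<^esub> (\<Oplus>\<^bsub>Z\<^esub>i\<in>?Q. l i (g i))"
      using lc[OF fg(1)] lc[OF fg(2)] by (intro Z.X.finsum_addf) auto
    also have "(\<Oplus>\<^bsub>Z\<^esub>i\<in>?Q. l i (f i)) = copower_lift M Z I l f"
      by (rule sup[symmetric]) (use fc[OF fg(1)] in auto)
    also have "(\<Oplus>\<^bsub>Z\<^esub>i\<in>?Q. l i (g i)) = copower_lift M Z I l g"
      by (rule sup[symmetric]) (use fc[OF fg(2)] in auto)
    finally show ?thesis .
  qed
  show "copower_lift M Z I l (r \<odot>\<^bsub>copower_module I M\<^esub> f) = r \<odot>\<^bsub>Z\<^esub> copower_lift M Z I l f"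
    if r: "r \<in> carrier R" and f: "f \<in> carrier (copower_module I M)" for r f
  proof -
    have Q: "finite (?S f)" "?S f \<subseteq> I" using fin[OF f] by auto
    have "copower_lift M Z I l (r \<odot>\<^bsub>copower_module I M\<^esub> f) = (\<Oplus>\<^bsub>Z\<^esub>i\<in>?S f. l i (r \<odot>\<^bsub>M\<^esub> f i))"
      by (subst copower_lift_superset[OF Z l _ Q])
        (use fc[OF f] r in \<open>auto intro!: Z.X.finsum_cong' linear_map.closed[OF l] M.act_closed\<close>)
    also have "\<dots> = (\<Oplus>\<^bsub>Z\<^esub>i\<in>?S f. r \<odot>\<^bsub>Z\<^esub> l i (f i))"
      using fc[OF f] lc[OF f] r linear_map.smult[OF l] by (intro Z.X.finsum_cong') (auto intro!: Z.act_closed)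
    also have "\<dots> = r \<odot>\<^bsub>Z\<^esub> copower_lift M Z I l f"
      unfolding copower_lift_def using lc[OF f] r Q by (intro Z.act_finsum[symmetric]) auto
    finally show ?thesis .
  qed
qed

lemma copower_lift_single:
  assumes M: "left_module R M" and Z: "left_module R Z"
    and l: "\<And>i. i \<in> I \<Longrightarrow> linear_map R M Z (l i)" and i: "i \<in> I" and m: "m \<in> carrier M"
  shows "copower_lift M Z I l (\<lambda>j\<in>I. if j = i then m else \<zero>\<^bsub>M\<^esub>) = l i m"
proof -
  interpret M: left_module R M by (rule M)
  interpret Z: left_module R Z by (rule Z)
  have Q: "finite {i}" "{i} \<subseteq> I" using i by auto
  have "copower_lift M Z I l (\<lambda>j\<in>I. if j = i then m else \<zero>\<^bsub>M\<^esub>) =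
      (\<Oplus>\<^bsub>Z\<^esub>j\<in>{i}. l j ((\<lambda>j\<in>I. if j = i then m else \<zero>\<^bsub>M\<^esub>) j))"
    by (rule copower_lift_superset[OF Z l _ Q]) (use m in auto)
  then show ?thesis using i linear_map.closed[OF l[OF i] m] by simp
qed

lemma copower_lift_compose:
  assumes M: "left_module R M" and Z: "left_module R Z"
    and l: "\<And>i. i \<in> I \<Longrightarrow> linear_map R M Z (l i)" and k: "linear_map R Z Z' k"
    and f: "f \<in> carrier (copower_module I M)"
  shows "k (copower_lift M Z I l f) = copower_lift M Z' I (\<lambda>i x. k (l i x)) f"
  unfolding copower_lift_def using f
  by (intro linear_map.finsum[OF k]) (auto intro!: linear_map.closed[OF l])

locale module_pair = R?: cring R + M: left_module R M + N: left_module R N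
  for R :: "('r, 'k) ring_scheme" (structure)
    and M :: "('r, 'b, 'm) module_scheme" and N :: "('r, 'd, 'n) module_scheme"
begin

abbreviation "F \<equiv> free_on_pairs R M N"

lemma free_carrier: "carrier F = {f \<in> carrier M \<times> carrier N \<rightarrow>\<^sub>E carrier R.
    finite {q \<in> carrier M \<times> carrier N. f q \<noteq> \<zero>}}"
  by (simp add: free_on_pairs_def)

lemma free_left_module: "left_module R F"
  unfolding free_on_pairs_def by (rule left_module.copower_left_module[OF R.regular_left_module])

sublocale F: left_module R F by (rule free_left_module)

lemma pair_gen_carrier: "x \<in> carrier M \<Longrightarrow> y \<in> carrier N \<Longrightarrow> pair_gen R M N x y \<in> carrier F"
proof -
  have "finite {q \<in> carrier M \<times> carrier N. pair_gen R M N x y q \<noteq> \<zero>}"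
    by (rule finite_subset[of _ "{(x, y)}"]) (auto simp: pair_gen_def split: if_splits)
  then show ?thesis unfolding free_carrier by (auto simp: pair_gen_def)
qed

lemma relations_carrier: "tensor_relations R M N \<subseteq> carrier F"
  unfolding tensor_relations_def Let_def
  by (auto intro!: F.X.minus_closed F.X.a_closed pair_gen_carrier F.act_closed M.act_closed N.act_closed)

lemma kernel_submodule: "submodule (tensor_kernel R M N) R F"
  unfolding tensor_kernel_def by (rule F.span_submodule[OF relations_carrier])

lemma tensor_carrier:
  "carrier (tensor R M N) = (\<lambda>f. tensor_kernel R M N +>\<^bsub>F\<^esub> f) ` carrier F"
  unfolding tensor_def by (rule F.quotient_carrier)

text \<open>Stated for an arbitrary submodule \<open>B\<close>, since it is needed also for a map that respects the
  bilinearity relations only up to a nonzero \<open>B\<close>.\<close>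

lemma tensor_kernel_mapsto:
  assumes l: "linear_map R F Z l" and B: "submodule B R Z"
    and "\<And>x x' y. \<lbrakk>x \<in> carrier M; x' \<in> carrier M; y \<in> carrier N\<rbrakk> \<Longrightarrow>
      l (pair_gen R M N (x \<oplus>\<^bsub>M\<^esub> x') y) \<ominus>\<^bsub>Z\<^esub> (l (pair_gen R M N x y) \<oplus>\<^bsub>Z\<^esub> l (pair_gen R M N x' y)) \<in> B"
    and "\<And>x y y'. \<lbrakk>x \<in> carrier M; y \<in> carrier N; y' \<in> carrier N\<rbrakk> \<Longrightarrow>
      l (pair_gen R M N x (y \<oplus>\<^bsub>N\<^esub> y')) \<ominus>\<^bsub>Z\<^esub> (l (pair_gen R M N x y) \<oplus>\<^bsub>Z\<^esub> l (pair_gen R M N x y')) \<in> B"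
    and "\<And>r x y. \<lbrakk>r \<in> carrier R; x \<in> carrier M; y \<in> carrier N\<rbrakk> \<Longrightarrow>
      l (pair_gen R M N (r \<odot>\<^bsub>M\<^esub> x) y) \<ominus>\<^bsub>Z\<^esub> r \<odot>\<^bsub>Z\<^esub> l (pair_gen R M N x y) \<in> B"
    and "\<And>r x y. \<lbrakk>r \<in> carrier R; x \<in> carrier M; y \<in> carrier N\<rbrakk> \<Longrightarrow>
      l (pair_gen R M N x (r \<odot>\<^bsub>N\<^esub> y)) \<ominus>\<^bsub>Z\<^esub> r \<odot>\<^bsub>Z\<^esub> l (pair_gen R M N x y) \<in> B"
    and k: "k \<in> tensor_kernel R M N"
  shows "l k \<in> B"
proof -
  interpret l: linear_map R F Z l by fact
  have "tensor_relations R M N \<subseteq> {f \<in> carrier F. l f \<in> B}"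
    using relations_carrier assms(3-6)
    unfolding tensor_relations_def Let_def
    by (auto simp: l.diff l.add l.smult pair_gen_carrier F.act_closed M.act_closed N.act_closed)
  then show ?thesis
    using span_least[OF l.vimage_submodule[OF B]] k by (auto simp: tensor_kernel_def)
qed

end

text \<open>Here \<open>b\<close> is an arbitrary function: it extends to the free module on the pairs, though not to the
  tensor product.\<close>

locale free_map = module_pair R M N + Z: left_module R Z
  for R :: "('r, 'k) ring_scheme" (structure)
    and M :: "('r, 'b, 'm) module_scheme" and N :: "('r, 'd, 'n) module_scheme"
    and Z :: "('r, 'z, 'l) module_scheme" +
  fixes b
  assumes b_closed: "x \<in> carrier M \<Longrightarrow> y \<in> carrier N \<Longrightarrow> b x y \<in> carrier Z"
begin

lemma free_lift_eq_copower_lift: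
  "free_lift R M N Z b = copower_lift (regular_module R) Z (carrier M \<times> carrier N)
     (\<lambda>q r. r \<odot>\<^bsub>Z\<^esub> b (fst q) (snd q))"
  by (simp add: fun_eq_iff free_lift_def copower_lift_def)

lemma summand_linear:
  assumes "q \<in> carrier M \<times> carrier N"
  shows "linear_map R (regular_module R) Z (\<lambda>r. r \<odot>\<^bsub>Z\<^esub> b (fst q) (snd q))"
  by (intro linear_map.intro linear_map_axioms.intro linear_mapsI R.regular_left_module Z.left_module_axioms)
    (use assms in \<open>auto simp: b_closed Z.act_closed Z.act_l_distr Z.act_assoc\<close>)

lemma free_lift_linear_map: "linear_map R F Z (free_lift R M N Z b)"
  unfolding free_lift_eq_copower_lift free_on_pairs_def
  by (rule copower_lift_linear_map[OF R.is_cring R.regular_left_module Z.left_module_axioms summand_linear])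

sublocale lift: linear_map R F Z "free_lift R M N Z b" by (rule free_lift_linear_map)

lemma free_lift_pair_gen:
  assumes "x \<in> carrier M" "y \<in> carrier N"
  shows "free_lift R M N Z b (pair_gen R M N x y) = b x y"
proof -
  have xy: "(x, y) \<in> carrier M \<times> carrier N" using assms by simp
  have e: "pair_gen R M N x y =
      (\<lambda>q\<in>carrier M \<times> carrier N. if q = (x, y) then \<one>\<^bsub>R\<^esub> else \<zero>\<^bsub>regular_module R\<^esub>)"
    by (simp only: pair_gen_def regular_simps)
  show ?thesis
    unfolding free_lift_eq_copower_lift e
    using copower_lift_single[OF R.regular_left_module Z.left_module_axioms summand_linear xy, where m = "\<one>\<^bsub>R\<^esub>"]
      assms by (simp add: Z.act_one b_closed)
qed

lemma free_lift_compose: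
  assumes "linear_map R Z Z' l" "f \<in> carrier F"
  shows "l (free_lift R M N Z b f) = free_lift R M N Z' (\<lambda>x y. l (b x y)) f"
proof -
  interpret l: linear_map R Z Z' l by fact
  have f: "f \<in> carrier (copower_module (carrier M \<times> carrier N) (regular_module R))"
    using assms(2) by (simp add: free_on_pairs_def)
  have "l (free_lift R M N Z b f) = copower_lift (regular_module R) Z' (carrier M \<times> carrier N)
      (\<lambda>q r. l (r \<odot>\<^bsub>Z\<^esub> b (fst q) (snd q))) f"
    unfolding free_lift_eq_copower_lift
    by (rule copower_lift_compose[OF R.regular_left_module Z.left_module_axioms summand_linear assms(1) f])
  also have "\<dots> = free_lift R M N Z' (\<lambda>x y. l (b x y)) f"
    unfolding free_lift_def copower_lift_def using assms(2) unfolding free_carrier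
    by (intro l.Y.X.finsum_cong')
      (auto simp: l.smult b_closed PiE_iff intro!: l.Y.act_closed l.closed)
  finally show ?thesis .
qed

end

lemma free_lift_cong:
  assumes "left_module R Z" "f \<in> carrier M \<times> carrier N \<rightarrow>\<^sub>E carrier R"
    "\<And>x y. x \<in> carrier M \<Longrightarrow> y \<in> carrier N \<Longrightarrow> b x y = b' x y"
    "\<And>x y. x \<in> carrier M \<Longrightarrow> y \<in> carrier N \<Longrightarrow> b' x y \<in> carrier Z"
  shows "free_lift R M N Z b f = free_lift R M N Z b' f"
proof -
  interpret Z: left_module R Z by fact
  show ?thesis unfolding free_lift_def using assms(2-)
    by (intro Z.X.finsum_cong') (auto intro!: Z.act_closed)
qed

locale bilinear_map = free_map R M N Z b
  for R :: "('r, 'k) ring_scheme" (structure)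
    and M :: "('r, 'b, 'm) module_scheme" and N :: "('r, 'd, 'n) module_scheme"
    and Z :: "('r, 'z, 'l) module_scheme" and b +
  assumes b_add_left: "\<lbrakk>x \<in> carrier M; x' \<in> carrier M; y \<in> carrier N\<rbrakk> \<Longrightarrow>
      b (x \<oplus>\<^bsub>M\<^esub> x') y = b x y \<oplus>\<^bsub>Z\<^esub> b x' y"
    and b_add_right: "\<lbrakk>x \<in> carrier M; y \<in> carrier N; y' \<in> carrier N\<rbrakk> \<Longrightarrow>
      b x (y \<oplus>\<^bsub>N\<^esub> y') = b x y \<oplus>\<^bsub>Z\<^esub> b x y'"
    and b_smult_left: "\<lbrakk>r \<in> carrier R; x \<in> carrier M; y \<in> carrier N\<rbrakk> \<Longrightarrow>
      b (r \<odot>\<^bsub>M\<^esub> x) y = r \<odot>\<^bsub>Z\<^esub> b x y"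
    and b_smult_right: "\<lbrakk>r \<in> carrier R; x \<in> carrier M; y \<in> carrier N\<rbrakk> \<Longrightarrow>
      b x (r \<odot>\<^bsub>N\<^esub> y) = r \<odot>\<^bsub>Z\<^esub> b x y"
begin

lemma free_lift_kernel:
  assumes "k \<in> tensor_kernel R M N"
  shows "free_lift R M N Z b k = \<zero>\<^bsub>Z\<^esub>"
proof -
  have "free_lift R M N Z b k \<in> {\<zero>\<^bsub>Z\<^esub>}"
    by (rule tensor_kernel_mapsto[OF free_lift_linear_map Z.zero_submodule _ _ _ _ assms])
      (simp_all add: free_lift_pair_gen b_add_left b_add_right b_smult_left b_smult_right
        b_closed M.act_closed N.act_closed Z.act_closed Z.diff_zero_iff)
  then show ?thesis by simp
qed

text \<open>Elements of a coset differ by the kernel, on which the lift vanishes; hence \<open>tensor_lift\<close> may be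
  evaluated on any representative.\<close>

lemma tensor_lift_coset:
  assumes f: "f \<in> carrier F"
  shows "tensor_lift R M N Z b (tensor_kernel R M N +>\<^bsub>F\<^esub> f) = free_lift R M N Z b f"
proof -
  have "free_lift R M N Z b (k \<oplus>\<^bsub>F\<^esub> f) = free_lift R M N Z b f" if "k \<in> tensor_kernel R M N" for k
    using that f submodule_subset[OF kernel_submodule that] lift.closed[OF f]
    by (simp add: lift.add free_lift_kernel)
  then have "free_lift R M N Z b ` (tensor_kernel R M N +>\<^bsub>F\<^esub> f) =
      (\<Union>k\<in>tensor_kernel R M N. {free_lift R M N Z b f})"
    unfolding a_r_coset_def' image_UN by (intro SUP_cong refl) simp
  also have "\<dots> = {free_lift R M N Z b f}"
    using submodule_zero[OF kernel_submodule] by auto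
  finally have "free_lift R M N Z b ` (tensor_kernel R M N +>\<^bsub>F\<^esub> f) = {free_lift R M N Z b f}" .
  then show ?thesis by (simp add: tensor_lift_def)
qed

end

section \<open>The pairing: Sweedler sums and local projectivity\<close>

text \<open>What the proof uses of a measuring \<open>\<alpha>\<close>-pairing, free of tensor products: the \<open>\<alpha>\<close>-condition
  survives as local projectivity of \<open>C\<close> relative to \<open>A\<close>, and the comultiplication as the fact that
  \<open>a \<mapsto> \<langle>a b, c\<rangle>\<close> and \<open>b \<mapsto> \<langle>a b, c\<rangle>\<close> vanish on the annihilator of a finite set that
  depends on \<open>c\<close> alone.\<close>

locale locally_projective_pairing = R?: cring R + A: ring A + AR: left_module R A + C: left_module R C
  for R :: "('r, 'k) ring_scheme" (structure) and A :: "('r, 'a, 'm) module_scheme" (structure)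
    and C :: "('r, 'c, 'n) coalg_scheme" (structure) +
  fixes p :: "'a \<Rightarrow> 'c \<Rightarrow> 'r"
  assumes smult_mult_left: "\<lbrakk>r \<in> carrier R; a \<in> carrier A; b \<in> carrier A\<rbrakk> \<Longrightarrow>
      (r \<odot>\<^bsub>A\<^esub> a) \<otimes>\<^bsub>A\<^esub> b = r \<odot>\<^bsub>A\<^esub> (a \<otimes>\<^bsub>A\<^esub> b)"
    and smult_mult_right: "\<lbrakk>r \<in> carrier R; a \<in> carrier A; b \<in> carrier A\<rbrakk> \<Longrightarrow>
      a \<otimes>\<^bsub>A\<^esub> (r \<odot>\<^bsub>A\<^esub> b) = r \<odot>\<^bsub>A\<^esub> (a \<otimes>\<^bsub>A\<^esub> b)"
    and p_linear_right: "a \<in> carrier A \<Longrightarrow> p a \<in> linear_maps R C (regular_module R)"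
    and p_linear_left: "c \<in> carrier C \<Longrightarrow> (\<lambda>a. p a c) \<in> linear_maps R A (regular_module R)"
    and locally_projective: "c \<in> carrier C \<Longrightarrow>
      c \<in> submodule_span R C {p a c \<odot>\<^bsub>C\<^esub> d | a d. a \<in> carrier A \<and> d \<in> carrier C}"
    and mult_continuous_left: "c \<in> carrier C \<Longrightarrow> \<exists>T. finite T \<and> T \<subseteq> carrier C \<and>
      (\<forall>a\<in>carrier A. \<forall>b\<in>carrier A. (\<forall>t\<in>T. p a t = \<zero>) \<longrightarrow> p (a \<otimes>\<^bsub>A\<^esub> b) c = \<zero>)"
    and mult_continuous_right: "c \<in> carrier C \<Longrightarrow> \<exists>T. finite T \<and> T \<subseteq> carrier C \<and>
      (\<forall>a\<in>carrier A. \<forall>b\<in>carrier A. (\<forall>t\<in>T. p b t = \<zero>) \<longrightarrow> p (a \<otimes>\<^bsub>A\<^esub> b) c = \<zero>)"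

text \<open>The maps \<open>a \<mapsto> \<Sum> \<langle>a, c\<^sub>i\<rangle> x\<^sub>i\<close>.\<close>

definition rational_maps ::
  "('r, 'k) ring_scheme \<Rightarrow> ('r, 'a, 'm) module_scheme \<Rightarrow> ('r, 'c, 'n) module_scheme \<Rightarrow>
   ('a \<Rightarrow> 'c \<Rightarrow> 'r) \<Rightarrow> ('r, 'x, 'l) module_scheme \<Rightarrow> ('a \<Rightarrow> 'x) set" where
  "rational_maps R A C p X = submodule_span R (Hom_module R A X)
     {\<lambda>a\<in>carrier A. p a c \<odot>\<^bsub>X\<^esub> x | x c. x \<in> carrier X \<and> c \<in> carrier C}"

context measuring_pairing
begin

lemma cring_R: "cring R" by unfold_locales
lemma ring_A: "ring A" by unfold_locales
lemma left_module_A: "left_module R A"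
proof -
  have "module R A" by unfold_locales
  then show ?thesis by (simp add: module_iff_left_module)
qed
lemma left_module_C: "left_module R C"
proof -
  have "module R C" by unfold_locales
  then show ?thesis by (simp add: module_iff_left_module)
qed

lemma p_closed: "a \<in> carrier A \<Longrightarrow> c \<in> carrier C \<Longrightarrow> p a c \<in> carrier R"
  using linear_closed[OF pairing_linear_right] by simp
lemma p_add_right: "a \<in> carrier A \<Longrightarrow> c \<in> carrier C \<Longrightarrow> d \<in> carrier C \<Longrightarrow>
    p a (c \<oplus>\<^bsub>C\<^esub> d) = p a c \<oplus> p a d"
  using linear_add[OF pairing_linear_right] by simp
lemma p_smult_right: "a \<in> carrier A \<Longrightarrow> c \<in> carrier C \<Longrightarrow> r \<in> carrier R \<Longrightarrow>
    p a (r \<odot>\<^bsub>C\<^esub> c) = r \<otimes> p a c"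
  using linear_smult[OF pairing_linear_right] by simp
lemma p_add_left: "a \<in> carrier A \<Longrightarrow> b \<in> carrier A \<Longrightarrow> c \<in> carrier C \<Longrightarrow>
    p (a \<oplus>\<^bsub>A\<^esub> b) c = p a c \<oplus> p b c"
  using linear_add[OF pairing_linear_left] by simp
lemma p_smult_left: "a \<in> carrier A \<Longrightarrow> c \<in> carrier C \<Longrightarrow> r \<in> carrier R \<Longrightarrow>
    p (r \<odot>\<^bsub>A\<^esub> a) c = r \<otimes> p a c"
  using linear_smult[OF pairing_linear_left] by simp

lemma alpha_bilinear:
  assumes "left_module R X"
  shows "bilinear_map R X C (Hom_module R A X) (\<lambda>x c. \<lambda>a\<in>carrier A. p a c \<odot>\<^bsub>X\<^esub> x)"
proof -
  interpret R: cring R by (rule cring_R)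
  interpret A: left_module R A by (rule left_module_A)
  interpret C: left_module R C by (rule left_module_C)
  interpret X: left_module R X by fact
  have com: "r \<odot>\<^bsub>X\<^esub> (s \<odot>\<^bsub>X\<^esub> x) = s \<odot>\<^bsub>X\<^esub> (r \<odot>\<^bsub>X\<^esub> x)"
    if "r \<in> carrier R" "s \<in> carrier R" "x \<in> carrier X" for r s x
    using that X.act_assoc[of r s x] X.act_assoc[of s r x] R.m_comm[of r s] by simp
  show ?thesis
    by (intro bilinear_map.intro bilinear_map_axioms.intro free_map.intro free_map_axioms.intro
        module_pair.intro Hom_left_module cring_R left_module_A left_module_C assms)
      (auto simp: restrict_def extensional_def fun_eq_iff p_closed p_add_left p_add_right p_smult_left p_smult_right
        X.act_closed X.act_l_distr X.act_r_distr X.act_assoc X.X.a_ac com A.act_closed C.act_closed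
        intro!: linear_mapsI)
qed

text \<open>Every element of the tensor product is a finite sum of pure tensors, so the image is spanned by
  their images.\<close>

lemma alpha_map_range:
  assumes "left_module R X"
  shows "alpha_map R A C p X ` carrier (tensor R X C) = rational_maps R A C p X"
proof -
  let ?b = "\<lambda>x c. \<lambda>a\<in>carrier A. p a c \<odot>\<^bsub>X\<^esub> x" and ?H = "Hom_module R A X"
  let ?G = "{\<lambda>a\<in>carrier A. p a c \<odot>\<^bsub>X\<^esub> x | x c. x \<in> carrier X \<and> c \<in> carrier C}"
  interpret b: bilinear_map R X C ?H ?b by (rule alpha_bilinear[OF assms])
  let ?l = "free_lift R X C ?H ?b"
  have "alpha_map R A C p X ` carrier (tensor R X C) = ?l ` carrier b.F"
    unfolding alpha_map_def b.tensor_carrier image_image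
    by (intro image_cong refl b.tensor_lift_coset)
  also have "\<dots> = submodule_span R ?H ?G"
  proof
    have G: "?G \<subseteq> carrier ?H" using b.b_closed by auto
    have sp: "submodule (submodule_span R ?H ?G) R ?H" by (rule b.Z.span_submodule[OF G])
    show "?l ` carrier b.F \<subseteq> submodule_span R ?H ?G"
    proof
      fix u assume "u \<in> ?l ` carrier b.F"
      then obtain f where f: "u = ?l f" "f \<in> carrier b.F" by blast
      have fc: "f q \<in> carrier R" if "q \<in> carrier X \<times> carrier C" for q
        using f(2) PiE_mem[OF _ that] unfolding b.free_carrier by blast
      have "?b (fst q) (snd q) \<in> submodule_span R ?H ?G" if "q \<in> carrier X \<times> carrier C" for q
      proof (rule subsetD[OF span_superset[of ?G R ?H]])
        have "fst q \<in> carrier X" "snd q \<in> carrier C" using that by auto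
        then show "?b (fst q) (snd q) \<in> ?G" by blast
      qed
      then have mem: "f q \<odot>\<^bsub>?H\<^esub> ?b (fst q) (snd q) \<in> submodule_span R ?H ?G"
        if "q \<in> carrier X \<times> carrier C" for q
        using submodule.smult_closed[OF sp fc] that by blast
      show "u \<in> submodule_span R ?H ?G"
        unfolding f(1) free_lift_def
      proof (rule b.Z.finsum_in_submodule[OF sp])
        show "finite {q \<in> carrier X \<times> carrier C. f q \<noteq> \<zero>}"
          using f(2) unfolding b.free_carrier by blast
      qed (rule mem, simp)
    qed
    have "?b x c \<in> ?l ` carrier b.F" if "x \<in> carrier X" "c \<in> carrier C" for x c
    proof -
      have "?l (pair_gen R X C x c) \<in> ?l ` carrier b.F" by (rule imageI[OF b.pair_gen_carrier[OF that]])
      then show ?thesis by (simp only: b.free_lift_pair_gen[OF that])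
    qed
    then have "?G \<subseteq> ?l ` carrier b.F" by blast
    then show "submodule_span R ?H ?G \<subseteq> ?l ` carrier b.F"
      by (rule span_least[OF b.lift.image_submodule[OF b.F.carrier_submodule]])
  qed
  finally show ?thesis by (simp add: rational_maps_def)
qed

text \<open>A representative \<open>\<Sum> c\<^sub>1 \<otimes> c\<^sub>2\<close> of the comultiplication in the free module on the pairs. One fixed
  choice serves all bilinear maps, which is what makes the finite sets of factors independent of \<open>a\<close>.\<close>

definition sweedler :: "'c \<Rightarrow> ('c \<times> 'c \<Rightarrow> 'r)" where
  "sweedler c = (SOME f. f \<in> carrier (free_on_pairs R C C) \<and>
     comult C c = tensor_kernel R C C +>\<^bsub>free_on_pairs R C C\<^esub> f)"

lemma module_pair_CC: "module_pair R C C"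
  by (intro module_pair.intro cring_R left_module_C)

lemma sweedler:
  assumes "c \<in> carrier C"
  shows "sweedler c \<in> carrier (free_on_pairs R C C)"
    "comult C c = tensor_kernel R C C +>\<^bsub>free_on_pairs R C C\<^esub> sweedler c"
proof -
  interpret CC: module_pair R C C by (rule module_pair_CC)
  have "comult C c \<in> carrier (tensor R C C)" using linear_closed[OF comult_linear assms] .
  then have "\<exists>f. f \<in> carrier CC.F \<and> comult C c = tensor_kernel R C C +>\<^bsub>CC.F\<^esub> f"
    unfolding CC.tensor_carrier by auto
  from someI_ex[OF this]
  show "sweedler c \<in> carrier (free_on_pairs R C C)"
    "comult C c = tensor_kernel R C C +>\<^bsub>free_on_pairs R C C\<^esub> sweedler c"
    by (simp_all add: sweedler_def)
qed

lemma sweedler_support: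
  assumes "c \<in> carrier C"
  shows "finite {q \<in> carrier C \<times> carrier C. sweedler c q \<noteq> \<zero>}"
    "sweedler c \<in> carrier C \<times> carrier C \<rightarrow>\<^sub>E carrier R"
  using sweedler(1)[OF assms] unfolding module_pair.free_carrier[OF module_pair_CC] by auto

text \<open>That \<open>\<kappa>\<close> is multiplicative reads \<open>\<langle>a b, c\<rangle> = \<Sum> \<langle>a, c\<^sub>1\<rangle> \<langle>b, c\<^sub>2\<rangle>\<close>.\<close>

lemma pairing_mult:
  assumes ab: "a \<in> carrier A" "b \<in> carrier A" and c: "c \<in> carrier C"
  shows "p (a \<otimes>\<^bsub>A\<^esub> b) c = free_lift R C C (regular_module R) (\<lambda>x y. p a x \<otimes> p b y) (sweedler c)"
proof -
  interpret R: cring R by (rule cring_R)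
  have "kappa C p (a \<otimes>\<^bsub>A\<^esub> b) c =
      (kappa C p a \<otimes>\<^bsub>convolution_algebra R C\<^esub> kappa C p b) c"
    using ring_hom_mult[OF kappa_ring_hom ab] by simp
  then have "p (a \<otimes>\<^bsub>A\<^esub> b) c = tensor_lift R C C (regular_module R)
      (\<lambda>x y. kappa C p a x \<otimes> kappa C p b y) (comult C c)"
    using c by (simp add: kappa_def convolution_algebra_def)
  also have "\<dots> = free_lift R C C (regular_module R)
      (\<lambda>x y. kappa C p a x \<otimes> kappa C p b y) (sweedler c)"
  proof -
    interpret k: bilinear_map R C C "regular_module R" "\<lambda>x y. kappa C p a x \<otimes> kappa C p b y"
      using ab left_module.act_closed[OF left_module_C] left_module_C
      by (intro bilinear_map.intro bilinear_map_axioms.intro free_map.intro free_map_axioms.intro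
          module_pair.intro R.regular_left_module cring_R left_module_C)
        (auto simp: kappa_def p_closed p_add_right p_smult_right R.l_distr R.r_distr R.m_ac)
    show ?thesis unfolding sweedler(2)[OF c] by (rule k.tensor_lift_coset[OF sweedler(1)[OF c]])
  qed
  also have "\<dots> = free_lift R C C (regular_module R) (\<lambda>x y. p a x \<otimes> p b y) (sweedler c)"
    using ab by (intro free_lift_cong R.regular_left_module sweedler_support c) (auto simp: kappa_def p_closed)
  finally show ?thesis .
qed

lemma pairing_linear_map: "a \<in> carrier A \<Longrightarrow> linear_map R C (regular_module R) (p a)"
  by (intro linear_map.intro linear_map_axioms.intro left_module_C pairing_linear_right
      ring.regular_left_module cring.axioms(1) cring_R)

lemma tensor_lift_comult:
  assumes b: "bilinear_map R C C C b" and c: "c \<in> carrier C"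
  shows "tensor_lift R C C C b (comult C c) \<in> carrier C"
    and "d \<in> carrier A \<Longrightarrow> p d (tensor_lift R C C C b (comult C c)) =
      free_lift R C C (regular_module R) (\<lambda>x y. p d (b x y)) (sweedler c)"
proof -
  interpret b: bilinear_map R C C C b by (rule b)
  have e: "tensor_lift R C C C b (comult C c) = free_lift R C C C b (sweedler c)"
    unfolding sweedler(2)[OF c] by (rule b.tensor_lift_coset[OF sweedler(1)[OF c]])
  show "tensor_lift R C C C b (comult C c) \<in> carrier C"
    unfolding e by (rule b.lift.closed[OF sweedler(1)[OF c]])
  show "p d (tensor_lift R C C C b (comult C c)) =
      free_lift R C C (regular_module R) (\<lambda>x y. p d (b x y)) (sweedler c)" if "d \<in> carrier A"
    unfolding e by (rule b.free_lift_compose[OF pairing_linear_map[OF that] sweedler(1)[OF c]])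
qed

text \<open>The two actions are the transposes of right and left multiplication. Since \<open>A\<close> separates the
  elements of \<open>C\<close>, every identity for the actions can be read off from the multiplication of \<open>A\<close>.\<close>

lemma left_action:
  assumes a: "a \<in> carrier A" and c: "c \<in> carrier C"
  shows "left_action R C p a c \<in> carrier C"
    and "d \<in> carrier A \<Longrightarrow> p d (left_action R C p a c) = p (d \<otimes>\<^bsub>A\<^esub> a) c"
proof -
  interpret R: cring R by (rule cring_R)
  interpret C: left_module R C by (rule left_module_C)
  have b: "bilinear_map R C C C (\<lambda>x y. p a y \<odot>\<^bsub>C\<^esub> x)"
    using a
    by (intro bilinear_map.intro bilinear_map_axioms.intro free_map.intro free_map_axioms.intro
        module_pair.intro cring_R left_module_C)
      (auto simp: p_closed p_add_right p_smult_right C.act_closed C.act_l_distr C.act_r_distr R.m_ac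
        simp flip: C.act_assoc)
  show "left_action R C p a c \<in> carrier C" unfolding left_action_def by (rule tensor_lift_comult(1)[OF b c])
  show "p d (left_action R C p a c) = p (d \<otimes>\<^bsub>A\<^esub> a) c" if d: "d \<in> carrier A"
    unfolding left_action_def tensor_lift_comult(2)[OF b c d] pairing_mult[OF d a c] using a d
    by (intro free_lift_cong R.regular_left_module sweedler_support c) (auto simp: p_closed p_smult_right R.m_comm)
qed

lemma right_action:
  assumes a: "a \<in> carrier A" and c: "c \<in> carrier C"
  shows "right_action R C p c a \<in> carrier C"
    and "d \<in> carrier A \<Longrightarrow> p d (right_action R C p c a) = p (a \<otimes>\<^bsub>A\<^esub> d) c"
proof -
  interpret R: cring R by (rule cring_R)
  interpret C: left_module R C by (rule left_module_C)
  have b: "bilinear_map R C C C (\<lambda>x y. p a x \<odot>\<^bsub>C\<^esub> y)"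
    using a
    by (intro bilinear_map.intro bilinear_map_axioms.intro free_map.intro free_map_axioms.intro
        module_pair.intro cring_R left_module_C)
      (auto simp: p_closed p_add_right p_smult_right C.act_closed C.act_l_distr C.act_r_distr R.m_ac
        simp flip: C.act_assoc)
  show "right_action R C p c a \<in> carrier C" unfolding right_action_def by (rule tensor_lift_comult(1)[OF b c])
  show "p d (right_action R C p c a) = p (a \<otimes>\<^bsub>A\<^esub> d) c" if d: "d \<in> carrier A"
    unfolding right_action_def tensor_lift_comult(2)[OF b c d] pairing_mult[OF a d c] using a d
    by (intro free_lift_cong R.regular_left_module sweedler_support c) (auto simp: p_closed p_smult_right)
qed

lemma pairing_mult_zero:
  assumes "a \<in> carrier A" "b \<in> carrier A" "c \<in> carrier C"
    and "\<And>q. q \<in> carrier C \<times> carrier C \<Longrightarrow> sweedler c q \<noteq> \<zero> \<Longrightarrow> p a (fst q) = \<zero> \<or> p b (snd q) = \<zero>"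
  shows "p (a \<otimes>\<^bsub>A\<^esub> b) c = \<zero>"
proof -
  interpret R: cring R by (rule cring_R)
  interpret M: left_module R "regular_module R" by (rule R.regular_left_module)
  have "sweedler c q \<odot>\<^bsub>regular_module R\<^esub> (p a (fst q) \<otimes> p b (snd q)) \<in> {\<zero>\<^bsub>regular_module R\<^esub>}"
    if q: "q \<in> {q \<in> carrier C \<times> carrier C. sweedler c q \<noteq> \<zero>}" for q
  proof -
    have "sweedler c q \<in> carrier R" using sweedler_support(2)[OF assms(3)] q by auto
    moreover have "p a (fst q) \<otimes> p b (snd q) = \<zero>"
      using assms(4)[of q] q p_closed[of a "fst q"] p_closed[of b "snd q"] assms(1,2) by auto
    ultimately show ?thesis by simp
  qed
  then have "free_lift R C C (regular_module R) (\<lambda>x y. p a x \<otimes> p b y) (sweedler c) \<in> {\<zero>\<^bsub>regular_module R\<^esub>}"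
    unfolding free_lift_def
    by (intro M.finsum_in_submodule[OF M.zero_submodule] sweedler_support assms) auto
  then show ?thesis by (simp add: pairing_mult assms)
qed

end

context measuring_alpha_pairing
begin

text \<open>Let \<open>J\<close> be the ideal of all \<open>\<langle>a, m\<rangle>\<close>. In \<open>R/J \<otimes> C\<close> the tensor \<open>1 \<otimes> m\<close> is sent to
  the map \<open>a \<mapsto> \<langle>a, m\<rangle> 1 = 0\<close>, so it vanishes by the \<open>\<alpha>\<close>-condition; as \<open>R/J \<otimes> C = C/JC\<close>, this means
  \<open>m \<in> JC\<close>. Instead of forming \<open>C/JC\<close>, the proof sends \<open>(x, c)\<close> to \<open>s x \<cdot> c\<close> for a choice \<open>s\<close> of
  representatives and computes modulo \<open>JC\<close>.\<close>

lemma alpha_locally_projective: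
  assumes m: "m \<in> carrier C"
  shows "m \<in> submodule_span R C {p a m \<odot>\<^bsub>C\<^esub> d | a d. a \<in> carrier A \<and> d \<in> carrier C}" (is "m \<in> ?IC")
proof -
  interpret R: cring R by (rule cring_R)
  interpret A: left_module R A by (rule left_module_A)
  interpret C: left_module R C by (rule left_module_C)
  \<comment> \<open>\<open>R\<close> as a power with one factor, so that its quotient \<open>X\<close> is carried by sets of functions on \<open>nat\<close>\<close>
  define P where "P = power_module {0::nat} (regular_module R)"
  interpret P: left_module R P
    unfolding P_def by (rule left_module.power_left_module[OF R.regular_left_module])
  let ?k = "\<lambda>r. \<lambda>i\<in>{0::nat}. r"
  interpret k: linear_map R "regular_module R" P ?k
    by (intro linear_map.intro linear_map_axioms.intro R.regular_left_module P.left_module_axioms linear_mapsI)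
      (auto simp: P_def restrict_def extensional_def split: if_splits)
  interpret pm: linear_map R A "regular_module R" "\<lambda>a. p a m"
    by (intro linear_map.intro linear_map_axioms.intro R.regular_left_module left_module_A pairing_linear_left m)
  define J where "J = (\<lambda>a. p a m) ` carrier A"
  have J: "submodule J R (regular_module R)"
    unfolding J_def by (rule pm.image_submodule[OF A.carrier_submodule])
  define N where "N = ?k ` J"
  have N: "submodule N R P" unfolding N_def by (rule k.image_submodule[OF J])
  have k_in_N: "r \<in> J" if "?k r \<in> N" for r
    using that unfolding N_def by (auto dest!: fun_cong[of _ _ 0])
  have Pk: "f = ?k (f 0)" "f 0 \<in> carrier R" if "f \<in> carrier P" for f
    using that by (auto simp: P_def PiE_def extensional_def fun_eq_iff)
  define X where "X = quotient_module P N"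
  interpret X: left_module R X unfolding X_def by (rule P.quotient_left_module[OF N])
  have modX: "module R X" using module_iff_left_module cring_R X.left_module_axioms by blast
  define coset where "coset r = N +>\<^bsub>P\<^esub> ?k r" for r
  have coset_lin: "linear_map R (regular_module R) X coset"
    unfolding X_def coset_def
    by (intro linear_map.intro linear_map_axioms.intro R.regular_left_module P.quotient_left_module N
        linear_map_comp[OF k.linear P.quotient_proj_linear])
  interpret coset: linear_map R "regular_module R" X coset by (rule coset_lin)
  have coset_eq: "coset r = coset s \<longleftrightarrow> r \<ominus> s \<in> J" if "r \<in> carrier R" "s \<in> carrier R" for r s
  proof -
    have "coset r = coset s \<longleftrightarrow> ?k r \<ominus>\<^bsub>P\<^esub> ?k s \<in> N"
      unfolding coset_def using that k.closed by (intro P.coset_eq_iff N) auto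
    also have "?k r \<ominus>\<^bsub>P\<^esub> ?k s = ?k (r \<ominus>\<^bsub>regular_module R\<^esub> s)" using k.diff that by simp
    also have "r \<ominus>\<^bsub>regular_module R\<^esub> s = r \<ominus> s"
      using left_module.minus_eq_act[OF R.regular_left_module, of s] that by (simp add: a_minus_def R.l_minus)
    finally show ?thesis using k_in_N imageI[of _ J ?k] unfolding N_def by blast
  qed
  have X_coset: "carrier X = coset ` carrier R"
  proof -
    have "carrier P = ?k ` carrier R"
    proof
      show "carrier P \<subseteq> ?k ` carrier R" using Pk by blast
      show "?k ` carrier R \<subseteq> carrier P" using k.closed by auto
    qed
    then show ?thesis unfolding X_def P.quotient_carrier coset_def by (simp add: image_image)
  qed
  define s where "s x = (SOME r. r \<in> carrier R \<and> coset r = x)" for x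
  have s: "s x \<in> carrier R" "coset (s x) = x" if "x \<in> carrier X" for x
  proof -
    have "\<exists>r. r \<in> carrier R \<and> coset r = x" using that X_coset by auto
    from someI_ex[OF this] show "s x \<in> carrier R" "coset (s x) = x" by (simp_all add: s_def)
  qed
  interpret b: bilinear_map R X C "Hom_module R A X" "\<lambda>x c. \<lambda>a\<in>carrier A. p a c \<odot>\<^bsub>X\<^esub> x"
    by (rule alpha_bilinear[OF X.left_module_axioms])
  let ?K = "tensor_kernel R X C" and ?g = "pair_gen R X C (coset \<one>) m"
  have u: "coset \<one> \<in> carrier X" using coset.closed by simp
  have g: "?g \<in> carrier b.F" by (rule b.pair_gen_carrier[OF u m])
  have "p a m \<odot>\<^bsub>X\<^esub> coset \<one> = \<zero>\<^bsub>X\<^esub>" if a: "a \<in> carrier A" for a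
  proof -
    have "p a m \<odot>\<^bsub>X\<^esub> coset \<one> = coset (p a m)"
      using coset.smult[of "p a m" "\<one>"] p_closed[OF a m] by simp
    also have "\<dots> = coset \<zero>"
      using coset_eq[of "p a m" "\<zero>"] p_closed[OF a m] a by (auto simp: J_def R.minus_eq)
    finally show ?thesis using coset.zero by simp
  qed
  then have "free_lift R X C (Hom_module R A X) (\<lambda>x c. \<lambda>a\<in>carrier A. p a c \<odot>\<^bsub>X\<^esub> x) ?g =
      \<zero>\<^bsub>Hom_module R A X\<^esub>"
    using b.free_lift_pair_gen[OF u m] by (auto simp: fun_eq_iff restrict_def)
  then have "alpha_map R A C p X (?K +>\<^bsub>b.F\<^esub> ?g) = alpha_map R A C p X (?K +>\<^bsub>b.F\<^esub> \<zero>\<^bsub>b.F\<^esub>)"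
    unfolding alpha_map_def using b.tensor_lift_coset[OF g] b.tensor_lift_coset[OF b.F.X.zero_closed] b.lift.zero
    by simp
  then have "?K +>\<^bsub>b.F\<^esub> ?g = ?K +>\<^bsub>b.F\<^esub> \<zero>\<^bsub>b.F\<^esub>"
    using inj_onD[OF alpha_condition[OF modX]] g unfolding b.tensor_carrier by blast
  then have gK: "?g \<in> ?K"
    using b.F.coset_eq_iff[OF b.kernel_submodule g b.F.X.zero_closed] g
    by (metis b.F.X.r_zero b.F.X.zero_closed b.F.coset_eq_self_iff b.F.submodule_cancel b.kernel_submodule submodule_zero)
  have G: "{p a m \<odot>\<^bsub>C\<^esub> d | a d. a \<in> carrier A \<and> d \<in> carrier C} \<subseteq> carrier C"
    using p_closed m C.act_closed by auto
  have IC: "submodule ?IC R C" by (rule C.span_submodule[OF G])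
  have JIC: "r \<odot>\<^bsub>C\<^esub> d \<in> ?IC" if "r \<in> J" "d \<in> carrier C" for r d
    by (rule subsetD[OF span_superset]) (use that in \<open>auto simp: J_def\<close>)
  \<comment> \<open>\<open>s\<close> is additive and homogeneous modulo \<open>J\<close>, so this map is bilinear modulo \<open>?IC\<close>\<close>
  interpret l: free_map R X C C "\<lambda>x c. s x \<odot>\<^bsub>C\<^esub> c"
    using s by (intro free_map.intro free_map_axioms.intro b.module_pair_axioms left_module_C C.act_closed)
  have mod: "r \<odot>\<^bsub>C\<^esub> c \<ominus>\<^bsub>C\<^esub> r' \<odot>\<^bsub>C\<^esub> c \<in> ?IC"
    if "coset r = coset r'" "r \<in> carrier R" "r' \<in> carrier R" "c \<in> carrier C" for r r' c
    using that coset_eq[of r r'] JIC[of "r \<ominus> r'" c] C.act_l_diff[of r r' c] by simp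
  let ?l = "free_lift R X C C (\<lambda>x c. s x \<odot>\<^bsub>C\<^esub> c)" and ?pg = "pair_gen R X C"
  have "?l ?g \<in> ?IC"
  proof (rule b.tensor_kernel_mapsto[OF l.free_lift_linear_map IC _ _ _ _ gK])
    fix x x' y assume a: "x \<in> carrier X" "x' \<in> carrier X" "y \<in> carrier C"
    have "coset (s (x \<oplus>\<^bsub>X\<^esub> x')) = coset (s x \<oplus> s x')"
      using coset.add[of "s x" "s x'"] s a by simp
    then show "?l (?pg (x \<oplus>\<^bsub>X\<^esub> x') y) \<ominus>\<^bsub>C\<^esub>
       (?l (?pg x y) \<oplus>\<^bsub>C\<^esub>
        ?l (?pg x' y)) \<in> ?IC"
      using mod[of "s (x \<oplus>\<^bsub>X\<^esub> x')" "s x \<oplus> s x'" y] s(1)[of "x \<oplus>\<^bsub>X\<^esub> x'"] s(1)[of x] s(1)[of x'] a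
      by (simp add: l.free_lift_pair_gen C.act_l_distr)
  next
    fix x y y' assume a: "x \<in> carrier X" "y \<in> carrier C" "y' \<in> carrier C"
    then show "?l (?pg x (y \<oplus>\<^bsub>C\<^esub> y')) \<ominus>\<^bsub>C\<^esub>
       (?l (?pg x y) \<oplus>\<^bsub>C\<^esub>
        ?l (?pg x y')) \<in> ?IC"
      using C.diff_zero_iff[THEN iffD2, OF _ _ refl] s submodule_zero[OF IC]
      by (simp add: l.free_lift_pair_gen C.act_r_distr C.act_closed)
  next
    fix r x y assume a: "r \<in> carrier R" "x \<in> carrier X" "y \<in> carrier C"
    have "coset (s (r \<odot>\<^bsub>X\<^esub> x)) = coset (r \<otimes> s x)"
      using coset.smult[of r "s x"] s a X.act_closed by simp
    then show "?l (?pg (r \<odot>\<^bsub>X\<^esub> x) y) \<ominus>\<^bsub>C\<^esub>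
       r \<odot>\<^bsub>C\<^esub> ?l (?pg x y) \<in> ?IC"
      using mod[of "s (r \<odot>\<^bsub>X\<^esub> x)" "r \<otimes> s x" y] s(1)[of "r \<odot>\<^bsub>X\<^esub> x"] s(1)[of x] a X.act_closed
      by (simp add: l.free_lift_pair_gen C.act_assoc)
    have "r \<odot>\<^bsub>C\<^esub> (s x \<odot>\<^bsub>C\<^esub> y) = s x \<odot>\<^bsub>C\<^esub> (r \<odot>\<^bsub>C\<^esub> y)"
      using a s C.act_assoc[of r "s x" y] C.act_assoc[of "s x" r y] R.m_comm[of r "s x"] by simp
    then show "?l (?pg x (r \<odot>\<^bsub>C\<^esub> y)) \<ominus>\<^bsub>C\<^esub>
       r \<odot>\<^bsub>C\<^esub> ?l (?pg x y) \<in> ?IC"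
      using C.diff_zero_iff[THEN iffD2, OF _ _ refl] s submodule_zero[OF IC] a
      by (simp add: l.free_lift_pair_gen C.act_closed)
  qed
  then have "s (coset \<one>) \<odot>\<^bsub>C\<^esub> m \<in> ?IC" by (simp add: l.free_lift_pair_gen[OF u m])
  moreover have "m \<ominus>\<^bsub>C\<^esub> s (coset \<one>) \<odot>\<^bsub>C\<^esub> m \<in> ?IC"
    using mod[of "\<one>" "s (coset \<one>)" m] s[OF u] m by (simp add: C.act_one)
  ultimately show ?thesis using C.submodule_cancel[OF IC m] by blast
qed

lemma locally_projective_pairing: "locally_projective_pairing R A C p"
proof (intro locally_projective_pairing.intro locally_projective_pairing_axioms.intro)
  fix c assume c: "c \<in> carrier C"
  let ?S = "{q \<in> carrier C \<times> carrier C. sweedler c q \<noteq> \<zero>}"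
  show "\<exists>T. finite T \<and> T \<subseteq> carrier C \<and> (\<forall>a\<in>carrier A. \<forall>b\<in>carrier A.
      (\<forall>t\<in>T. p a t = \<zero>) \<longrightarrow> p (a \<otimes>\<^bsub>A\<^esub> b) c = \<zero>)"
  proof (intro exI[of _ "fst ` ?S"] conjI ballI impI)
    show "p (a \<otimes>\<^bsub>A\<^esub> b) c = \<zero>"
      if "a \<in> carrier A" "b \<in> carrier A" "\<forall>t\<in>fst ` ?S. p a t = \<zero>" for a b
      using that by (intro pairing_mult_zero c) auto
  qed (use sweedler_support(1)[OF c] in auto)
  show "\<exists>T. finite T \<and> T \<subseteq> carrier C \<and> (\<forall>a\<in>carrier A. \<forall>b\<in>carrier A.
      (\<forall>t\<in>T. p b t = \<zero>) \<longrightarrow> p (a \<otimes>\<^bsub>A\<^esub> b) c = \<zero>)"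
  proof (intro exI[of _ "snd ` ?S"] conjI ballI impI)
    show "p (a \<otimes>\<^bsub>A\<^esub> b) c = \<zero>"
      if "a \<in> carrier A" "b \<in> carrier A" "\<forall>t\<in>snd ` ?S. p b t = \<zero>" for a b
      using that by (intro pairing_mult_zero c) auto
  qed (use sweedler_support(1)[OF c] in auto)
  show "c \<in> submodule_span R C {p a c \<odot>\<^bsub>C\<^esub> d | a d. a \<in> carrier A \<and> d \<in> carrier C}"
    by (rule alpha_locally_projective[OF c])
  show "(\<lambda>a. p a c) \<in> linear_maps R A (regular_module R)" by (rule pairing_linear_left[OF c])
qed (auto intro: cring_R ring_A left_module_A left_module_C pairing_linear_right smult_mult_left smult_mult_right)

end

section \<open>Rational maps\<close>

context locally_projective_pairing
begin

lemma p_closed: "a \<in> carrier A \<Longrightarrow> c \<in> carrier C \<Longrightarrow> p a c \<in> carrier R"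
  using linear_closed[OF p_linear_right] by simp

lemma pairing_linear_map_right: "a \<in> carrier A \<Longrightarrow> linear_map R C (regular_module R) (p a)"
  by (intro linear_map.intro linear_map_axioms.intro C.left_module_axioms p_linear_right R.regular_left_module)

lemma pairing_linear_map_left: "c \<in> carrier C \<Longrightarrow> linear_map R A (regular_module R) (\<lambda>a. p a c)"
  by (intro linear_map.intro linear_map_axioms.intro AR.left_module_axioms p_linear_left R.regular_left_module)

lemma regular_diff: "r \<in> carrier R \<Longrightarrow> s \<in> carrier R \<Longrightarrow> r \<ominus>\<^bsub>regular_module R\<^esub> s = r \<ominus> s"
  using left_module.minus_eq_act[OF R.regular_left_module, of s] by (simp add: a_minus_def R.l_minus)

lemma p_add_right: "a \<in> carrier A \<Longrightarrow> c \<in> carrier C \<Longrightarrow> d \<in> carrier C \<Longrightarrow>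
    p a (c \<oplus>\<^bsub>C\<^esub> d) = p a c \<oplus> p a d"
  and p_smult_right: "a \<in> carrier A \<Longrightarrow> c \<in> carrier C \<Longrightarrow> r \<in> carrier R \<Longrightarrow>
    p a (r \<odot>\<^bsub>C\<^esub> c) = r \<otimes> p a c"
  and p_diff_right: "a \<in> carrier A \<Longrightarrow> c \<in> carrier C \<Longrightarrow> d \<in> carrier C \<Longrightarrow>
    p a (c \<ominus>\<^bsub>C\<^esub> d) = p a c \<ominus> p a d"
  and p_zero_right: "a \<in> carrier A \<Longrightarrow> p a \<zero>\<^bsub>C\<^esub> = \<zero>"
  using linear_map.add[OF pairing_linear_map_right] linear_map.smult[OF pairing_linear_map_right]
    linear_map.diff[OF pairing_linear_map_right] linear_map.zero[OF pairing_linear_map_right]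
  by (simp_all add: regular_diff p_closed)

lemma p_add_left: "a \<in> carrier A \<Longrightarrow> b \<in> carrier A \<Longrightarrow> c \<in> carrier C \<Longrightarrow>
    p (a \<oplus>\<^bsub>A\<^esub> b) c = p a c \<oplus> p b c"
  and p_smult_left: "a \<in> carrier A \<Longrightarrow> c \<in> carrier C \<Longrightarrow> r \<in> carrier R \<Longrightarrow>
    p (r \<odot>\<^bsub>A\<^esub> a) c = r \<otimes> p a c"
  and p_diff_left: "a \<in> carrier A \<Longrightarrow> b \<in> carrier A \<Longrightarrow> c \<in> carrier C \<Longrightarrow>
    p (a \<ominus>\<^bsub>A\<^esub> b) c = p a c \<ominus> p b c"
  and p_zero_left: "c \<in> carrier C \<Longrightarrow> p \<zero>\<^bsub>A\<^esub> c = \<zero>"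
  using linear_map.add[OF pairing_linear_map_left] linear_map.smult[OF pairing_linear_map_left]
    linear_map.diff[OF pairing_linear_map_left] linear_map.zero[OF pairing_linear_map_left]
  by (simp_all add: regular_diff p_closed)

definition perp :: "'c set \<Rightarrow> 'a set" where
  "perp T = {a \<in> carrier A. \<forall>t\<in>T. p a t = \<zero>}"

lemma perp_submodule: "T \<subseteq> carrier C \<Longrightarrow> submodule (perp T) R A"
  unfolding perp_def
  by (rule AR.submoduleI) (auto simp: subset_iff p_zero_left p_add_left p_smult_left AR.act_closed)

lemma perp_antimono: "S \<subseteq> T \<Longrightarrow> perp T \<subseteq> perp S"
  by (auto simp: perp_def)

lemma perp_span:
  assumes "T \<subseteq> carrier C"
  shows "perp (submodule_span R C T) = perp T"
proof
  show "perp (submodule_span R C T) \<subseteq> perp T" by (rule perp_antimono[OF span_superset])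
  show "perp T \<subseteq> perp (submodule_span R C T)"
  proof
    fix a assume a: "a \<in> perp T"
    then interpret pa: linear_map R C "regular_module R" "p a"
      by (intro pairing_linear_map_right) (simp add: perp_def)
    have "submodule_span R C T \<subseteq> {c \<in> carrier C. p a c = \<zero>\<^bsub>regular_module R\<^esub>}"
      using a assms by (intro span_least pa.kernel_submodule) (auto simp: perp_def)
    then show "a \<in> perp (submodule_span R C T)" using a by (auto simp: perp_def)
  qed
qed

lemma nondegenerate:
  assumes c: "c \<in> carrier C" and "\<And>a. a \<in> carrier A \<Longrightarrow> p a c = \<zero>"
  shows "c = \<zero>\<^bsub>C\<^esub>"
proof -
  have "{p a c \<odot>\<^bsub>C\<^esub> d | a d. a \<in> carrier A \<and> d \<in> carrier C} \<subseteq> {\<zero>\<^bsub>C\<^esub>}"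
    using assms by auto
  then show ?thesis using locally_projective[OF c] span_least[OF C.zero_submodule] by blast
qed

lemma separating:
  assumes "c \<in> carrier C" "d \<in> carrier C" "\<And>a. a \<in> carrier A \<Longrightarrow> p a c = p a d"
  shows "c = d"
proof -
  have "c \<ominus>\<^bsub>C\<^esub> d = \<zero>\<^bsub>C\<^esub>"
    using assms by (intro nondegenerate) (auto simp: p_diff_right p_closed R.minus_eq R.r_neg)
  then show ?thesis using C.diff_zero_iff assms by simp
qed

lemma Hom_diff_apply:
  assumes "left_module R Y" "f \<in> carrier (Hom_module R A Y)" "g \<in> carrier (Hom_module R A Y)"
    "a \<in> carrier A"
  shows "(f \<ominus>\<^bsub>Hom_module R A Y\<^esub> g) a = f a \<ominus>\<^bsub>Y\<^esub> g a"
proof -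
  interpret Y: left_module R Y by fact
  interpret H: left_module R "Hom_module R A Y"
    by (intro Hom_left_module R.is_cring AR.left_module_axioms assms)
  have "g a \<in> carrier Y" using assms linear_closed[of g R A Y a] by simp
  then show ?thesis
    unfolding a_minus_def H.minus_eq_act[OF assms(3)] using assms(4)
    by (simp add: Y.minus_eq_act)
qed

text \<open>Local projectivity says \<open>m = \<Sum> \<langle>a\<^sub>j, m\<rangle> d\<^sub>j\<close> for some \<open>a\<^sub>j\<close>, \<open>d\<^sub>j\<close>. Then \<open>\<phi> a = \<Sum> \<langle>a, d\<^sub>j\<rangle> a\<^sub>j\<close>
  and its transpose \<open>\<phi>' c = \<Sum> \<langle>a\<^sub>j, c\<rangle> d\<^sub>j\<close> are as desired. The sums are avoided: the values at \<open>m\<close> of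
  the transposes of rational maps form a submodule of \<open>C\<close>.\<close>

lemma rational_identity:
  assumes m: "m \<in> carrier C"
  obtains \<phi> \<phi>' where "\<phi> \<in> rational_maps R A C p A" "\<And>c. c \<in> carrier C \<Longrightarrow> \<phi>' c \<in> carrier C"
    "\<And>a c. a \<in> carrier A \<Longrightarrow> c \<in> carrier C \<Longrightarrow> p (\<phi> a) c = p a (\<phi>' c)" "\<phi>' m = m"
proof -
  interpret H: left_module R "Hom_module R A A"
    by (intro Hom_left_module R.is_cring AR.left_module_axioms)
  let ?G = "{\<lambda>a\<in>carrier A. p a c \<odot>\<^bsub>A\<^esub> x | x c. x \<in> carrier A \<and> c \<in> carrier C}"
  have G: "?G \<subseteq> carrier (Hom_module R A A)"
    by (auto intro!: linear_mapsI
        simp: p_closed p_add_left p_smult_left AR.act_closed AR.act_l_distr AR.act_assoc)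
  have rat: "submodule (rational_maps R A C p A) R (Hom_module R A A)"
    unfolding rational_maps_def by (rule H.span_submodule[OF G])
  have rc: "\<phi> a \<in> carrier A" if "\<phi> \<in> rational_maps R A C p A" "a \<in> carrier A" for \<phi> a
    using submodule_subset[OF rat that(1)] that(2) linear_closed[of \<phi> R A A a] by simp
  let ?P = "\<lambda>\<phi> \<phi>'. \<phi> \<in> rational_maps R A C p A \<and> (\<forall>c\<in>carrier C. \<phi>' c \<in> carrier C) \<and>
      (\<forall>a\<in>carrier A. \<forall>c\<in>carrier C. p (\<phi> a) c = p a (\<phi>' c))"
  let ?D = "{\<phi>' m | \<phi> \<phi>'. ?P \<phi> \<phi>'}"
  have D: "submodule ?D R C"
  proof (rule C.submoduleI)
    show "?D \<subseteq> carrier C" using m by auto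
    have "?P \<zero>\<^bsub>Hom_module R A A\<^esub> (\<lambda>c. \<zero>\<^bsub>C\<^esub>)"
      using submodule_zero[OF rat] by (simp add: p_zero_left p_zero_right)
    then show "\<zero>\<^bsub>C\<^esub> \<in> ?D"
      by (intro CollectI exI[of _ "\<zero>\<^bsub>Hom_module R A A\<^esub>"] exI[of _ "\<lambda>c. \<zero>\<^bsub>C\<^esub>"]) simp
  next
    fix x y assume "x \<in> ?D" "y \<in> ?D"
    then obtain \<phi> \<phi>' \<psi> \<psi>' where xy: "x = \<phi>' m" "y = \<psi>' m" and P: "?P \<phi> \<phi>'" "?P \<psi> \<psi>'" by blast
    have "?P (\<phi> \<oplus>\<^bsub>Hom_module R A A\<^esub> \<psi>) (\<lambda>c. \<phi>' c \<oplus>\<^bsub>C\<^esub> \<psi>' c)"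
      using P submodule_add[OF rat, of \<phi> \<psi>] by (auto simp: p_add_left p_add_right rc)
    then show "x \<oplus>\<^bsub>C\<^esub> y \<in> ?D" unfolding xy
      by (intro CollectI exI[of _ "\<phi> \<oplus>\<^bsub>Hom_module R A A\<^esub> \<psi>"] exI[of _ "\<lambda>c. \<phi>' c \<oplus>\<^bsub>C\<^esub> \<psi>' c"]) simp
  next
    fix r x assume r: "r \<in> carrier R" and "x \<in> ?D"
    then obtain \<phi> \<phi>' where xy: "x = \<phi>' m" and P: "?P \<phi> \<phi>'" by blast
    have "?P (r \<odot>\<^bsub>Hom_module R A A\<^esub> \<phi>) (\<lambda>c. r \<odot>\<^bsub>C\<^esub> \<phi>' c)"
      using P r submodule.smult_closed[OF rat, of r \<phi>]
      by (auto simp: p_smult_left p_smult_right rc C.act_closed)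
    then show "r \<odot>\<^bsub>C\<^esub> x \<in> ?D" unfolding xy
      by (intro CollectI exI[of _ "r \<odot>\<^bsub>Hom_module R A A\<^esub> \<phi>"] exI[of _ "\<lambda>c. r \<odot>\<^bsub>C\<^esub> \<phi>' c"]) simp
  qed
  have "p a m \<odot>\<^bsub>C\<^esub> d \<in> ?D" if ad: "a \<in> carrier A" "d \<in> carrier C" for a d
  proof -
    have "(\<lambda>b\<in>carrier A. p b d \<odot>\<^bsub>A\<^esub> a) \<in> rational_maps R A C p A"
      unfolding rational_maps_def by (rule subsetD[OF span_superset]) (use ad in blast)
    then have "?P (\<lambda>b\<in>carrier A. p b d \<odot>\<^bsub>A\<^esub> a) (\<lambda>c. p a c \<odot>\<^bsub>C\<^esub> d)"
      using ad by (auto simp: C.act_closed p_closed p_smult_left p_smult_right R.m_comm)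
    then show ?thesis
      by (intro CollectI exI[of _ "\<lambda>b\<in>carrier A. p b d \<odot>\<^bsub>A\<^esub> a"] exI[of _ "\<lambda>c. p a c \<odot>\<^bsub>C\<^esub> d"]) simp
  qed
  then have "{p a m \<odot>\<^bsub>C\<^esub> d | a d. a \<in> carrier A \<and> d \<in> carrier C} \<subseteq> ?D" by auto
  then have "m \<in> ?D" by (rule subsetD[OF span_least[OF D] locally_projective[OF m]])
  then obtain \<phi> \<phi>' where "?P \<phi> \<phi>'" and "m = \<phi>' m" by (elim CollectE exE conjE) (rule that, (intro conjI; assumption), assumption)
  then show thesis by (intro that[of \<phi> \<phi>']) auto
qed

lemma rational_maps_submodule:
  assumes "left_module R Y"
  shows "submodule (rational_maps R A C p Y) R (Hom_module R A Y)"
proof -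
  interpret Y: left_module R Y by fact
  interpret H: left_module R "Hom_module R A Y"
    by (intro Hom_left_module R.is_cring AR.left_module_axioms assms)
  show ?thesis unfolding rational_maps_def
    by (rule H.span_submodule)
      (auto intro!: linear_mapsI
        simp: p_closed p_add_left p_smult_left AR.act_closed Y.act_closed Y.act_l_distr Y.act_assoc)
qed

lemma rational_maps_compose:
  assumes "left_module R Y" and f: "f \<in> linear_maps R A Y" and \<phi>: "\<phi> \<in> rational_maps R A C p A"
  shows "(\<lambda>a\<in>carrier A. f (\<phi> a)) \<in> rational_maps R A C p Y"
proof -
  interpret f: linear_map R A Y f
    by (intro linear_map.intro linear_map_axioms.intro AR.left_module_axioms assms)
  have "linear_map R (Hom_module R A A) (Hom_module R A Y) (\<lambda>\<phi>. \<lambda>a\<in>carrier A. f (\<phi> a))"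
    by (intro linear_map.intro linear_map_axioms.intro Hom_left_module R.is_cring AR.left_module_axioms
        assms linear_mapsI)
      (auto simp: linear_maps_def Pi_def f.closed f.add f.smult AR.act_closed fun_eq_iff)
  then interpret post: linear_map R "Hom_module R A A" "Hom_module R A Y" "\<lambda>\<phi>. \<lambda>a\<in>carrier A. f (\<phi> a)" .
  let ?G = "{\<lambda>a\<in>carrier A. p a c \<odot>\<^bsub>A\<^esub> x | x c. x \<in> carrier A \<and> c \<in> carrier C}"
  let ?V = "{\<phi> \<in> carrier (Hom_module R A A). (\<lambda>a\<in>carrier A. f (\<phi> a)) \<in> rational_maps R A C p Y}"
  have "?G \<subseteq> ?V"
  proof
    fix g assume "g \<in> ?G"
    then obtain x c where g: "g = (\<lambda>a\<in>carrier A. p a c \<odot>\<^bsub>A\<^esub> x)" "x \<in> carrier A" "c \<in> carrier C" by blast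
    have "(\<lambda>a\<in>carrier A. f (g a)) = (\<lambda>a\<in>carrier A. p a c \<odot>\<^bsub>Y\<^esub> f x)"
      using g by (auto simp: f.smult p_closed)
    moreover have "(\<lambda>a\<in>carrier A. p a c \<odot>\<^bsub>Y\<^esub> f x) \<in> rational_maps R A C p Y"
      unfolding rational_maps_def by (rule subsetD[OF span_superset]) (use g f.closed in blast)
    moreover have "g \<in> carrier (Hom_module R A A)" using g
      by (auto intro!: linear_mapsI
        simp: p_closed p_add_left p_smult_left AR.act_closed AR.act_l_distr AR.act_assoc)
    ultimately show "g \<in> ?V" by simp
  qed
  then have "rational_maps R A C p A \<subseteq> ?V"
    unfolding rational_maps_def[of R A C p A]
    by (intro span_least post.vimage_submodule rational_maps_submodule assms)
  then show ?thesis using \<phi> by blast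
qed

text \<open>By induction on the size of \<open>T\<close>. Choose \<open>m \<in> T\<close> and a rational \<open>\<phi>\<close> whose transpose \<open>\<phi>'\<close> fixes \<open>m\<close>,
  and write \<open>f = (f - f \<circ> \<phi>) + f \<circ> \<phi>\<close>. The second summand is rational. The first one vanishes at
  \<open>a\<close> whenever \<open>a\<close> annihilates all \<open>t - \<phi>' t\<close> with \<open>t \<in> T\<close>, for then \<open>a - \<phi> a\<close> annihilates \<open>T\<close>; and the
  element \<open>m - \<phi>' m = 0\<close> may be dropped, which leaves fewer elements than \<open>T\<close> has.\<close>

lemma rational_mapsI:
  assumes Y: "left_module R Y"
    and f: "f \<in> linear_maps R A Y" "f \<in> extensional (carrier A)"
    and T: "finite T" "T \<subseteq> carrier C" "\<And>a. a \<in> perp T \<Longrightarrow> f a = \<zero>\<^bsub>Y\<^esub>"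
  shows "f \<in> rational_maps R A C p Y"
proof -
  interpret Y: left_module R Y by fact
  interpret H: left_module R "Hom_module R A Y"
    by (intro Hom_left_module R.is_cring AR.left_module_axioms assms)
  note rat = rational_maps_submodule[OF Y]
  have "f \<in> rational_maps R A C p Y"
    if "card T \<le> n" "f \<in> carrier (Hom_module R A Y)" "finite T" "T \<subseteq> carrier C"
      "\<And>a. a \<in> perp T \<Longrightarrow> f a = \<zero>\<^bsub>Y\<^esub>" for n f T
    using that
  proof (induction n arbitrary: f T)
    case 0
    then have "f = \<zero>\<^bsub>Hom_module R A Y\<^esub>"
      by (auto simp: perp_def fun_eq_iff extensional_def)
    then show ?case using submodule_zero[OF rat] by (simp only:)
  next
    case (Suc n)
    show ?case
    proof (cases "T = {}")
      case True
      then show ?thesis using Suc.IH[of T f] Suc.prems by simp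
    next
      case False
      then obtain m where m: "m \<in> T" by blast
      obtain \<phi> \<phi>' where \<phi>: "\<phi> \<in> rational_maps R A C p A" "\<And>c. c \<in> carrier C \<Longrightarrow> \<phi>' c \<in> carrier C"
        "\<And>a c. a \<in> carrier A \<Longrightarrow> c \<in> carrier C \<Longrightarrow> p (\<phi> a) c = p a (\<phi>' c)" "\<phi>' m = m"
        using rational_identity[of m] m Suc.prems by blast
      have \<phi>c: "\<phi> a \<in> carrier A" if "a \<in> carrier A" for a
        using submodule_subset[OF rational_maps_submodule[OF AR.left_module_axioms] \<phi>(1)] that
          linear_closed[of \<phi> R A A a] by simp
      interpret f: linear_map R A Y f
        using Suc.prems by (intro linear_map.intro linear_map_axioms.intro AR.left_module_axioms Y) simp
      define h where "h = (\<lambda>a\<in>carrier A. f (\<phi> a))"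
      have h: "h \<in> rational_maps R A C p Y"
        unfolding h_def by (rule rational_maps_compose[OF Y f.linear \<phi>(1)])
      then have hc: "h \<in> carrier (Hom_module R A Y)" by (rule submodule_subset[OF rat])
      let ?T = "(\<lambda>t. t \<ominus>\<^bsub>C\<^esub> \<phi>' t) ` (T - {m})"
      have "f \<ominus>\<^bsub>Hom_module R A Y\<^esub> h \<in> rational_maps R A C p Y"
      proof (rule Suc.IH[of ?T])
        have "card ?T \<le> card (T - {m})" by (rule card_image_le) (use Suc.prems in simp)
        then show "card ?T \<le> n" using Suc.prems m by simp
        show "f \<ominus>\<^bsub>Hom_module R A Y\<^esub> h \<in> carrier (Hom_module R A Y)"
          using Suc.prems(2) hc by (rule H.X.minus_closed)
        show "finite ?T" using Suc.prems by simp
        show "?T \<subseteq> carrier C" using Suc.prems \<phi>(2) by auto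
        fix a assume a: "a \<in> perp ?T"
        then have ac: "a \<in> carrier A" by (simp add: perp_def)
        have "p (a \<ominus>\<^bsub>A\<^esub> \<phi> a) t = \<zero>" if t: "t \<in> T" for t
        proof -
          have tc: "t \<in> carrier C" using t Suc.prems by auto
          have "p (a \<ominus>\<^bsub>A\<^esub> \<phi> a) t = p a (t \<ominus>\<^bsub>C\<^esub> \<phi>' t)"
            using ac tc \<phi> \<phi>c by (simp add: p_diff_left p_diff_right)
          also have "\<dots> = \<zero>"
          proof (cases "t = m")
            case True
            then show ?thesis using \<phi>(4) tc ac by (simp add: p_diff_right R.minus_eq R.r_neg p_closed)
          next
            case False
            then show ?thesis using a t by (auto simp: perp_def)
          qed
          finally show ?thesis .
        qed
        then have "f (a \<ominus>\<^bsub>A\<^esub> \<phi> a) = \<zero>\<^bsub>Y\<^esub>"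
          using Suc.prems(5) ac \<phi>c by (simp add: perp_def)
        then show "(f \<ominus>\<^bsub>Hom_module R A Y\<^esub> h) a = \<zero>\<^bsub>Y\<^esub>"
          using Hom_diff_apply[OF Y Suc.prems(2) hc ac] f.diff[OF ac \<phi>c[OF ac]] ac by (simp add: h_def)
      qed
      then show ?thesis using H.submodule_cancel[OF rat Suc.prems(2) h] by simp
    qed
  qed
  from this[OF order_refl _ T(1,2)] show ?thesis using f T(3) by simp
qed

text \<open>The rational maps are the maps that are continuous for the linear weak topology on \<open>A\<close> and the
  discrete topology on \<open>Y\<close>.\<close>

lemma rational_maps_iff:
  assumes Y: "left_module R Y" and f: "f \<in> linear_maps R A Y" "f \<in> extensional (carrier A)"
  shows "f \<in> rational_maps R A C p Y \<longleftrightarrow>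
    (\<exists>T. finite T \<and> T \<subseteq> carrier C \<and> (\<forall>a\<in>perp T. f a = \<zero>\<^bsub>Y\<^esub>))"
proof
  interpret Y: left_module R Y by fact
  interpret H: left_module R "Hom_module R A Y"
    by (intro Hom_left_module R.is_cring AR.left_module_axioms assms)
  let ?V = "{f \<in> carrier (Hom_module R A Y). \<exists>T. finite T \<and> T \<subseteq> carrier C \<and> (\<forall>a\<in>perp T. f a = \<zero>\<^bsub>Y\<^esub>)}"
  have pc: "a \<in> carrier A" if "a \<in> perp T" for a T using that by (simp add: perp_def)
  have "submodule ?V R (Hom_module R A Y)"
  proof (rule H.submoduleI)
    show "\<zero>\<^bsub>Hom_module R A Y\<^esub> \<in> ?V"
      using H.X.zero_closed pc by (auto intro!: exI[of _ "{}"])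
  next
    fix f g assume fg: "f \<in> ?V" "g \<in> ?V"
    then obtain S T where S: "finite S" "S \<subseteq> carrier C" "\<forall>a\<in>perp S. f a = \<zero>\<^bsub>Y\<^esub>"
      and T: "finite T" "T \<subseteq> carrier C" "\<forall>a\<in>perp T. g a = \<zero>\<^bsub>Y\<^esub>" by blast
    then have "finite (S \<union> T) \<and> S \<union> T \<subseteq> carrier C \<and> (\<forall>a\<in>perp (S \<union> T). (f \<oplus>\<^bsub>Hom_module R A Y\<^esub> g) a = \<zero>\<^bsub>Y\<^esub>)"
      using perp_antimono[of S "S \<union> T"] perp_antimono[of T "S \<union> T"] pc by (auto simp: subset_iff)
    moreover have "f \<oplus>\<^bsub>Hom_module R A Y\<^esub> g \<in> carrier (Hom_module R A Y)"
      using fg by (intro H.X.a_closed) auto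
    ultimately show "f \<oplus>\<^bsub>Hom_module R A Y\<^esub> g \<in> ?V" by blast
  next
    fix r f assume rf: "r \<in> carrier R" "f \<in> ?V"
    then obtain S where S: "finite S" "S \<subseteq> carrier C" "\<forall>a\<in>perp S. f a = \<zero>\<^bsub>Y\<^esub>" by blast
    then have "\<forall>a\<in>perp S. (r \<odot>\<^bsub>Hom_module R A Y\<^esub> f) a = \<zero>\<^bsub>Y\<^esub>" using rf pc by auto
    moreover have "r \<odot>\<^bsub>Hom_module R A Y\<^esub> f \<in> carrier (Hom_module R A Y)"
      using rf by (intro H.act_closed) auto
    ultimately show "r \<odot>\<^bsub>Hom_module R A Y\<^esub> f \<in> ?V" using S by blast
  qed auto
  moreover have "(\<lambda>a\<in>carrier A. p a c \<odot>\<^bsub>Y\<^esub> x) \<in> ?V" if "x \<in> carrier Y" "c \<in> carrier C" for x c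
    using that by (auto intro!: linear_mapsI exI[of _ "{c}"]
        simp: perp_def p_closed p_add_left p_smult_left AR.act_closed Y.act_closed Y.act_l_distr Y.act_assoc)
  ultimately have "rational_maps R A C p Y \<subseteq> ?V"
    unfolding rational_maps_def by (intro span_least) auto
  then show "\<exists>T. finite T \<and> T \<subseteq> carrier C \<and> (\<forall>a\<in>perp T. f a = \<zero>\<^bsub>Y\<^esub>)" if "f \<in> rational_maps R A C p Y"
    using that by blast
qed (use rational_mapsI[OF Y f] in blast)

end

section \<open>Topologies, cofinite ideals and the finite dual\<close>

definition filter_base :: "'a set set \<Rightarrow> bool" where
  "filter_base \<B> \<longleftrightarrow> \<B> \<noteq> {} \<and> (\<forall>N\<in>\<B>. \<forall>N'\<in>\<B>. \<exists>N''\<in>\<B>. N'' \<subseteq> N \<inter> N')"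

context left_module
begin

lemma l_coset_mono: "N \<subseteq> N' \<Longrightarrow> a <+\<^bsub>X\<^esub> N \<subseteq> a <+\<^bsub>X\<^esub> N'"
  by (auto simp: a_l_coset_def')

lemma openin_linear_topology_iff:
  "filter_base \<B> \<Longrightarrow> openin (linear_topology X \<B>) U \<longleftrightarrow>
    U \<subseteq> carrier X \<and> (\<forall>a\<in>U. \<exists>N\<in>\<B>. a <+\<^bsub>X\<^esub> N \<subseteq> U)"
  by (rule openin_linear_topology) (auto simp: filter_base_def)

text \<open>Members of the basis are open subgroups, so equality of two topologies can be tested at \<open>0\<close>.\<close>

lemma linear_topology_finer:
  assumes "filter_base \<B>" "filter_base \<B>'"
    and B: "\<And>N. N \<in> \<B> \<Longrightarrow> submodule N A X" and B': "\<And>N. N \<in> \<B>' \<Longrightarrow> submodule N A X"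
    and eq: "linear_topology X \<B> = linear_topology X \<B>'" and N: "N \<in> \<B>"
  shows "\<exists>N'\<in>\<B>'. N' \<subseteq> N"
proof -
  have "openin (linear_topology X \<B>) N"
    unfolding openin_linear_topology_iff[OF assms(1)]
    using submodule_subset[OF B[OF N]] submodule_add[OF B[OF N]] N
    by (auto simp: a_l_coset_def' intro!: bexI[of _ N])
  then obtain N' where N': "N' \<in> \<B>'" "\<zero>\<^bsub>X\<^esub> <+\<^bsub>X\<^esub> N' \<subseteq> N"
    unfolding eq openin_linear_topology_iff[OF assms(2)] using submodule_zero[OF B[OF N]] by blast
  show ?thesis
  proof (rule bexI[OF _ N'(1)], rule subsetI)
    fix n assume n: "n \<in> N'"
    then have "\<zero>\<^bsub>X\<^esub> \<oplus>\<^bsub>X\<^esub> n \<in> N" using N'(2) by (auto simp: a_l_coset_def')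
    then show "n \<in> N" using submodule_subset[OF B'[OF N'(1)] n] by simp
  qed
qed

lemma linear_topology_eqI:
  assumes fb: "filter_base \<B>" "filter_base \<B>'"
    and "\<And>N. N \<in> \<B> \<Longrightarrow> \<exists>N'\<in>\<B>'. N' \<subseteq> N" "\<And>N'. N' \<in> \<B>' \<Longrightarrow> \<exists>N\<in>\<B>. N \<subseteq> N'"
  shows "linear_topology X \<B> = linear_topology X \<B>'"
proof -
  have "(\<exists>N\<in>\<B>. a <+\<^bsub>X\<^esub> N \<subseteq> U) \<longleftrightarrow> (\<exists>N\<in>\<B>'. a <+\<^bsub>X\<^esub> N \<subseteq> U)" for a U
    using assms(3,4) l_coset_mono by (meson order_trans)
  then show ?thesis by (simp add: topology_eq openin_linear_topology_iff[OF fb(1)] openin_linear_topology_iff[OF fb(2)])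
qed

lemma linear_topology_eq_iff:
  assumes "filter_base \<B>" "filter_base \<B>'"
    and "\<And>N. N \<in> \<B> \<Longrightarrow> submodule N A X" "\<And>N. N \<in> \<B>' \<Longrightarrow> submodule N A X"
  shows "linear_topology X \<B> = linear_topology X \<B>' \<longleftrightarrow>
    (\<forall>N\<in>\<B>. \<exists>N'\<in>\<B>'. N' \<subseteq> N) \<and> (\<forall>N'\<in>\<B>'. \<exists>N\<in>\<B>. N \<subseteq> N')"
  using linear_topology_finer[OF assms] linear_topology_finer[OF assms(2,1,4,3)]
    linear_topology_eqI[OF assms(1,2)] by metis

lemma closedin_linear_topology_iff:
  assumes fb: "filter_base \<B>" and B: "\<And>N. N \<in> \<B> \<Longrightarrow> submodule N A X"
  shows "closedin (linear_topology X \<B>) U \<longleftrightarrow>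
    U \<subseteq> carrier X \<and> (\<forall>a\<in>carrier X - U. \<exists>N\<in>\<B>. (a <+\<^bsub>X\<^esub> N) \<inter> U = {})"
proof -
  have sub: "a <+\<^bsub>X\<^esub> N \<subseteq> carrier X" if "N \<in> \<B>" "a \<in> carrier X" for a N
    using submodule_subset[OF B[OF that(1)]] that(2) by (auto simp: a_l_coset_def')
  obtain N0 where "N0 \<in> \<B>" using fb by (auto simp: filter_base_def)
  then have "openin (linear_topology X \<B>) (carrier X)"
    unfolding openin_linear_topology_iff[OF fb] using sub by blast
  then have top: "topspace (linear_topology X \<B>) = carrier X"
    using openin_linear_topology_iff[OF fb, of "topspace (linear_topology X \<B>)"] openin_subset by fastforce
  have "a <+\<^bsub>X\<^esub> N \<subseteq> carrier X - U \<longleftrightarrow> (a <+\<^bsub>X\<^esub> N) \<inter> U = {}" if "N \<in> \<B>" "a \<in> carrier X" for a N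
    using sub[OF that] by blast
  then show ?thesis unfolding closedin_def top openin_linear_topology_iff[OF fb] by (meson DiffD1 Diff_subset)
qed

end

context locally_projective_pairing
begin

lemma ideal_submodule:
  assumes "ideal I A"
  shows "submodule I R A"
proof -
  interpret I: ideal I A by fact
  show ?thesis
  proof (rule AR.submoduleI)
    fix r x assume r: "r \<in> carrier R" and x: "x \<in> I"
    have xc: "x \<in> carrier A" using x I.a_subset by auto
    have "(r \<odot>\<^bsub>A\<^esub> \<one>\<^bsub>A\<^esub>) \<otimes>\<^bsub>A\<^esub> x \<in> I" using r x by (intro I.I_l_closed AR.act_closed) auto
    then show "r \<odot>\<^bsub>A\<^esub> x \<in> I" using smult_mult_left[of r "\<one>\<^bsub>A\<^esub>" x] r xc by simp
  qed (use I.a_subset I.a_closed additive_subgroup.zero_closed[OF I.is_additive_subgroup] in auto)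
qed

lemma cofinite_ideal_iff:
  "cofinite_ideal R A I \<longleftrightarrow> ideal I A \<and>
    (\<exists>Z. finite Z \<and> Z \<subseteq> carrier A \<and> submodule_span R A (I \<union> Z) = carrier A)"
  unfolding cofinite_ideal_def using AR.fg_quotient_iff[OF ideal_submodule] by blast

lemma cofinite_ideal_superset:
  assumes "ideal J A" "submodule I R A" "I \<subseteq> J"
    and "finite Z" "Z \<subseteq> carrier A" "submodule_span R A (I \<union> Z) = carrier A"
  shows "cofinite_ideal R A J"
proof -
  have "submodule_span R A (I \<union> Z) \<subseteq> submodule_span R A (J \<union> Z)" by (rule span_mono) (use assms(3) in auto)
  moreover have "submodule_span R A (J \<union> Z) \<subseteq> carrier A"
    using assms(5) submodule_subset[OF ideal_submodule[OF assms(1)]] by (intro AR.span_subset_carrier) auto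
  ultimately show ?thesis
    unfolding cofinite_ideal_iff using assms(1,4,5,6) by (intro conjI exI[of _ Z]) auto
qed

text \<open>\<open>I/(I \<inter> J)\<close> embeds in \<open>A/J\<close>, so it is finitely generated over the noetherian ring \<open>R\<close>.\<close>

lemma cofinite_ideal_Int:
  assumes noeth: "noetherian_ring R" and I: "cofinite_ideal R A I" and J: "cofinite_ideal R A J"
  shows "cofinite_ideal R A (I \<inter> J)"
proof -
  interpret M: cring_module R A by (intro cring_module.intro R.is_cring AR.left_module_axioms)
  have Ii: "ideal I A" and Ji: "ideal J A" using I J by (simp_all add: cofinite_ideal_def)
  note Is = ideal_submodule[OF Ii] and Js = ideal_submodule[OF Ji]
  have IJ: "ideal (I \<inter> J) A" by (rule A.i_intersect[OF Ii Ji])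
  obtain Z where Z: "finite Z" "Z \<subseteq> carrier A" "submodule_span R A (I \<union> Z) = carrier A"
    using I cofinite_ideal_iff by auto
  obtain Y where Y: "finite Y" "Y \<subseteq> carrier A" "submodule_span R A (J \<union> Y) = carrier A"
    using J cofinite_ideal_iff by auto
  have IA: "I \<subseteq> carrier A" using submodule_subset[OF Is] by auto
  obtain W where W: "finite W" "W \<subseteq> I" "I \<subseteq> submodule_span R A ((I \<inter> J) \<union> W)"
    using M.noetherian_relative_fg[OF noeth Js Y(1,2) Is] Y(3) IA by auto
  have "submodule_span R A (I \<union> Z) \<subseteq> submodule_span R A (((I \<inter> J) \<union> W) \<union> Z)"
    by (rule AR.span_Un_span) (use W Z IA in auto)
  moreover have "submodule_span R A (((I \<inter> J) \<union> W) \<union> Z) \<subseteq> carrier A"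
    by (rule AR.span_subset_carrier) (use W Z IA in auto)
  ultimately show ?thesis
    unfolding cofinite_ideal_iff using IJ W Z IA
    by (intro conjI exI[of _ "W \<union> Z"]) (auto simp: Un_assoc)
qed

text \<open>\<open>A/perp T\<close> embeds in \<open>R\<^sup>n\<close>, where \<open>n\<close> is the size of \<open>T\<close>.\<close>

lemma perp_cofinite:
  assumes "noetherian_ring R" "finite T" "T \<subseteq> carrier C"
  shows "\<exists>Z. finite Z \<and> Z \<subseteq> carrier A \<and> submodule_span R A (perp T \<union> Z) = carrier A"
proof -
  have "\<exists>Z. finite Z \<and> Z \<subseteq> carrier A \<and> carrier A \<subseteq>
      submodule_span R A ({a \<in> carrier A. \<forall>t\<in>T. p a t = \<zero>\<^bsub>regular_module R\<^esub>} \<union> Z)"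
  proof (rule kernels_cofinite[OF R.is_cring assms(1,2)])
    fix t assume "t \<in> T"
    then have t: "t \<in> carrier C" using assms by auto
    then show "linear_map R A (regular_module R) (\<lambda>a. p a t)" by (rule pairing_linear_map_left)
    show "\<exists>S. finite S \<and> S \<subseteq> carrier (regular_module R) \<and>
        (\<lambda>a. p a t) ` carrier A \<subseteq> submodule_span R (regular_module R) S"
      using t p_closed by (intro exI[of _ "{\<one>}"]) (auto simp: R.regular_span_one)
  qed (rule AR.left_module_axioms AR.carrier_submodule)+
  then obtain Z where Z: "finite Z" "Z \<subseteq> carrier A" "carrier A \<subseteq> submodule_span R A (perp T \<union> Z)"
    by (auto simp: perp_def)
  then show ?thesis
    using AR.span_subset_carrier[of "perp T \<union> Z"] by (intro exI[of _ Z]) (auto simp: perp_def)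
qed

text \<open>The largest two-sided ideal \<open>I\<close> inside \<open>perp T\<close> will do: \<open>a \<mapsto> \<langle>b a d, t\<rangle>\<close> vanishes on the annihilator
  of a finite set that does not depend on \<open>b\<close> and \<open>d\<close>, so \<open>I\<close> contains some \<open>perp W\<close> with \<open>W\<close> finite.\<close>

lemma perp_contains_cofinite_ideal:
  assumes noeth: "noetherian_ring R" and T: "finite T" "T \<subseteq> carrier C"
  shows "\<exists>I. cofinite_ideal R A I \<and> I \<subseteq> perp T"
proof -
  define I where "I = {a \<in> carrier A. \<forall>b\<in>carrier A. \<forall>d\<in>carrier A. \<forall>t\<in>T. p (b \<otimes>\<^bsub>A\<^esub> (a \<otimes>\<^bsub>A\<^esub> d)) t = \<zero>}"
  have tc: "t \<in> carrier C" if "t \<in> T" for t using that T by auto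
  have IA: "I \<subseteq> carrier A" by (auto simp: I_def)
  have "ideal I A"
  proof (rule idealI[OF A.ring_axioms])
    show "subgroup I (add_monoid A)"
    proof (rule submodule.axioms(1), rule AR.submoduleI)
      show "\<zero>\<^bsub>A\<^esub> \<in> I" using tc by (simp add: I_def p_zero_left)
      show "x \<oplus>\<^bsub>A\<^esub> y \<in> I" if "x \<in> I" "y \<in> I" for x y
        using that tc by (simp add: I_def A.l_distr A.r_distr p_add_left)
      show "r \<odot>\<^bsub>A\<^esub> x \<in> I" if "r \<in> carrier R" "x \<in> I" for r x
        using that tc by (simp add: I_def smult_mult_left smult_mult_right AR.act_closed p_smult_left)
    qed (rule IA)
  next
    fix a x assume a: "a \<in> I" and x: "x \<in> carrier A"
    have ac: "a \<in> carrier A" using a IA by auto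
    show "x \<otimes>\<^bsub>A\<^esub> a \<in> I"
    proof -
      have "p (b \<otimes>\<^bsub>A\<^esub> ((x \<otimes>\<^bsub>A\<^esub> a) \<otimes>\<^bsub>A\<^esub> d)) t = \<zero>" if "b \<in> carrier A" "d \<in> carrier A" "t \<in> T" for b d t
      proof -
        have "b \<otimes>\<^bsub>A\<^esub> ((x \<otimes>\<^bsub>A\<^esub> a) \<otimes>\<^bsub>A\<^esub> d) = (b \<otimes>\<^bsub>A\<^esub> x) \<otimes>\<^bsub>A\<^esub> (a \<otimes>\<^bsub>A\<^esub> d)"
          using that x ac by (simp add: A.m_assoc)
        then show ?thesis using a x that unfolding I_def by simp
      qed
      then show ?thesis using x ac by (simp add: I_def)
    qed
    show "a \<otimes>\<^bsub>A\<^esub> x \<in> I" using a x ac by (simp add: I_def A.m_assoc)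
  qed
  have "\<exists>U. finite U \<and> U \<subseteq> carrier C \<and> (\<forall>a\<in>carrier A. \<forall>b\<in>carrier A. a \<in> perp U \<longrightarrow> p (b \<otimes>\<^bsub>A\<^esub> a) t = \<zero>)"
    if "t \<in> T" for t
    using mult_continuous_right[OF tc[OF that]] by (auto simp: perp_def)
  then obtain U where U: "\<And>t. t \<in> T \<Longrightarrow> finite (U t)" "\<And>t. t \<in> T \<Longrightarrow> U t \<subseteq> carrier C"
    "\<And>t a b. t \<in> T \<Longrightarrow> a \<in> carrier A \<Longrightarrow> b \<in> carrier A \<Longrightarrow> a \<in> perp (U t) \<Longrightarrow> p (b \<otimes>\<^bsub>A\<^esub> a) t = \<zero>"
    by metis
  have "\<exists>V. finite V \<and> V \<subseteq> carrier C \<and> (\<forall>a\<in>carrier A. \<forall>b\<in>carrier A. a \<in> perp V \<longrightarrow> p (a \<otimes>\<^bsub>A\<^esub> b) u = \<zero>)"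
    if "u \<in> carrier C" for u
    using mult_continuous_left[OF that] by (auto simp: perp_def)
  then obtain V where V: "\<And>u. u \<in> carrier C \<Longrightarrow> finite (V u)" "\<And>u. u \<in> carrier C \<Longrightarrow> V u \<subseteq> carrier C"
    "\<And>u a b. u \<in> carrier C \<Longrightarrow> a \<in> carrier A \<Longrightarrow> b \<in> carrier A \<Longrightarrow> a \<in> perp (V u) \<Longrightarrow> p (a \<otimes>\<^bsub>A\<^esub> b) u = \<zero>"
    by metis
  define W where "W = (\<Union>t\<in>T. \<Union>u\<in>U t. V u)"
  have W: "finite W" "W \<subseteq> carrier C"
    using T U(1,2) V(1,2) unfolding W_def by blast+
  have "perp W \<subseteq> I"
  proof
    fix a assume a: "a \<in> perp W"
    then have ac: "a \<in> carrier A" by (simp add: perp_def)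
    have "p (b \<otimes>\<^bsub>A\<^esub> (a \<otimes>\<^bsub>A\<^esub> d)) t = \<zero>" if bd: "b \<in> carrier A" "d \<in> carrier A" and t: "t \<in> T" for b d t
    proof (rule U(3)[OF t _ bd(1)])
      have "p (a \<otimes>\<^bsub>A\<^esub> d) u = \<zero>" if u: "u \<in> U t" for u
      proof (rule V(3)[OF _ ac bd(2)])
        show "u \<in> carrier C" using u U(2)[OF t] by auto
        show "a \<in> perp (V u)" using a u t by (auto simp: perp_def W_def)
      qed
      then show "a \<otimes>\<^bsub>A\<^esub> d \<in> perp (U t)" using ac bd by (simp add: perp_def)
    qed (use ac bd in simp)
    then show "a \<in> I" using ac by (simp add: I_def)
  qed
  moreover obtain Z where Z: "finite Z" "Z \<subseteq> carrier A" "submodule_span R A (perp W \<union> Z) = carrier A"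
    using perp_cofinite[OF noeth W] by blast
  ultimately have "cofinite_ideal R A I"
    using cofinite_ideal_superset[OF \<open>ideal I A\<close> perp_submodule[OF W(2)]] by blast
  moreover have "I \<subseteq> perp T"
  proof
    fix a assume a: "a \<in> I"
    then have "p (\<one>\<^bsub>A\<^esub> \<otimes>\<^bsub>A\<^esub> (a \<otimes>\<^bsub>A\<^esub> \<one>\<^bsub>A\<^esub>)) t = \<zero>" if "t \<in> T" for t
      using that A.one_closed unfolding I_def by blast
    then show "a \<in> perp T" using a IA by (auto simp: perp_def)
  qed
  ultimately show ?thesis by blast
qed

definition perps :: "'a set set" where
  "perps = {perp T | T. finite T \<and> T \<subseteq> carrier C}"

lemma perps_filter_base: "filter_base perps"
proof -
  have "\<exists>N''\<in>perps. N'' \<subseteq> perp S \<inter> perp T" if "finite S" "S \<subseteq> carrier C" "finite T" "T \<subseteq> carrier C" for S T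
    using that by (intro bexI[of _ "perp (S \<union> T)"]) (auto simp: perps_def perp_def)
  then show ?thesis unfolding filter_base_def perps_def by blast
qed

lemma perps_submodule: "N \<in> perps \<Longrightarrow> submodule N R A"
  by (auto simp: perps_def perp_submodule)

lemma linear_weak_topology_eq: "linear_weak_topology R A C p = linear_topology A perps"
proof -
  have "{{a \<in> carrier A. \<forall>c\<in>K. p a c = \<zero>} | K. fg_submodule R C K} = perps"
    unfolding perps_def fg_submodule_def perp_def[symmetric]
    by (smt (verit, ccfv_SIG) Collect_cong perp_span)
  then show ?thesis by (simp add: linear_weak_topology_def)
qed

lemma closedin_weak_iff:
  "closedin (linear_weak_topology R A C p) U \<longleftrightarrow>
    U \<subseteq> carrier A \<and> (\<forall>a\<in>carrier A - U. \<exists>N\<in>perps. (a <+\<^bsub>A\<^esub> N) \<inter> U = {})"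
  unfolding linear_weak_topology_eq
  by (rule AR.closedin_linear_topology_iff[OF perps_filter_base]) (rule perps_submodule)

lemma cofinite_ideals_filter_base:
  assumes "noetherian_ring R"
  shows "filter_base {I. cofinite_ideal R A I}"
  using perp_contains_cofinite_ideal[OF assms, of "{}"] cofinite_ideal_Int[OF assms]
  unfolding filter_base_def by blast

lemma cofinite_ideal_submodule: "cofinite_ideal R A I \<Longrightarrow> submodule I R A"
  by (simp add: cofinite_ideal_def ideal_submodule)

lemma coreflexive_iff:
  assumes noeth: "noetherian_ring R"
  shows "coreflexive R A C p \<longleftrightarrow>
    (\<forall>I. cofinite_ideal R A I \<longrightarrow> (\<exists>T. finite T \<and> T \<subseteq> carrier C \<and> perp T \<subseteq> I))"
proof -
  have "coreflexive R A C p \<longleftrightarrow> (\<forall>N\<in>perps. \<exists>I\<in>{I. cofinite_ideal R A I}. I \<subseteq> N) \<and>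
      (\<forall>I\<in>{I. cofinite_ideal R A I}. \<exists>N\<in>perps. N \<subseteq> I)"
    unfolding coreflexive_def linear_weak_topology_eq cofinite_topology_def
    by (rule AR.linear_topology_eq_iff[OF perps_filter_base cofinite_ideals_filter_base[OF noeth]])
      (simp_all add: perps_submodule cofinite_ideal_submodule)
  moreover have "\<forall>N\<in>perps. \<exists>I\<in>{I. cofinite_ideal R A I}. I \<subseteq> N"
    using perp_contains_cofinite_ideal[OF noeth] by (auto simp: perps_def)
  moreover have "(\<exists>N\<in>perps. N \<subseteq> I) \<longleftrightarrow> (\<exists>T. finite T \<and> T \<subseteq> carrier C \<and> perp T \<subseteq> I)" for I
    by (auto simp: perps_def)
  ultimately show ?thesis by simp
qed

lemma chi_linear: "chi A p \<in> linear_maps R C (Hom_module R A (regular_module R))"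
  by (intro linear_mapsI)
    (auto simp: chi_def fun_eq_iff p_closed p_add_right p_smult_right p_add_left p_smult_left
      AR.act_closed intro!: linear_mapsI)

lemma chi_closed: "c \<in> carrier C \<Longrightarrow> chi A p c \<in> carrier (dual_module R A)"
  unfolding dual_module_def by (rule linear_closed[OF chi_linear])

lemma rational_maps_regular: "rational_maps R A C p (regular_module R) \<subseteq> chi A p ` carrier C"
proof -
  have "linear_map R C (Hom_module R A (regular_module R)) (chi A p)"
    by (intro linear_map.intro linear_map_axioms.intro C.left_module_axioms chi_linear
        Hom_left_module R.is_cring AR.left_module_axioms R.regular_left_module)
  then have "submodule (chi A p ` carrier C) R (Hom_module R A (regular_module R))"
    using linear_map.image_submodule C.carrier_submodule by blast
  moreover have "(\<lambda>a\<in>carrier A. p a c \<odot>\<^bsub>regular_module R\<^esub> r) \<in> chi A p ` carrier C"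
    if "r \<in> carrier (regular_module R)" "c \<in> carrier C" for r c
    using that by (intro image_eqI[of _ _ "r \<odot>\<^bsub>C\<^esub> c"])
      (auto simp: chi_def p_smult_right R.m_comm p_closed C.act_closed)
  ultimately show ?thesis unfolding rational_maps_def by (intro span_least) auto
qed

lemma chi_in_finite_dual:
  assumes noeth: "noetherian_ring R" and c: "c \<in> carrier C"
  shows "chi A p c \<in> finite_dual R A"
proof -
  obtain I where I: "cofinite_ideal R A I" "I \<subseteq> perp {c}"
    using perp_contains_cofinite_ideal[OF noeth, of "{c}"] c by auto
  then have "\<forall>a\<in>I. chi A p c a = \<zero>" by (auto simp: perp_def chi_def)
  then show ?thesis using I(1) chi_closed[OF c] by (auto simp: finite_dual_def)
qed

text \<open>A functional that kills a cofinite ideal kills some \<open>perp T\<close>, so it is rational; and rational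
  functionals \<open>a \<mapsto> \<Sum> \<langle>a, c\<^sub>i\<rangle> r\<^sub>i = \<langle>a, \<Sum> r\<^sub>i c\<^sub>i\<rangle>\<close> come from \<open>C\<close>.\<close>

lemma coreflexive_imp_finite_dual:
  assumes noeth: "noetherian_ring R" and "coreflexive R A C p"
  shows "chi A p ` carrier C = finite_dual R A"
proof
  show "chi A p ` carrier C \<subseteq> finite_dual R A" using chi_in_finite_dual[OF noeth] by blast
  show "finite_dual R A \<subseteq> chi A p ` carrier C"
  proof
    fix f assume "f \<in> finite_dual R A"
    then obtain I where f: "f \<in> linear_maps R A (regular_module R)" "f \<in> extensional (carrier A)"
      and I: "cofinite_ideal R A I" "\<forall>a\<in>I. f a = \<zero>"
      by (auto simp: finite_dual_def dual_module_def)
    obtain T where T: "finite T" "T \<subseteq> carrier C" "perp T \<subseteq> I"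
      using assms(2) I(1) unfolding coreflexive_iff[OF noeth] by blast
    have "f \<in> rational_maps R A C p (regular_module R)"
      using I(2) T by (intro rational_mapsI[OF R.regular_left_module f T(1,2)]) auto
    then show "f \<in> chi A p ` carrier C" using rational_maps_regular by blast
  qed
qed

lemma perp_subset_imp_closed:
  assumes "submodule I R A" "finite T" "T \<subseteq> carrier C" "perp T \<subseteq> I"
  shows "closedin (linear_weak_topology R A C p) I"
  unfolding closedin_weak_iff
proof (intro conjI ballI)
  show "I \<subseteq> carrier A" using submodule_subset[OF assms(1)] by blast
  fix a assume a: "a \<in> carrier A - I"
  have "a \<oplus>\<^bsub>A\<^esub> n \<notin> I" if "n \<in> perp T" for n
  proof
    assume *: "a \<oplus>\<^bsub>A\<^esub> n \<in> I"
    have n: "n \<in> I" "n \<in> carrier A" using that assms(4) by (auto simp: perp_def)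
    have "(a \<oplus>\<^bsub>A\<^esub> n) \<ominus>\<^bsub>A\<^esub> n = a" using a n by (simp add: A.minus_eq A.a_assoc A.r_neg)
    then show False using submodule_diff[OF assms(1) * n(1)] a by simp
  qed
  then show "\<exists>N\<in>perps. (a <+\<^bsub>A\<^esub> N) \<inter> I = {}"
    using assms by (intro bexI[of _ "perp T"]) (auto simp: perps_def a_l_coset_def')
qed

text \<open>The closed ideal \<open>I\<close> is the intersection of the submodules \<open>I + perp T\<close>. If none of these were
  equal to \<open>I\<close>, one could shrink them forever, against the descending chain condition in \<open>A/I\<close>.\<close>

lemma artinian_closed_imp_perp_subset:
  assumes art: "artinian_ring R" and I: "cofinite_ideal R A I"
    and closed: "closedin (linear_weak_topology R A C p) I"
  shows "\<exists>T. finite T \<and> T \<subseteq> carrier C \<and> perp T \<subseteq> I"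
proof (rule ccontr)
  assume neg: "\<not> ?thesis"
  interpret M: cring_module R A by (intro cring_module.intro R.is_cring AR.left_module_axioms)
  note Is = cofinite_ideal_submodule[OF I]
  define D where "D T = {i \<oplus>\<^bsub>A\<^esub> n | i n. i \<in> I \<and> n \<in> perp T}" for T
  have Dsub: "submodule (D T) R A" if "T \<subseteq> carrier C" for T
    unfolding D_def by (rule AR.submodule_sum[OF Is perp_submodule[OF that]])
  have ID: "I \<subseteq> D T" if "T \<subseteq> carrier C" for T
  proof
    fix i assume "i \<in> I"
    then show "i \<in> D T" unfolding D_def
      using submodule_zero[OF perp_submodule[OF that]] submodule_subset[OF Is]
      by (intro CollectI exI[of _ i] exI[of _ "\<zero>\<^bsub>A\<^esub>"]) auto
  qed
  let ?P = "\<lambda>T. finite T \<and> T \<subseteq> carrier C"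
  have step: "\<exists>T'. ?P T' \<and> D T' \<subset> D T" if T: "?P T" for T
  proof -
    obtain a where a: "a \<in> perp T" "a \<notin> I" using neg T by blast
    have ac: "a \<in> carrier A" using a by (simp add: perp_def)
    then obtain N where N: "N \<in> perps" "(a <+\<^bsub>A\<^esub> N) \<inter> I = {}"
      using closed a(2) unfolding closedin_weak_iff by blast
    then obtain S where S: "?P S" "N = perp S" by (auto simp: perps_def)
    have "a \<in> D T" unfolding D_def using a(1) ac submodule_zero[OF Is]
      by (intro CollectI exI[of _ "\<zero>\<^bsub>A\<^esub>"] exI[of _ a]) auto
    moreover have "a \<notin> D (T \<union> S)"
    proof
      assume "a \<in> D (T \<union> S)"
      then obtain i n where i: "a = i \<oplus>\<^bsub>A\<^esub> n" "i \<in> I" "n \<in> perp (T \<union> S)" by (auto simp: D_def)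
      have n: "n \<in> perp S" using i(3) by (auto simp: perp_def)
      have "\<ominus>\<^bsub>A\<^esub> n \<in> N" using submodule_minus[OF perp_submodule n] S by simp
      moreover have "a \<oplus>\<^bsub>A\<^esub> \<ominus>\<^bsub>A\<^esub> n = i"
        using i n submodule_subset[OF Is i(2)] by (simp add: A.a_assoc A.r_neg perp_def)
      ultimately have "i \<in> a <+\<^bsub>A\<^esub> N" unfolding a_l_coset_def' by blast
      then show False using N(2) i(2) by blast
    qed
    moreover have "D (T \<union> S) \<subseteq> D T" using perp_antimono[of T "T \<union> S"] by (auto simp: D_def)
    ultimately have "D (T \<union> S) \<subset> D T" by (metis psubsetI)
    then show ?thesis using T S(1) by (intro exI[of _ "T \<union> S"] conjI) auto
  qed
  have "\<exists>t. \<forall>n. ?P (t n) \<and> D (t (Suc n)) \<subset> D (t n)"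
  proof (rule dependent_nat_choice)
    show "\<exists>T. ?P T" by (intro exI[of _ "{}"]) simp
    show "\<exists>T'. ?P T' \<and> D T' \<subset> D T" if "?P T" for T n using step[OF that] .
  qed
  then obtain t where "\<forall>n. ?P (t n) \<and> D (t (Suc n)) \<subset> D (t n)" ..
  then have t: "\<And>n. ?P (t n)" "\<And>n. D (t (Suc n)) \<subset> D (t n)" by simp_all
  obtain Z where Z: "finite Z" "Z \<subseteq> carrier A" "submodule_span R A (I \<union> Z) = carrier A"
    using I cofinite_ideal_iff by auto
  have "\<exists>n. \<forall>m\<ge>n. D (t n) \<inter> submodule_span R A (I \<union> Z) \<subseteq> D (t m)"
  proof (rule M.artinian_chain_stabilizes[OF art Is Z(1,2)])
    show "submodule (D (t n)) R A" "I \<subseteq> D (t n)" for n using t(1) Dsub ID by simp_all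
    show "D (t (Suc n)) \<subseteq> D (t n)" for n using t(2)[of n] by (rule psubset_imp_subset)
  qed
  then obtain n where "\<forall>m\<ge>n. D (t n) \<inter> carrier A \<subseteq> D (t m)" unfolding Z(3) by blast
  then have "D (t n) \<inter> carrier A \<subseteq> D (t (Suc n))" by simp
  moreover have "D (t n) \<subseteq> carrier A" using submodule_subset[OF Dsub] t(1) by blast
  ultimately show False using t(2)[of n] by blast
qed

lemma artinian_coreflexive_iff:
  assumes "noetherian_ring R" "artinian_ring R"
  shows "coreflexive R A C p \<longleftrightarrow>
    (\<forall>I. cofinite_ideal R A I \<longrightarrow> closedin (linear_weak_topology R A C p) I)"
  unfolding coreflexive_iff[OF assms(1)]
  using perp_subset_imp_closed artinian_closed_imp_perp_subset[OF assms(2)] cofinite_ideal_submodule by meson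

text \<open>The submodule \<open>D\<close> of all \<open>c \<in> C\<close> with \<open>\<langle>I, c\<rangle> = 0\<close> is finitely generated, because an element of \<open>D\<close> is
  determined by its values at finitely many generators of \<open>A/I\<close>. By cogeneration, an element outside
  \<open>I\<close> is detected by a functional that kills \<open>I\<close>; this functional lies in the finite dual, hence in
  \<open>D\<close>. Therefore \<open>I\<close> contains the annihilator of a finite generating set of \<open>D\<close>.\<close>

lemma cogenerated_finite_dual_imp_coreflexive:
  assumes noeth: "noetherian_ring R" and cog: "cofinitely_cogenerated R A"
    and dual: "chi A p ` carrier C = finite_dual R A"
  shows "coreflexive R A C p"
  unfolding coreflexive_iff[OF noeth]
proof (intro allI impI)
  fix I assume I: "cofinite_ideal R A I"
  note Is = cofinite_ideal_submodule[OF I]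
  obtain Z where Z: "finite Z" "Z \<subseteq> carrier A" "submodule_span R A (I \<union> Z) = carrier A"
    using I cofinite_ideal_iff by auto
  define D where "D = {c \<in> carrier C. \<forall>a\<in>I. p a c = \<zero>}"
  have Ic: "a \<in> carrier A" if "a \<in> I" for a using submodule_subset[OF Is that] .
  have D: "submodule D R C"
    unfolding D_def by (rule C.submoduleI) (auto simp: Ic p_zero_right p_add_right p_smult_right C.act_closed)
  have "\<exists>G. finite G \<and> G \<subseteq> D \<and> D \<subseteq> submodule_span R C ({c \<in> D. \<forall>z\<in>Z. p z c = \<zero>\<^bsub>regular_module R\<^esub>} \<union> G)"
  proof (rule kernels_cofinite[OF R.is_cring noeth Z(1)])
    fix z assume "z \<in> Z"
    then have z: "z \<in> carrier A" using Z by auto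
    then show "linear_map R C (regular_module R) (p z)" by (rule pairing_linear_map_right)
    show "\<exists>S. finite S \<and> S \<subseteq> carrier (regular_module R) \<and> p z ` D \<subseteq> submodule_span R (regular_module R) S"
      using z p_closed submodule_subset[OF D] by (intro exI[of _ "{\<one>}"]) (auto simp: R.regular_span_one)
  qed (rule C.left_module_axioms D)+
  then obtain G where G: "finite G" "G \<subseteq> D"
    "D \<subseteq> submodule_span R C ({c \<in> D. \<forall>z\<in>Z. p z c = \<zero>} \<union> G)" by auto
  have GC: "G \<subseteq> carrier C" using G(2) by (auto simp: D_def)
  have "{c \<in> D. \<forall>z\<in>Z. p z c = \<zero>} \<subseteq> {\<zero>\<^bsub>C\<^esub>}"
  proof
    fix c assume c: "c \<in> {c \<in> D. \<forall>z\<in>Z. p z c = \<zero>}"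
    then have cc: "c \<in> carrier C" by (simp add: D_def)
    have "submodule_span R A (I \<union> Z) \<subseteq> {a \<in> carrier A. p a c = \<zero>\<^bsub>regular_module R\<^esub>}"
      using c Ic Z(2)
      by (intro span_least linear_map.kernel_submodule[OF pairing_linear_map_left[OF cc]]) (auto simp: D_def)
    then have "c = \<zero>\<^bsub>C\<^esub>" unfolding Z(3) by (intro nondegenerate cc) auto
    then show "c \<in> {\<zero>\<^bsub>C\<^esub>}" by simp
  qed
  then have "submodule_span R C ({c \<in> D. \<forall>z\<in>Z. p z c = \<zero>} \<union> G) \<subseteq> submodule_span R C G"
    using submodule_zero[OF C.span_submodule[OF GC]] span_superset[of G R C]
    by (intro span_least C.span_submodule GC) auto
  then have DG: "D \<subseteq> submodule_span R C G" using G(3) by blast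
  have "perp G \<subseteq> I"
  proof (rule subsetI, rule ccontr)
    fix a assume a: "a \<in> perp G" and nI: "a \<notin> I"
    have ac: "a \<in> carrier A" using a by (simp add: perp_def)
    obtain J :: "'a set set" and h where h: "h \<in> linear_maps R (quotient_module A I) (power_module J (regular_module R))"
      and inj: "inj_on h (carrier (quotient_module A I))"
      using cog I unfolding cofinitely_cogenerated_def embeds_in_power_of_ring_def by blast
    interpret \<pi>: linear_map R A "quotient_module A I" "\<lambda>x. I +>\<^bsub>A\<^esub> x"
      by (rule AR.quotient_proj_linear_map[OF Is])
    interpret h: linear_map R "quotient_module A I" "power_module J (regular_module R)" h
      by (intro linear_map.intro linear_map_axioms.intro \<pi>.Y.left_module_axioms h
          left_module.power_left_module R.regular_left_module)
    have "I +>\<^bsub>A\<^esub> a \<noteq> \<zero>\<^bsub>quotient_module A I\<^esub>"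
      using nI AR.coset_eq_self_iff[OF Is ac] by (simp add: AR.quotient_zero)
    then have "h (I +>\<^bsub>A\<^esub> a) \<noteq> \<zero>\<^bsub>power_module J (regular_module R)\<^esub>"
      using inj_onD[OF inj, of "I +>\<^bsub>A\<^esub> a" "\<zero>\<^bsub>quotient_module A I\<^esub>"] \<pi>.closed[OF ac] h.zero \<pi>.Y.X.zero_closed
      by auto
    moreover have "h (I +>\<^bsub>A\<^esub> a) \<in> carrier (power_module J (regular_module R))"
      by (rule h.closed[OF \<pi>.closed[OF ac]])
    ultimately obtain j where j: "j \<in> J" "h (I +>\<^bsub>A\<^esub> a) j \<noteq> \<zero>"
      by (auto simp: PiE_iff extensional_def fun_eq_iff split: if_splits)
    define f where "f = (\<lambda>x\<in>carrier A. h (I +>\<^bsub>A\<^esub> x) j)"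
    have hj: "h (I +>\<^bsub>A\<^esub> x) j \<in> carrier R" if "x \<in> carrier A" for x
      using h.closed[OF \<pi>.closed[OF that]] j(1) by auto
    have fI: "f x = \<zero>" if "x \<in> I" for x
      using that Ic AR.coset_eq_self_iff[OF Is, of x] h.zero j(1) by (auto simp: f_def AR.quotient_zero)
    have "f \<in> linear_maps R A (regular_module R)"
      using j(1) by (intro linear_mapsI)
        (auto simp: f_def hj \<pi>.add \<pi>.smult h.add h.smult \<pi>.closed AR.act_closed)
    moreover have "f \<in> extensional (carrier A)" by (simp add: f_def)
    ultimately have "f \<in> finite_dual R A"
      unfolding finite_dual_def dual_module_def using I fI by auto
    then obtain c where c: "c \<in> carrier C" "f = chi A p c" using dual by auto
    have "c \<in> D" using c fI Ic by (auto simp: D_def chi_def)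
    then have "p a c = \<zero>" using DG a perp_span[OF GC] by (auto simp: perp_def)
    moreover have "f a = p a c" using c(2) ac by (simp add: chi_def)
    ultimately show False using j(2) ac by (simp add: f_def)
  qed
  then show "\<exists>T. finite T \<and> T \<subseteq> carrier C \<and> perp T \<subseteq> I" using G GC by blast
qed

end

section \<open>Left modules over the algebra\<close>

lemma restrict_scalars_simps [simp]:
  "carrier (restrict_scalars A X) = carrier X"
  "\<zero>\<^bsub>restrict_scalars A X\<^esub> = \<zero>\<^bsub>X\<^esub>"
  "x \<oplus>\<^bsub>restrict_scalars A X\<^esub> y = x \<oplus>\<^bsub>X\<^esub> y"
  "r \<odot>\<^bsub>restrict_scalars A X\<^esub> x = (r \<odot>\<^bsub>A\<^esub> \<one>\<^bsub>A\<^esub>) \<odot>\<^bsub>X\<^esub> x"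
  by (simp_all add: restrict_scalars_def)

lemma coalgebra_left_module_simps [simp]:
  "carrier (coalgebra_left_module R C p) = carrier C"
  "\<zero>\<^bsub>coalgebra_left_module R C p\<^esub> = \<zero>\<^bsub>C\<^esub>"
  "x \<oplus>\<^bsub>coalgebra_left_module R C p\<^esub> y = x \<oplus>\<^bsub>C\<^esub> y"
  "a \<odot>\<^bsub>coalgebra_left_module R C p\<^esub> x = left_action R C p a x"
  by (simp_all add: coalgebra_left_module_def)

context locally_projective_pairing
begin

lemma scalar_mult:
  assumes "r \<in> carrier R" "a \<in> carrier A"
  shows "(r \<odot>\<^bsub>A\<^esub> \<one>\<^bsub>A\<^esub>) \<otimes>\<^bsub>A\<^esub> a = r \<odot>\<^bsub>A\<^esub> a" "a \<otimes>\<^bsub>A\<^esub> (r \<odot>\<^bsub>A\<^esub> \<one>\<^bsub>A\<^esub>) = r \<odot>\<^bsub>A\<^esub> a"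
  using assms by (simp_all add: smult_mult_left smult_mult_right)

lemma restrict_left_module:
  assumes "left_module A X"
  shows "left_module R (restrict_scalars A X)"
proof -
  interpret X: left_module A X by fact
  show ?thesis
  proof (intro left_module.intro left_module_axioms.intro R.ring_axioms abelian_groupI)
    show "\<exists>y\<in>carrier (restrict_scalars A X). y \<oplus>\<^bsub>restrict_scalars A X\<^esub> x = \<zero>\<^bsub>restrict_scalars A X\<^esub>"
      if "x \<in> carrier (restrict_scalars A X)" for x
      using that X.X.l_neg by (auto intro!: bexI[of _ "\<ominus>\<^bsub>X\<^esub> x"])
    fix r s x assume "r \<in> carrier R" "s \<in> carrier R" "x \<in> carrier (restrict_scalars A X)"
    then show "(r \<otimes> s) \<odot>\<^bsub>restrict_scalars A X\<^esub> x =
        r \<odot>\<^bsub>restrict_scalars A X\<^esub> (s \<odot>\<^bsub>restrict_scalars A X\<^esub> x)"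
      by (simp add: AR.act_assoc scalar_mult(1) AR.act_closed flip: X.act_assoc)
  qed (auto simp: X.act_closed X.act_l_distr X.act_r_distr X.X.a_ac AR.act_closed AR.act_l_distr
      AR.act_one X.act_one)
qed

lemma orbit_linear_map:
  assumes "left_module A X" and x: "x \<in> carrier X"
  shows "linear_map R A (restrict_scalars A X) (\<lambda>a. a \<odot>\<^bsub>X\<^esub> x)"
proof -
  interpret X: left_module A X by fact
  show ?thesis
    by (intro linear_map.intro linear_map_axioms.intro AR.left_module_axioms restrict_left_module
        assms linear_mapsI)
      (use x in \<open>simp_all add: X.act_closed X.act_l_distr scalar_mult AR.act_closed flip: X.act_assoc\<close>)
qed

lemma action_linear_map:
  assumes "left_module A X" and a: "a \<in> carrier A"
  shows "linear_map R (restrict_scalars A X) (restrict_scalars A X) (\<lambda>x. a \<odot>\<^bsub>X\<^esub> x)"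
proof -
  interpret X: left_module A X by fact
  show ?thesis
    by (intro linear_map.intro linear_map_axioms.intro restrict_left_module assms linear_mapsI)
      (use a in \<open>simp_all add: X.act_closed X.act_r_distr scalar_mult AR.act_closed flip: X.act_assoc\<close>)
qed

lemma fg_orbitI:
  assumes X: "left_module A X" and x: "x \<in> carrier X"
    and N: "N \<subseteq> carrier A" "\<And>a. a \<in> N \<Longrightarrow> a \<odot>\<^bsub>X\<^esub> x = \<zero>\<^bsub>X\<^esub>"
    and Z: "finite Z" "Z \<subseteq> carrier A" "submodule_span R A (N \<union> Z) = carrier A"
  shows "fg_submodule R (restrict_scalars A X) {a \<odot>\<^bsub>X\<^esub> x | a. a \<in> carrier A}"
proof -
  interpret f: linear_map R A "restrict_scalars A X" "\<lambda>a. a \<odot>\<^bsub>X\<^esub> x" by (rule orbit_linear_map[OF X x])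
  let ?S = "(\<lambda>a. a \<odot>\<^bsub>X\<^esub> x) ` (N \<union> Z)"
  have "?S \<subseteq> {\<zero>\<^bsub>X\<^esub>} \<union> (\<lambda>a. a \<odot>\<^bsub>X\<^esub> x) ` Z" using N(2) by auto
  then have "finite ?S" by (rule finite_subset) (use Z(1) in simp)
  moreover have "?S \<subseteq> carrier (restrict_scalars A X)" using f.closed N(1) Z(2) by auto
  moreover have "{a \<odot>\<^bsub>X\<^esub> x | a. a \<in> carrier A} = submodule_span R (restrict_scalars A X) ?S"
    using f.image_span[of "N \<union> Z"] N(1) Z(2) by (auto simp: Z(3))
  ultimately show ?thesis unfolding fg_submodule_def by (intro exI[of _ ?S]) simp
qed

text \<open>Equivalently, \<open>a \<mapsto> a x\<close> is continuous for the linear weak topology on \<open>A\<close> and the discrete topology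
  on \<open>X\<close>. Modules all of whose elements have this property are compared below with rational modules,
  with locally finite modules and with \<open>\<sigma>[C]\<close>.\<close>

definition discrete_element :: "('a, 'x, 'l) module_scheme \<Rightarrow> 'x \<Rightarrow> bool" where
  "discrete_element X x \<longleftrightarrow>
     (\<exists>T. finite T \<and> T \<subseteq> carrier C \<and> (\<forall>a\<in>perp T. a \<odot>\<^bsub>X\<^esub> x = \<zero>\<^bsub>X\<^esub>))"

lemma discrete_imp_locally_finite:
  assumes "noetherian_ring R" "left_module A X" "\<And>x. x \<in> carrier X \<Longrightarrow> discrete_element X x"
  shows "locally_finite R A X"
  unfolding locally_finite_def
proof
  fix x assume x: "x \<in> carrier X"
  then obtain T where T: "finite T" "T \<subseteq> carrier C" "\<forall>a\<in>perp T. a \<odot>\<^bsub>X\<^esub> x = \<zero>\<^bsub>X\<^esub>"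
    using assms(3) unfolding discrete_element_def by blast
  obtain Z where Z: "finite Z" "Z \<subseteq> carrier A" "submodule_span R A (perp T \<union> Z) = carrier A"
    using perp_cofinite[OF assms(1) T(1,2)] by blast
  show "fg_submodule R (restrict_scalars A X) {a \<odot>\<^bsub>X\<^esub> x | a. a \<in> carrier A}"
    by (rule fg_orbitI[OF assms(2) x _ _ Z]) (use T(3) in \<open>auto simp: perp_def\<close>)
qed

text \<open>If \<open>A x\<close> is generated over \<open>R\<close> by the finite set \<open>S\<close>, then \<open>a (A x) = 0\<close> holds already if \<open>a S = 0\<close>, because
  the action of \<open>a\<close> is \<open>R\<close>-linear. So the annihilator of \<open>A x\<close> is the common kernel of the
  finitely many maps \<open>a \<mapsto> a s\<close> into the finitely generated module \<open>A x\<close>.\<close>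

lemma annihilator_cofinite:
  assumes noeth: "noetherian_ring R" and X: "left_module A X" and x: "x \<in> carrier X"
    and fg: "fg_submodule R (restrict_scalars A X) {a \<odot>\<^bsub>X\<^esub> x | a. a \<in> carrier A}"
  shows "cofinite_ideal R A {a \<in> carrier A. \<forall>b\<in>carrier A. a \<odot>\<^bsub>X\<^esub> (b \<odot>\<^bsub>X\<^esub> x) = \<zero>\<^bsub>X\<^esub>}"
    (is "cofinite_ideal R A ?I")
proof -
  interpret X: left_module A X by (rule X)
  let ?Y = "restrict_scalars A X"
  interpret Y: left_module R ?Y by (rule restrict_left_module[OF X])
  obtain S where S: "finite S" "S \<subseteq> carrier X"
    and sp: "{a \<odot>\<^bsub>X\<^esub> x | a. a \<in> carrier A} = submodule_span R ?Y S"
    using fg by (auto simp: fg_submodule_def)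
  have orb: "s \<in> S \<Longrightarrow> \<exists>b\<in>carrier A. s = b \<odot>\<^bsub>X\<^esub> x" for s
    using span_superset[of S R ?Y] unfolding sp[symmetric] by blast
  have I_eq: "?I = {a \<in> carrier A. \<forall>s\<in>S. a \<odot>\<^bsub>X\<^esub> s = \<zero>\<^bsub>X\<^esub>}"
  proof (intro Collect_cong conj_cong refl iffI ballI)
    fix a s assume "\<forall>b\<in>carrier A. a \<odot>\<^bsub>X\<^esub> (b \<odot>\<^bsub>X\<^esub> x) = \<zero>\<^bsub>X\<^esub>" "s \<in> S"
    then show "a \<odot>\<^bsub>X\<^esub> s = \<zero>\<^bsub>X\<^esub>" using orb by blast
  next
    fix a b assume a: "a \<in> carrier A" "\<forall>s\<in>S. a \<odot>\<^bsub>X\<^esub> s = \<zero>\<^bsub>X\<^esub>" and b: "b \<in> carrier A"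
    interpret a: linear_map R ?Y ?Y "\<lambda>y. a \<odot>\<^bsub>X\<^esub> y" by (rule action_linear_map[OF X a(1)])
    have "submodule_span R ?Y S \<subseteq> {y \<in> carrier ?Y. a \<odot>\<^bsub>X\<^esub> y = \<zero>\<^bsub>?Y\<^esub>}"
      using a(2) S(2) by (intro span_least a.kernel_submodule) auto
    then show "a \<odot>\<^bsub>X\<^esub> (b \<odot>\<^bsub>X\<^esub> x) = \<zero>\<^bsub>X\<^esub>" unfolding sp[symmetric] using b by auto
  qed
  have "ideal ?I A"
  proof (rule idealI[OF A.ring_axioms])
    show "subgroup ?I (add_monoid A)"
    proof (rule submodule.axioms(1), rule AR.submoduleI)
      show "r \<odot>\<^bsub>A\<^esub> a \<in> ?I" if r: "r \<in> carrier R" and a: "a \<in> ?I" for r a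
      proof -
        have "(r \<odot>\<^bsub>A\<^esub> a) \<odot>\<^bsub>X\<^esub> (b \<odot>\<^bsub>X\<^esub> x) = (r \<odot>\<^bsub>A\<^esub> \<one>\<^bsub>A\<^esub>) \<odot>\<^bsub>X\<^esub> (a \<odot>\<^bsub>X\<^esub> (b \<odot>\<^bsub>X\<^esub> x))" if "b \<in> carrier A" for b
          using X.act_assoc[of "r \<odot>\<^bsub>A\<^esub> \<one>\<^bsub>A\<^esub>" a "b \<odot>\<^bsub>X\<^esub> x"] r a that x
          by (simp add: scalar_mult AR.act_closed X.act_closed)
        then show ?thesis using r a by (simp add: AR.act_closed)
      qed
    qed (auto simp: X.act_l_distr X.act_closed x)
  next
    fix a y assume a: "a \<in> ?I" and y: "y \<in> carrier A"
    show "y \<otimes>\<^bsub>A\<^esub> a \<in> ?I" using a y x by (simp add: X.act_assoc X.act_closed)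
    have "(a \<otimes>\<^bsub>A\<^esub> y) \<odot>\<^bsub>X\<^esub> (b \<odot>\<^bsub>X\<^esub> x) = a \<odot>\<^bsub>X\<^esub> ((y \<otimes>\<^bsub>A\<^esub> b) \<odot>\<^bsub>X\<^esub> x)" if "b \<in> carrier A" for b
      using a y x that by (simp add: X.act_assoc X.act_closed)
    then show "a \<otimes>\<^bsub>A\<^esub> y \<in> ?I" using a y by simp
  qed
  moreover have "\<exists>Z. finite Z \<and> Z \<subseteq> carrier A \<and>
      carrier A \<subseteq> submodule_span R A ({a \<in> carrier A. \<forall>s\<in>S. a \<odot>\<^bsub>X\<^esub> s = \<zero>\<^bsub>?Y\<^esub>} \<union> Z)"
  proof (rule kernels_cofinite[OF R.is_cring noeth S(1)])
    fix s assume s: "s \<in> S"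
    then show "linear_map R A ?Y (\<lambda>a. a \<odot>\<^bsub>X\<^esub> s)" using S(2) by (intro orbit_linear_map[OF X]) auto
    obtain b where b: "b \<in> carrier A" "s = b \<odot>\<^bsub>X\<^esub> x" using orb[OF s] by blast
    have "(\<lambda>a. a \<odot>\<^bsub>X\<^esub> s) ` carrier A \<subseteq> {a \<odot>\<^bsub>X\<^esub> x | a. a \<in> carrier A}"
      using b x by (auto simp flip: X.act_assoc)
    then show "\<exists>S. finite S \<and> S \<subseteq> carrier ?Y \<and> (\<lambda>a. a \<odot>\<^bsub>X\<^esub> s) ` carrier A \<subseteq> submodule_span R ?Y S"
      using S unfolding sp by (intro exI[of _ S]) simp
  qed (rule AR.left_module_axioms AR.carrier_submodule)+
  then obtain Z where Z: "finite Z" "Z \<subseteq> carrier A" "carrier A \<subseteq> submodule_span R A (?I \<union> Z)"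
    unfolding I_eq by auto
  moreover have "submodule_span R A (?I \<union> Z) \<subseteq> carrier A"
    by (rule AR.span_subset_carrier) (use Z(2) in auto)
  ultimately show ?thesis unfolding cofinite_ideal_iff by (intro conjI exI[of _ Z] equalityI)
qed

lemma coreflexive_imp_discrete:
  assumes noeth: "noetherian_ring R" and cor: "coreflexive R A C p" and X: "left_module A X"
    and lf: "locally_finite R A X" and x: "x \<in> carrier X"
  shows "discrete_element X x"
proof -
  interpret X: left_module A X by (rule X)
  have "fg_submodule R (restrict_scalars A X) {a \<odot>\<^bsub>X\<^esub> x | a. a \<in> carrier A}"
    using lf x by (simp add: locally_finite_def)
  from annihilator_cofinite[OF noeth X x this] obtain T where T: "finite T" "T \<subseteq> carrier C"
    "perp T \<subseteq> {a \<in> carrier A. \<forall>b\<in>carrier A. a \<odot>\<^bsub>X\<^esub> (b \<odot>\<^bsub>X\<^esub> x) = \<zero>\<^bsub>X\<^esub>}"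
    using cor unfolding coreflexive_iff[OF noeth] by blast
  have "a \<odot>\<^bsub>X\<^esub> (\<one>\<^bsub>A\<^esub> \<odot>\<^bsub>X\<^esub> x) = \<zero>\<^bsub>X\<^esub>" if "a \<in> perp T" for a
    using T(3) that A.one_closed by blast
  then show ?thesis unfolding discrete_element_def using T x by (intro exI[of _ T]) (simp add: X.act_one)
qed

text \<open>The test modules for the converse directions are the cyclic modules \<open>A/I\<close>, with the class of \<open>1\<close> as
  the element \<open>x\<close>.\<close>

lemma cyclic_module:
  assumes I: "cofinite_ideal R A I"
  shows "left_module A (quotient_module (regular_module A) I)" (is "left_module A ?X")
    and "locally_finite R A (quotient_module (regular_module A) I)"
    and "\<exists>x\<in>carrier (quotient_module (regular_module A) I). \<forall>a\<in>carrier A.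
      a \<odot>\<^bsub>quotient_module (regular_module A) I\<^esub> x = \<zero>\<^bsub>quotient_module (regular_module A) I\<^esub> \<longrightarrow> a \<in> I"
proof -
  have Ii: "ideal I A" using I by (simp add: cofinite_ideal_def)
  interpret I: ideal I A by (rule Ii)
  interpret M: left_module A "regular_module A" by (rule A.regular_left_module)
  have Is: "submodule I A (regular_module A)"
    by (rule M.submoduleI)
      (use I.a_subset I.a_closed additive_subgroup.zero_closed[OF I.is_additive_subgroup] I.I_l_closed in auto)
  show X: "left_module A ?X" by (rule M.quotient_left_module[OF Is])
  have act: "a \<odot>\<^bsub>?X\<^esub> (I +>\<^bsub>regular_module A\<^esub> b) = I +>\<^bsub>regular_module A\<^esub> (a \<otimes>\<^bsub>A\<^esub> b)"
    if "a \<in> carrier A" "b \<in> carrier A" for a b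
    using M.quotient_smult[OF Is, of a b] that by simp
  have zero: "I +>\<^bsub>regular_module A\<^esub> b = \<zero>\<^bsub>?X\<^esub> \<longleftrightarrow> b \<in> I" if "b \<in> carrier A" for b
    using M.coset_eq_self_iff[OF Is, of b] that by (simp add: M.quotient_zero)
  obtain Z where Z: "finite Z" "Z \<subseteq> carrier A" "submodule_span R A (I \<union> Z) = carrier A"
    using I cofinite_ideal_iff by auto
  show "locally_finite R A ?X"
    unfolding locally_finite_def
  proof
    fix x assume x: "x \<in> carrier ?X"
    then obtain b where b: "b \<in> carrier A" "x = I +>\<^bsub>regular_module A\<^esub> b" by (auto simp: M.quotient_carrier)
    show "fg_submodule R (restrict_scalars A ?X) {a \<odot>\<^bsub>?X\<^esub> x | a. a \<in> carrier A}"
      by (rule fg_orbitI[OF X x _ _ Z]) (use I.a_subset I.I_r_closed act zero b in auto)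
  qed
  have "I +>\<^bsub>regular_module A\<^esub> \<one>\<^bsub>A\<^esub> \<in> carrier ?X" by (simp add: M.quotient_carrier)
  then show "\<exists>x\<in>carrier ?X. \<forall>a\<in>carrier A. a \<odot>\<^bsub>?X\<^esub> x = \<zero>\<^bsub>?X\<^esub> \<longrightarrow> a \<in> I"
    using act[of _ "\<one>\<^bsub>A\<^esub>"] zero by (intro bexI[of _ "I +>\<^bsub>regular_module A\<^esub> \<one>\<^bsub>A\<^esub>"]) auto
qed

lemma locally_finite_discrete_imp_coreflexive:
  assumes noeth: "noetherian_ring R"
    and disc: "\<And>(X :: ('a, 'a set) module) x.
      left_module A X \<Longrightarrow> locally_finite R A X \<Longrightarrow> x \<in> carrier X \<Longrightarrow> discrete_element X x"
  shows "coreflexive R A C p"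
  unfolding coreflexive_iff[OF noeth]
proof (intro allI impI)
  fix I assume I: "cofinite_ideal R A I"
  let ?X = "quotient_module (regular_module A) I"
  obtain x where x: "x \<in> carrier ?X" "\<And>a. a \<in> carrier A \<Longrightarrow> a \<odot>\<^bsub>?X\<^esub> x = \<zero>\<^bsub>?X\<^esub> \<Longrightarrow> a \<in> I"
    using cyclic_module(3)[OF I] by blast
  obtain T where "finite T" "T \<subseteq> carrier C" "\<forall>a\<in>perp T. a \<odot>\<^bsub>?X\<^esub> x = \<zero>\<^bsub>?X\<^esub>"
    using disc[OF cyclic_module(1,2)[OF I] x(1)] by (auto simp: discrete_element_def)
  then show "\<exists>T. finite T \<and> T \<subseteq> carrier C \<and> perp T \<subseteq> I"
    using x(2) by (intro exI[of _ T]) (auto simp: perp_def)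
qed

end

context measuring_alpha_pairing
begin

sublocale lp: locally_projective_pairing R A C p by (rule locally_projective_pairing)

text \<open>An element \<open>x\<close> satisfies the rationality condition if and only if \<open>a \<mapsto> a x\<close> is a rational map.\<close>

lemma rational_iff_discrete:
  assumes X: "left_module A X"
  shows "rational R A C p X \<longleftrightarrow> (\<forall>x\<in>carrier X. lp.discrete_element X x)"
proof -
  let ?Y = "restrict_scalars A X"
  note Y = lp.restrict_left_module[OF X]
  have "(\<exists>u\<in>carrier (tensor R ?Y C). \<forall>a\<in>carrier A. a \<odot>\<^bsub>X\<^esub> x = alpha_map R A C p ?Y u a) \<longleftrightarrow>
      lp.discrete_element X x" if x: "x \<in> carrier X" for x
  proof -
    define f where "f = (\<lambda>a\<in>carrier A. a \<odot>\<^bsub>X\<^esub> x)"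
    interpret o: linear_map R A ?Y "\<lambda>a. a \<odot>\<^bsub>X\<^esub> x" by (rule lp.orbit_linear_map[OF X x])
    have fl: "f \<in> linear_maps R A ?Y"
      unfolding f_def using o.closed o.add o.smult lp.AR.act_closed by (intro linear_mapsI) auto
    have fe: "f \<in> extensional (carrier A)" by (simp add: f_def)
    have ext: "alpha_map R A C p ?Y u \<in> extensional (carrier A)" if "u \<in> carrier (tensor R ?Y C)" for u
    proof -
      have "alpha_map R A C p ?Y u \<in> rational_maps R A C p ?Y"
        using that alpha_map_range[OF Y] by blast
      then show ?thesis using submodule_subset[OF lp.rational_maps_submodule[OF Y]] by auto
    qed
    have "(\<forall>a\<in>carrier A. a \<odot>\<^bsub>X\<^esub> x = alpha_map R A C p ?Y u a) \<longleftrightarrow> f = alpha_map R A C p ?Y u"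
      if "u \<in> carrier (tensor R ?Y C)" for u
    proof
      assume "\<forall>a\<in>carrier A. a \<odot>\<^bsub>X\<^esub> x = alpha_map R A C p ?Y u a"
      then show "f = alpha_map R A C p ?Y u"
        by (intro extensionalityI[OF fe ext[OF that]]) (simp add: f_def)
    next
      assume "f = alpha_map R A C p ?Y u"
      then have "f a = alpha_map R A C p ?Y u a" for a by simp
      then show "\<forall>a\<in>carrier A. a \<odot>\<^bsub>X\<^esub> x = alpha_map R A C p ?Y u a"
        unfolding f_def by (metis restrict_apply')
    qed
    then have "(\<exists>u\<in>carrier (tensor R ?Y C). \<forall>a\<in>carrier A. a \<odot>\<^bsub>X\<^esub> x = alpha_map R A C p ?Y u a) \<longleftrightarrow>
        f \<in> rational_maps R A C p ?Y"
      using alpha_map_range[OF Y] by blast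
    also have "\<dots> \<longleftrightarrow> lp.discrete_element X x"
      unfolding lp.rational_maps_iff[OF Y fl fe] lp.discrete_element_def by (auto simp: f_def lp.perp_def)
    finally show ?thesis .
  qed
  then show ?thesis by (simp add: rational_def)
qed

text \<open>The axioms for the action are tested against the elements of \<open>A\<close>, where they become laws of the ring \<open>A\<close>.\<close>

lemma coalgebra_left_module_axioms: "left_module A (coalgebra_left_module R C p)"
proof (intro left_module.intro left_module_axioms.intro ring_A)
  interpret A: ring A by (rule ring_A)
  let ?L = "coalgebra_left_module R C p"
  note C_group = left_module.axioms(2)[OF left_module_C]
  note C_monoid = abelian_group.axioms(1)[OF C_group]
  show "abelian_group ?L"
  proof (rule abelian_groupI)
    show "\<exists>y\<in>carrier ?L. y \<oplus>\<^bsub>?L\<^esub> x = \<zero>\<^bsub>?L\<^esub>" if "x \<in> carrier ?L" for x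
      using that abelian_group.l_neg[OF C_group] abelian_group.a_inv_closed[OF C_group]
      by (auto intro!: bexI[of _ "\<ominus>\<^bsub>C\<^esub> x"])
  qed (simp_all add: abelian_monoid.a_closed[OF C_monoid] abelian_monoid.zero_closed[OF C_monoid]
      abelian_monoid.l_zero[OF C_monoid] abelian_monoid.a_assoc[OF C_monoid] abelian_monoid.a_comm[OF C_monoid]
      abelian_monoid.a_lcomm[OF C_monoid])
  fix a b x y assume a: "a \<in> carrier A" and b: "b \<in> carrier A" and x: "x \<in> carrier ?L" and y: "y \<in> carrier ?L"
  show "a \<odot>\<^bsub>?L\<^esub> x \<in> carrier ?L" using a x by (simp add: left_action)
  show "(a \<oplus>\<^bsub>A\<^esub> b) \<odot>\<^bsub>?L\<^esub> x = a \<odot>\<^bsub>?L\<^esub> x \<oplus>\<^bsub>?L\<^esub> b \<odot>\<^bsub>?L\<^esub> x"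
    using a b x by (auto intro!: lp.separating simp: left_action p_add_right p_add_left A.r_distr)
  show "a \<odot>\<^bsub>?L\<^esub> (x \<oplus>\<^bsub>?L\<^esub> y) = a \<odot>\<^bsub>?L\<^esub> x \<oplus>\<^bsub>?L\<^esub> a \<odot>\<^bsub>?L\<^esub> y"
    using a x y by (auto intro!: lp.separating simp: left_action p_add_right)
  show "(a \<otimes>\<^bsub>A\<^esub> b) \<odot>\<^bsub>?L\<^esub> x = a \<odot>\<^bsub>?L\<^esub> (b \<odot>\<^bsub>?L\<^esub> x)"
    using a b x by (auto intro!: lp.separating simp: left_action A.m_assoc)
next
  interpret A: ring A by (rule ring_A)
  show "\<one>\<^bsub>A\<^esub> \<odot>\<^bsub>coalgebra_left_module R C p\<^esub> x = x" if "x \<in> carrier (coalgebra_left_module R C p)" for x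
    using that by (auto intro!: lp.separating simp: left_action)
qed

lemma left_action_discrete:
  assumes "c \<in> carrier C"
  shows "\<exists>T. finite T \<and> T \<subseteq> carrier C \<and> (\<forall>a\<in>lp.perp T. left_action R C p a c = \<zero>\<^bsub>C\<^esub>)"
proof -
  obtain T where T: "finite T" "T \<subseteq> carrier C"
    "\<forall>a\<in>carrier A. \<forall>b\<in>carrier A. (\<forall>t\<in>T. p b t = \<zero>) \<longrightarrow> p (a \<otimes>\<^bsub>A\<^esub> b) c = \<zero>"
    using lp.mult_continuous_right[OF assms] by blast
  have "left_action R C p a c = \<zero>\<^bsub>C\<^esub>" if "a \<in> lp.perp T" for a
    using that T(3) assms by (intro lp.nondegenerate) (auto simp: left_action lp.perp_def)
  then show ?thesis using T by blast
qed

text \<open>A representative in \<open>C\<^bsup>(I)\<^esup>\<close> of the image of \<open>x\<close> has finitely many nonzero entries, each killed by the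
  annihilator of a finite set.\<close>

lemma subgenerated_imp_discrete:
  fixes X :: "('a, 'x, 'l) module_scheme"
  assumes X: "left_module A X" and sg: "subgenerated_by A (coalgebra_left_module R C p) X"
    and x: "x \<in> carrier X"
  shows "lp.discrete_element X x"
proof -
  let ?L = "coalgebra_left_module R C p"
  interpret X: left_module A X by (rule X)
  interpret L: left_module A ?L by (rule coalgebra_left_module_axioms)
  obtain I :: "('x \<times> nat) set" and K h where K: "submodule K A (copower_module I ?L)"
    and h: "h \<in> linear_maps A X (quotient_module (copower_module I ?L) K)" and inj: "inj_on h (carrier X)"
    using sg unfolding subgenerated_by_def by blast
  interpret CP: left_module A "copower_module I ?L" by (rule L.copower_left_module)
  interpret h: linear_map A X "quotient_module (copower_module I ?L) K" h
    by (intro linear_map.intro linear_map_axioms.intro X CP.quotient_left_module K h)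
  obtain g where g: "g \<in> carrier (copower_module I ?L)" "h x = K +>\<^bsub>copower_module I ?L\<^esub> g"
    using h.closed[OF x] by (auto simp: CP.quotient_carrier)
  let ?S = "{i \<in> I. g i \<noteq> \<zero>\<^bsub>C\<^esub>}"
  have gc: "g i \<in> carrier C" if "i \<in> I" for i using g(1) that by auto
  have fin: "finite ?S" using g(1) by simp
  obtain T where T: "\<And>i. i \<in> I \<Longrightarrow> finite (T i)" "\<And>i. i \<in> I \<Longrightarrow> T i \<subseteq> carrier C"
    "\<And>i a. i \<in> I \<Longrightarrow> a \<in> lp.perp (T i) \<Longrightarrow> left_action R C p a (g i) = \<zero>\<^bsub>C\<^esub>"
    using left_action_discrete[OF gc] by metis
  define U where "U = (\<Union>i\<in>?S. T i)"
  have "a \<odot>\<^bsub>X\<^esub> x = \<zero>\<^bsub>X\<^esub>" if a: "a \<in> lp.perp U" for a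
  proof -
    have ac: "a \<in> carrier A" using a by (simp add: lp.perp_def)
    have "left_action R C p a (g i) = \<zero>\<^bsub>C\<^esub>" if i: "i \<in> I" for i
    proof (cases "g i = \<zero>\<^bsub>C\<^esub>")
      case True
      then show ?thesis using L.act_r_null[OF ac] by simp
    next
      case False
      then have "a \<in> lp.perp (T i)" using a i unfolding lp.perp_def U_def by blast
      then show ?thesis by (rule T(3)[OF i])
    qed
    then have "a \<odot>\<^bsub>copower_module I ?L\<^esub> g = \<zero>\<^bsub>copower_module I ?L\<^esub>" by auto
    then have "h (a \<odot>\<^bsub>X\<^esub> x) = K +>\<^bsub>copower_module I ?L\<^esub> \<zero>\<^bsub>copower_module I ?L\<^esub>"
      using h.smult[OF ac x] CP.quotient_smult[OF K ac g(1)] g(2) by simp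
    also have "\<dots> = h \<zero>\<^bsub>X\<^esub>"
      using h.zero CP.coset_eq_self_iff[OF K CP.X.zero_closed] submodule_zero[OF K]
      by (simp only: CP.quotient_zero)
    finally show ?thesis using inj_onD[OF inj] X.act_closed[OF ac x] by blast
  qed
  moreover have "finite U" "U \<subseteq> carrier C" using T(1,2) fin unfolding U_def by blast+
  ultimately show ?thesis unfolding lp.discrete_element_def by blast
qed

text \<open>The coaction embeds \<open>X\<close> in \<open>X \<otimes> C\<close>, which is a quotient of a direct sum of copies of \<open>C\<close>, one copy for each element
  of \<open>X\<close>. Without tensor products: let \<open>\<Phi>\<close> send a family \<open>g\<close> in this direct sum to the map
  \<open>a \<mapsto> \<Sum> \<langle>a, g y\<rangle> y\<close>. Then \<open>\<Phi> (a g) b = \<Phi> g (b a)\<close>, so the kernel \<open>K\<close> of \<open>\<Phi>\<close> is an \<open>A\<close>-submodule. The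
  image of \<open>\<Phi>\<close> consists of the rational maps and therefore contains all orbit maps
  \<open>a \<mapsto> a x\<close>; sending \<open>x\<close> to the fibre of \<open>\<Phi>\<close> over its orbit map is the desired embedding.\<close>

lemma discrete_imp_subgenerated:
  fixes X :: "('a, 'x, 'l) module_scheme"
  assumes X: "left_module A X" and disc: "\<And>x. x \<in> carrier X \<Longrightarrow> lp.discrete_element X x"
  shows "subgenerated_by A (coalgebra_left_module R C p) X"
proof -
  let ?L = "coalgebra_left_module R C p" and ?Y = "restrict_scalars A X"
  define I where "I = carrier X \<times> {0::nat}"
  let ?CA = "copower_module I ?L" and ?CR = "copower_module I C" and ?H = "Hom_module R A ?Y"
  note Y = lp.restrict_left_module[OF X]
  note H = Hom_left_module[OF cring_R left_module_A Y]
  interpret X: left_module A X by (rule X)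
  interpret A: ring A by (rule ring_A)
  interpret AR: left_module R A by (rule left_module_A)
  interpret L: left_module A ?L by (rule coalgebra_left_module_axioms)
  interpret CA: left_module A ?CA by (rule L.copower_left_module)
  interpret CR: left_module R ?CR by (rule left_module.copower_left_module[OF left_module_C])
  interpret Y: left_module R ?Y by (rule Y)
  define l where "l i c = (\<lambda>a\<in>carrier A. p a c \<odot>\<^bsub>?Y\<^esub> fst i)" for i :: "'x \<times> nat" and c
  have l: "linear_map R C ?H (l i)" if "i \<in> I" for i
  proof -
    interpret b: bilinear_map R ?Y C ?H "\<lambda>x c. \<lambda>a\<in>carrier A. p a c \<odot>\<^bsub>?Y\<^esub> x" by (rule alpha_bilinear[OF Y])
    have i: "fst i \<in> carrier ?Y" using that by (auto simp: I_def)
    show ?thesis unfolding l_def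
      by (intro linear_map.intro linear_map_axioms.intro left_module_C H linear_mapsI)
        (rule b.b_closed[OF i] b.b_add_right[OF i] b.b_smult_right[OF _ i]; assumption)+
  qed
  define \<Phi> where "\<Phi> = copower_lift C ?H I l"
  have "linear_map R ?CR ?H \<Phi>"
    unfolding \<Phi>_def by (rule copower_lift_linear_map[OF cring_R left_module_C H l])
  then interpret \<Phi>: linear_map R ?CR ?H \<Phi> .
  have car: "carrier ?CA = carrier ?CR" "\<And>g g'. g \<oplus>\<^bsub>?CA\<^esub> g' = g \<oplus>\<^bsub>?CR\<^esub> g'" "\<zero>\<^bsub>?CA\<^esub> = \<zero>\<^bsub>?CR\<^esub>"
    by simp_all
  have \<Phi>_eval: "\<Phi> g a = copower_lift C ?Y I (\<lambda>i c. l i c a) g" if "g \<in> carrier ?CR" "a \<in> carrier A" for g a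
  proof -
    have "linear_map R ?H ?Y (\<lambda>f. f a)"
      by (intro linear_map.intro linear_map_axioms.intro H Y linear_mapsI)
        (use that(2) linear_closed[of _ R A ?Y a] in auto)
    from copower_lift_compose[OF left_module_C H l this that(1)] show ?thesis unfolding \<Phi>_def .
  qed
  have l_eval: "linear_map R C ?Y (\<lambda>c. l i c a)" if "i \<in> I" "a \<in> carrier A" for i a
    using linear_map.add[OF l[OF that(1)]] linear_map.smult[OF l[OF that(1)]] linear_map.closed[OF l[OF that(1)]]
    by (intro linear_map.intro linear_map_axioms.intro left_module_C Y linear_mapsI)
      (use that(2) linear_closed[of _ R A ?Y a] in \<open>auto simp: fun_eq_iff\<close>)
  have \<Phi>_act: "\<Phi> (a \<odot>\<^bsub>?CA\<^esub> g) b = \<Phi> g (b \<otimes>\<^bsub>A\<^esub> a)"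
    if g: "g \<in> carrier ?CR" and ab: "a \<in> carrier A" "b \<in> carrier A" for a b g
  proof -
    let ?Q = "{i \<in> I. g i \<noteq> \<zero>\<^bsub>C\<^esub>}"
    have gc: "g i \<in> carrier C" if "i \<in> I" for i using g that by auto
    have Q: "finite ?Q" "?Q \<subseteq> I" using g by auto
    have ag: "a \<odot>\<^bsub>?CA\<^esub> g \<in> carrier ?CR" using CA.act_closed[OF ab(1)] g car(1) by blast
    have supp: "{i \<in> I. (a \<odot>\<^bsub>?CA\<^esub> g) i \<noteq> \<zero>\<^bsub>C\<^esub>} \<subseteq> ?Q"
      using L.act_r_null[OF ab(1)] by auto
    have "\<Phi> (a \<odot>\<^bsub>?CA\<^esub> g) b = (\<Oplus>\<^bsub>?Y\<^esub>i\<in>?Q. l i ((a \<odot>\<^bsub>?CA\<^esub> g) i) b)"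
      unfolding \<Phi>_eval[OF ag ab(2)]
      by (rule copower_lift_superset[OF Y l_eval[OF _ ab(2)] _ Q supp]) (use ag in auto)
    also have "\<dots> = (\<Oplus>\<^bsub>?Y\<^esub>i\<in>?Q. l i (g i) (b \<otimes>\<^bsub>A\<^esub> a))"
    proof (rule Y.X.finsum_cong'[OF refl])
      show "(\<lambda>i. l i (g i) (b \<otimes>\<^bsub>A\<^esub> a)) \<in> ?Q \<rightarrow> carrier ?Y"
        using linear_map.closed[OF l_eval gc] ab by blast
      show "l i ((a \<odot>\<^bsub>?CA\<^esub> g) i) b = l i (g i) (b \<otimes>\<^bsub>A\<^esub> a)" if "i \<in> ?Q" for i
        using that gc ab by (simp add: l_def left_action)
    qed
    also have "\<dots> = \<Phi> g (b \<otimes>\<^bsub>A\<^esub> a)"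
      unfolding \<Phi>_eval[OF g A.m_closed[OF ab(2,1)]] copower_lift_def by simp
    finally show ?thesis .
  qed
  define orbit where "orbit x = (\<lambda>a\<in>carrier A. a \<odot>\<^bsub>X\<^esub> x)" for x
  have orbit_range: "orbit x \<in> \<Phi> ` carrier ?CR" if x: "x \<in> carrier X" for x
  proof -
    interpret o: linear_map R A ?Y "\<lambda>a. a \<odot>\<^bsub>X\<^esub> x" by (rule lp.orbit_linear_map[OF X x])
    have fl: "orbit x \<in> linear_maps R A ?Y"
      unfolding orbit_def using o.closed o.add o.smult lp.AR.act_closed by (intro linear_mapsI) auto
    have fe: "orbit x \<in> extensional (carrier A)" by (simp add: orbit_def)
    have "orbit x \<in> rational_maps R A C p ?Y"
      unfolding lp.rational_maps_iff[OF Y fl fe]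
      using disc[OF x] by (auto simp: lp.discrete_element_def orbit_def lp.perp_def)
    moreover have "(\<lambda>a\<in>carrier A. p a c \<odot>\<^bsub>?Y\<^esub> y) \<in> \<Phi> ` carrier ?CR"
      if y: "y \<in> carrier ?Y" and c: "c \<in> carrier C" for y c
    proof -
      have i: "(y, 0) \<in> I" using y by (simp add: I_def)
      let ?g = "\<lambda>j\<in>I. if j = (y, 0) then c else \<zero>\<^bsub>C\<^esub>"
      have "finite {j \<in> I. ?g j \<noteq> \<zero>\<^bsub>C\<^esub>}" by (rule finite_subset[of _ "{(y, 0)}"]) auto
      then have "?g \<in> carrier ?CR" using c left_module.carrier_submodule[OF left_module_C] submodule_zero by auto
      moreover have "\<Phi> ?g = l (y, 0) c"
        unfolding \<Phi>_def by (rule copower_lift_single[OF left_module_C H l i c])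
      ultimately have "l (y, 0) c \<in> \<Phi> ` carrier ?CR" by (metis imageI)
      then show ?thesis by (simp only: l_def fst_conv)
    qed
    then have "rational_maps R A C p ?Y \<subseteq> \<Phi> ` carrier ?CR"
      unfolding rational_maps_def
      by (intro span_least \<Phi>.image_submodule CR.carrier_submodule) blast
    ultimately show ?thesis by blast
  qed
  define K where "K = {g \<in> carrier ?CA. \<Phi> g = \<zero>\<^bsub>?H\<^esub>}"
  have \<Phi>c: "\<Phi> g \<in> carrier ?H" if "g \<in> carrier ?CA" for g
    using \<Phi>.closed that car(1) by blast
  have \<Phi>add: "\<Phi> (g \<oplus>\<^bsub>?CA\<^esub> g') = \<Phi> g \<oplus>\<^bsub>?H\<^esub> \<Phi> g'" if "g \<in> carrier ?CA" "g' \<in> carrier ?CA" for g g'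
    using \<Phi>.add[of g g'] that unfolding car by blast
  have ext: "f = f'" if "f \<in> carrier ?H" "f' \<in> carrier ?H" "\<And>a. a \<in> carrier A \<Longrightarrow> f a = f' a" for f f'
    using that extensionalityI[of f "carrier A" f'] by auto
  have K: "submodule K A ?CA"
  proof (rule CA.submoduleI)
    show "K \<subseteq> carrier ?CA" by (auto simp: K_def)
    show "\<zero>\<^bsub>?CA\<^esub> \<in> K" unfolding K_def using CA.X.zero_closed \<Phi>.zero unfolding car(3) by blast
    show "g \<oplus>\<^bsub>?CA\<^esub> g' \<in> K" if "g \<in> K" "g' \<in> K" for g g'
    proof -
      have "\<Phi> (g \<oplus>\<^bsub>?CA\<^esub> g') = \<zero>\<^bsub>?H\<^esub> \<oplus>\<^bsub>?H\<^esub> \<zero>\<^bsub>?H\<^esub>" using that \<Phi>add unfolding K_def by force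
      then show ?thesis using that CA.X.a_closed \<Phi>.Y.X.l_zero[OF \<Phi>.Y.X.zero_closed] unfolding K_def by force
    qed
    show "a \<odot>\<^bsub>?CA\<^esub> g \<in> K" if a: "a \<in> carrier A" and g: "g \<in> K" for a g
    proof -
      have gc: "g \<in> carrier ?CA" "\<Phi> g = \<zero>\<^bsub>?H\<^esub>" using g by (simp_all only: K_def mem_Collect_eq)
      have ag: "a \<odot>\<^bsub>?CA\<^esub> g \<in> carrier ?CA" by (rule CA.act_closed[OF a gc(1)])
      have "\<Phi> (a \<odot>\<^bsub>?CA\<^esub> g) = \<zero>\<^bsub>?H\<^esub>"
      proof (rule ext[OF \<Phi>c[OF ag] \<Phi>.Y.X.zero_closed])
        fix b assume b: "b \<in> carrier A"
        show "\<Phi> (a \<odot>\<^bsub>?CA\<^esub> g) b = \<zero>\<^bsub>?H\<^esub> b"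
          using \<Phi>_act[of g a b] gc a b unfolding car by simp
      qed
      then show ?thesis using ag unfolding K_def by blast
    qed
  qed
  have coset_eq: "K +>\<^bsub>?CA\<^esub> g = K +>\<^bsub>?CA\<^esub> g' \<longleftrightarrow> \<Phi> g = \<Phi> g'"
    if g: "g \<in> carrier ?CA" and g': "g' \<in> carrier ?CA" for g g'
  proof -
    let ?d = "g \<ominus>\<^bsub>?CA\<^esub> g'"
    have d: "?d \<in> carrier ?CA" using g g' by (rule CA.X.minus_closed)
    have "?d \<oplus>\<^bsub>?CA\<^esub> g' = g"
      using g g' by (simp only: CA.X.minus_eq CA.X.a_assoc CA.X.l_neg CA.X.a_inv_closed CA.X.r_zero)
    then have "\<Phi> g = \<Phi> ?d \<oplus>\<^bsub>?H\<^esub> \<Phi> g'" using \<Phi>add[OF d g'] by metis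
    then have "\<Phi> ?d = \<zero>\<^bsub>?H\<^esub> \<longleftrightarrow> \<Phi> g = \<Phi> g'"
      using \<Phi>c[OF d] \<Phi>c[OF g'] \<Phi>.Y.X.add.r_cancel_one by metis
    then show ?thesis using CA.coset_eq_iff[OF K g g'] d unfolding K_def by blast
  qed
  define g where "g x = (SOME g. g \<in> carrier ?CA \<and> \<Phi> g = orbit x)" for x
  have g: "g x \<in> carrier ?CA" "\<Phi> (g x) = orbit x" if "x \<in> carrier X" for x
  proof -
    have "\<exists>g. g \<in> carrier ?CA \<and> \<Phi> g = orbit x" using orbit_range[OF that] unfolding car by (elim imageE) metis
    from someI_ex[OF this] show "g x \<in> carrier ?CA" "\<Phi> (g x) = orbit x" unfolding g_def by blast+
  qed
  define h where "h x = K +>\<^bsub>?CA\<^esub> g x" for x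
  have "h \<in> linear_maps A X (quotient_module ?CA K)"
  proof (rule linear_mapsI)
    show "h x \<in> carrier (quotient_module ?CA K)" if "x \<in> carrier X" for x
      unfolding h_def CA.quotient_carrier using g(1)[OF that] by blast
    show "h (x \<oplus>\<^bsub>X\<^esub> y) = h x \<oplus>\<^bsub>quotient_module ?CA K\<^esub> h y" if x: "x \<in> carrier X" and y: "y \<in> carrier X" for x y
    proof -
      have "orbit (x \<oplus>\<^bsub>X\<^esub> y) = orbit x \<oplus>\<^bsub>?H\<^esub> orbit y"
        using x y by (auto simp: orbit_def X.act_r_distr)
      then have "\<Phi> (g (x \<oplus>\<^bsub>X\<^esub> y)) = \<Phi> (g x \<oplus>\<^bsub>?CA\<^esub> g y)"
        using g[OF x] g[OF y] g(2)[OF X.X.a_closed[OF x y]] \<Phi>add by metis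
      then have "h (x \<oplus>\<^bsub>X\<^esub> y) = K +>\<^bsub>?CA\<^esub> (g x \<oplus>\<^bsub>?CA\<^esub> g y)"
        unfolding h_def
        by (simp only: coset_eq[OF g(1)[OF X.X.a_closed[OF x y]] CA.X.a_closed[OF g(1)[OF x] g(1)[OF y]]])
      then show ?thesis using CA.quotient_add[OF K g(1)[OF x] g(1)[OF y]] unfolding h_def by metis
    qed
    show "h (a \<odot>\<^bsub>X\<^esub> x) = a \<odot>\<^bsub>quotient_module ?CA K\<^esub> h x" if a: "a \<in> carrier A" and x: "x \<in> carrier X" for a x
    proof -
      have ag: "a \<odot>\<^bsub>?CA\<^esub> g x \<in> carrier ?CA" by (rule CA.act_closed[OF a g(1)[OF x]])
      have ax: "a \<odot>\<^bsub>X\<^esub> x \<in> carrier X" by (rule X.act_closed[OF a x])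
      have "\<Phi> (g (a \<odot>\<^bsub>X\<^esub> x)) = \<Phi> (a \<odot>\<^bsub>?CA\<^esub> g x)"
      proof (rule ext[OF \<Phi>c[OF g(1)[OF ax]] \<Phi>c[OF ag]])
        fix b assume b: "b \<in> carrier A"
        have "\<Phi> (a \<odot>\<^bsub>?CA\<^esub> g x) b = \<Phi> (g x) (b \<otimes>\<^bsub>A\<^esub> a)"
          by (rule \<Phi>_act[OF _ a b]) (use g(1)[OF x] car(1) in blast)
        then show "\<Phi> (g (a \<odot>\<^bsub>X\<^esub> x)) b = \<Phi> (a \<odot>\<^bsub>?CA\<^esub> g x) b"
          using g(2)[OF x] g(2)[OF ax] a b x by (simp add: orbit_def X.act_assoc)
      qed
      then have "h (a \<odot>\<^bsub>X\<^esub> x) = K +>\<^bsub>?CA\<^esub> (a \<odot>\<^bsub>?CA\<^esub> g x)"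
        unfolding h_def by (simp only: coset_eq[OF g(1)[OF ax] ag])
      then show ?thesis using CA.quotient_smult[OF K a g(1)[OF x]] unfolding h_def by metis
    qed
  qed
  moreover have "inj_on h (carrier X)"
  proof (rule inj_onI)
    fix x y assume x: "x \<in> carrier X" and y: "y \<in> carrier X" and eq: "h x = h y"
    have "orbit x = orbit y"
      using coset_eq[OF g(1)[OF x] g(1)[OF y]] eq g(2)[OF x] g(2)[OF y] unfolding h_def by metis
    then have "orbit x \<one>\<^bsub>A\<^esub> = orbit y \<one>\<^bsub>A\<^esub>" by simp
    then show "x = y" using x y by (simp add: orbit_def X.act_one)
  qed
  ultimately show ?thesis unfolding subgenerated_by_def using K by blast
qed

lemma subgenerated_iff_discrete:
  "left_module A X \<Longrightarrow> subgenerated_by A (coalgebra_left_module R C p) X \<longleftrightarrow>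
    (\<forall>x\<in>carrier X. lp.discrete_element X x)"
  using subgenerated_imp_discrete discrete_imp_subgenerated by metis

text \<open>As \<open>\<langle>d, w \<leftharpoonup> a\<rangle> = \<langle>a d, w\<rangle>\<close>, taking \<open>d = 1\<close> shows that \<open>w \<leftharpoonup> a = 0\<close> implies \<open>\<langle>a, w\<rangle> = 0\<close>; conversely
  \<open>w \<leftharpoonup> a = 0\<close> holds once \<open>a\<close> annihilates the finitely many first factors of the comultiplication of \<open>w\<close>.\<close>

lemma right_adic_topology_eq: "linear_weak_topology R A C p = right_adic_topology R A C p"
proof -
  interpret AR: left_module R A by (rule left_module_A)
  interpret A: ring A by (rule ring_A)
  let ?N = "\<lambda>W. {a \<in> carrier A. \<forall>w\<in>W. right_action R C p w a = \<zero>\<^bsub>C\<^esub>}"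
  let ?B = "{?N W | W. finite W \<and> W \<subseteq> carrier C}"
  have zero_iff: "right_action R C p w a = \<zero>\<^bsub>C\<^esub> \<longleftrightarrow> (\<forall>d\<in>carrier A. p (a \<otimes>\<^bsub>A\<^esub> d) w = \<zero>)"
    if "w \<in> carrier C" "a \<in> carrier A" for w a
    using that right_action[OF that(2,1)] lp.nondegenerate[of "right_action R C p w a"] lp.p_zero_right by metis
  have "filter_base ?B"
  proof -
    have "\<exists>N''\<in>?B. N'' \<subseteq> ?N S \<inter> ?N T" if "finite S" "S \<subseteq> carrier C" "finite T" "T \<subseteq> carrier C" for S T
    proof (rule bexI[of _ "?N (S \<union> T)"])
      show "?N (S \<union> T) \<in> ?B" using that by (intro CollectI exI[of _ "S \<union> T"]) auto
    qed auto
    then show ?thesis unfolding filter_base_def by blast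
  qed
  then show ?thesis
    unfolding lp.linear_weak_topology_eq right_adic_topology_def
  proof (intro lp.AR.linear_topology_eqI lp.perps_filter_base)
    fix N assume "N \<in> lp.perps"
    then obtain T where T: "finite T" "T \<subseteq> carrier C" "N = lp.perp T" by (auto simp: lp.perps_def)
    have "?N T \<subseteq> lp.perp T"
    proof
      fix a assume a: "a \<in> ?N T"
      then have "p (a \<otimes>\<^bsub>A\<^esub> \<one>\<^bsub>A\<^esub>) t = \<zero>" if "t \<in> T" for t using zero_iff[of t a] that T(2) by blast
      then show "a \<in> lp.perp T" using a by (simp add: lp.perp_def)
    qed
    then show "\<exists>N'\<in>?B. N' \<subseteq> N" using T by blast
  next
    fix N assume "N \<in> ?B"
    then obtain W where W: "finite W" "W \<subseteq> carrier C" "N = ?N W" by blast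
    have "\<exists>T. finite T \<and> T \<subseteq> carrier C \<and> (\<forall>a\<in>lp.perp T. right_action R C p w a = \<zero>\<^bsub>C\<^esub>)"
      if "w \<in> W" for w
    proof -
      have w: "w \<in> carrier C" using that W by auto
      obtain T where T: "finite T" "T \<subseteq> carrier C"
        "\<forall>a\<in>carrier A. \<forall>b\<in>carrier A. (\<forall>t\<in>T. p a t = \<zero>) \<longrightarrow> p (a \<otimes>\<^bsub>A\<^esub> b) w = \<zero>"
        using lp.mult_continuous_left[OF w] by blast
      then have "\<forall>a\<in>lp.perp T. right_action R C p w a = \<zero>\<^bsub>C\<^esub>" using zero_iff[OF w] by (simp add: lp.perp_def)
      then show ?thesis using T by blast
    qed
    then obtain T where T: "\<And>w. w \<in> W \<Longrightarrow> finite (T w)" "\<And>w. w \<in> W \<Longrightarrow> T w \<subseteq> carrier C"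
      "\<And>w a. w \<in> W \<Longrightarrow> a \<in> lp.perp (T w) \<Longrightarrow> right_action R C p w a = \<zero>\<^bsub>C\<^esub>" by metis
    have "lp.perp (\<Union>w\<in>W. T w) \<subseteq> N"
      unfolding W(3) using T(3) by (auto simp: lp.perp_def)
    moreover have "lp.perp (\<Union>w\<in>W. T w) \<in> lp.perps"
      unfolding lp.perps_def using T(1,2) W(1) by blast
    ultimately show "\<exists>N'\<in>lp.perps. N' \<subseteq> N" by blast
  qed
qed

lemma coreflexive_imp_locally_finite_rational:
  assumes noeth: "noetherian_ring R" and cor: "coreflexive R A C p"
  shows "locally_finite_imp_rational TYPE('x) R A C p"
  unfolding locally_finite_imp_rational_def
proof (intro allI impI)
  fix X :: "('a, 'x) module"
  assume X: "left_module A X" and "locally_finite R A X"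
  then show "rational R A C p X"
    unfolding rational_iff_discrete[OF X] by (intro ballI lp.coreflexive_imp_discrete[OF noeth cor])
qed

lemma coreflexive_imp_Loc_eq_sigma:
  assumes noeth: "noetherian_ring R" and cor: "coreflexive R A C p"
  shows "Loc_eq_sigma TYPE('x) R A C p"
  unfolding Loc_eq_sigma_def
proof (intro Collect_cong conj_cong refl)
  fix X :: "('a, 'x) module" assume X: "left_module A X"
  show "locally_finite R A X \<longleftrightarrow> subgenerated_by A (coalgebra_left_module R C p) X"
    unfolding subgenerated_iff_discrete[OF X]
    using lp.coreflexive_imp_discrete[OF noeth cor X] lp.discrete_imp_locally_finite[OF noeth X] by blast
qed

lemma locally_finite_rational_imp_coreflexive:
  assumes noeth: "noetherian_ring R" and "locally_finite_imp_rational TYPE('a set) R A C p"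
  shows "coreflexive R A C p"
  by (rule lp.locally_finite_discrete_imp_coreflexive[OF noeth])
    (use assms(2) rational_iff_discrete in \<open>auto simp: locally_finite_imp_rational_def\<close>)

lemma Loc_eq_sigma_imp_coreflexive:
  assumes noeth: "noetherian_ring R" and loc: "Loc_eq_sigma TYPE('a set) R A C p"
  shows "coreflexive R A C p"
proof (rule lp.locally_finite_discrete_imp_coreflexive[OF noeth])
  fix X :: "('a, 'a set) module" and x
  assume X: "left_module A X" and "locally_finite R A X" and x: "x \<in> carrier X"
  then have "X \<in> {X. left_module A X \<and> subgenerated_by A (coalgebra_left_module R C p) X}"
    using loc unfolding Loc_eq_sigma_def by blast
  then show "lp.discrete_element X x" using subgenerated_imp_discrete[OF X _ x] by blast
qed

end

section \<open>Coreflexive pairings\<close>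

theorem theorem5p17:
  fixes R :: "'r ring" and A :: "('r, 'a) module" and C :: "('r, 'c) coalg"
    and p :: "'a \<Rightarrow> 'c \<Rightarrow> 'r"
  assumes "cring R" and "\<one>\<^bsub>R\<^esub> \<noteq> \<zero>\<^bsub>R\<^esub>" and "noetherian_ring R"
    and "measuring_alpha_pairing R A C p"
  shows
    "(coreflexive R A C p \<longrightarrow> chi A p ` carrier C = finite_dual R A)
     \<and>
     (artinian_ring R \<longrightarrow>
        (coreflexive R A C p \<longleftrightarrow>
           (\<forall>I. cofinite_ideal R A I \<longrightarrow> closedin (linear_weak_topology R A C p) I)) \<and>
        linear_weak_topology R A C p = right_adic_topology R A C p)
     \<and>
     (cofinitely_cogenerated R A \<longrightarrow>
        (coreflexive R A C p \<longleftrightarrow> chi A p ` carrier C = finite_dual R A) \<and>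
        (coreflexive R A C p \<longleftrightarrow> locally_finite_imp_rational TYPE('a set) R A C p) \<and>
        (coreflexive R A C p \<longleftrightarrow> Loc_eq_sigma TYPE('a set) R A C p) \<and>
        (coreflexive R A C p \<longrightarrow> locally_finite_imp_rational TYPE('x) R A C p) \<and>
        (coreflexive R A C p \<longrightarrow> Loc_eq_sigma TYPE('x) R A C p))"
proof -
  interpret measuring_alpha_pairing R A C p by fact
  note noeth = \<open>noetherian_ring R\<close>
  show ?thesis
  proof (intro conjI impI)
    show "chi A p ` carrier C = finite_dual R A" if "coreflexive R A C p"
      by (rule lp.coreflexive_imp_finite_dual[OF noeth that])
    show "coreflexive R A C p \<longleftrightarrow>
        (\<forall>I. cofinite_ideal R A I \<longrightarrow> closedin (linear_weak_topology R A C p) I)" if "artinian_ring R"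
      by (rule lp.artinian_coreflexive_iff[OF noeth that])
    show "linear_weak_topology R A C p = right_adic_topology R A C p"
      by (rule right_adic_topology_eq)
    show "coreflexive R A C p \<longleftrightarrow> chi A p ` carrier C = finite_dual R A" if "cofinitely_cogenerated R A"
      using lp.coreflexive_imp_finite_dual[OF noeth]
        lp.cogenerated_finite_dual_imp_coreflexive[OF noeth that] by (rule iffI)
    show "coreflexive R A C p \<longleftrightarrow> locally_finite_imp_rational TYPE('a set) R A C p"
      using coreflexive_imp_locally_finite_rational[OF noeth]
        locally_finite_rational_imp_coreflexive[OF noeth] by (rule iffI)
    show "coreflexive R A C p \<longleftrightarrow> Loc_eq_sigma TYPE('a set) R A C p"
      using coreflexive_imp_Loc_eq_sigma[OF noeth] Loc_eq_sigma_imp_coreflexive[OF noeth] by (rule iffI)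
    show "locally_finite_imp_rational TYPE('x) R A C p" if "coreflexive R A C p"
      by (rule coreflexive_imp_locally_finite_rational[OF noeth that])
    show "Loc_eq_sigma TYPE('x) R A C p" if "coreflexive R A C p"
      by (rule coreflexive_imp_Loc_eq_sigma[OF noeth that])
  qed
qed

end
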